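(* Let $f,h_1,\ldots,h_{m_1},g_1,\ldots,g_{m_2}\in\mathbb{R}[x]$, $x=(x_1,\ldots,x_n)$, and consider the problem of minimizing $f(x)$ over $$K=\{x\in\mathbb{R}^n:\ h_i(x)=0\ (1\le i\le m_1),\ g_j(x)\ge 0\ (1\le j\le m_2)\}.$$ Suppose that the archimedean condition holds for the tuples $h=(h_1,\ldots,h_{m_1})$ and $g=(g_1,\ldots,g_{m_2})$. If the constraint qualification condition, the strict complementarity condition and the second order sufficiency condition hold at every global minimizer of $f$ on $K$, then Lasserre's hierarchy has finite convergence, i.e. $f_k=f_{\min}$ for some $k\in\mathbb{N}$.
   Context: Either $m_1$ or $m_2$ may be $0$. Put $g_0:=1$. $\Sigma\mathbb{R}[x]^2$ is the set of polynomials that are finite sums of squares (SOS) of real polynomials. For $k\in\mathbb{N}$ let $$\langle h\rangle_{2k}=\Big\{\sum_{i=1}^{m_1}\phi_i h_i:\ \phi_i\in\mathbb{R}[x],\ \deg(\phi_i h_i)\le 2k\Big\},\qquad Q_k(g)=\Big\{\sum_{j=0}^{m_2}\sigma_j g_j:\ \sigma_j\in\Sigma\mathbb{R}[x]^2,\ \deg(\sigma_j g_j)\le 2k\Big\}.$$ Lasserre's hierarchy is the sequence of problems: maximize $\gamma$ subject to $f-\gamma\in\langle h\rangle_{2k}+Q_k(g)$; its optimal value (supremum) is denoted $f_k$. $f_{\min}$ denotes the minimum value of $f$ on $K$. The archimedean condition: there are $t\in\mathbb{N}$ and $R>0$ with $R-\sum_{i=1}^n x_i^2\in\langle h\rangle_{2t}+Q_t(g)$.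 Optimality conditions at a (local or global) minimizer $u$, where $J(u)=\{j_1,\ldots,j_r\}=\{j: g_j(u)=0\}$ is the set of active inequality constraints: Constraint qualification condition: the gradients $\nabla h_1(u),\ldots,\nabla h_{m_1}(u),\nabla g_{j_1}(u),\ldots,\nabla g_{j_r}(u)$ are linearly independent. When it holds there exist (unique) Lagrange multipliers $\lambda_i,\mu_j\in\mathbb{R}$ with $\nabla f(u)=\sum_{i=1}^{m_1}\lambda_i\nabla h_i(u)+\sum_{j=1}^{m_2}\mu_j\nabla g_j(u)$, $\mu_jg_j(u)=0$ and $\mu_j\ge 0$ for all $j$. Strict complementarity condition: $\mu_j+g_j(u)>0$ for all $j=1,\ldots,m_2$ (for these multipliers). Second order sufficiency condition: with $L(x)=f(x)-\sum_{i=1}^{m_1}\lambda_ih_i(x)-\sum_{j\in J(u)}\mu_jg_j(x)$ and $G(u)$ the matrix with rows $\nabla h_1(u)^T,\ldots,\nabla h_{m_1}(u)^T,\nabla g_{j_1}(u)^T,\ldots,\nabla g_{j_r}(u)^T$, one has $v^T\nabla_x^2L(u)v>0$ for all $0\ne v$ in the null space of $G(u)$. *)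

theory Defs
  imports "HOL-Analysis.Analysis" "HOL-Library.Poly_Mapping" "HOL-Library.Set_Algebras"
begin

text \<open>
  The ring of real polynomials in variables indexed by the finite type \<open>'n\<close> (so that the number
  of variables is \<open>CARD('n)\<close>): finitely supported maps from exponent vectors to coefficients,
  with the convolution product of \<^theory>\<open>HOL-Library.Poly_Mapping\<close>.
\<close>

type_synonym 'n rpoly = "('n \<Rightarrow>\<^sub>0 nat) \<Rightarrow>\<^sub>0 real"

definition pconst :: "real \<Rightarrow> 'n rpoly" where
  "pconst c = Poly_Mapping.single 0 c"

definition pvar :: "'n \<Rightarrow> 'n rpoly" where
  "pvar i = Poly_Mapping.single (Poly_Mapping.single i 1) 1"

definition peval :: "'n::finite rpoly \<Rightarrow> real ^ 'n \<Rightarrow> real" where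
  "peval p x = (\<Sum>m\<in>Poly_Mapping.keys p.
     Poly_Mapping.lookup p m * (\<Prod>i\<in>UNIV. (x $ i) ^ Poly_Mapping.lookup m i))"

text \<open>Total degree; the zero polynomial gets degree 0, which is harmless in bounds \<open>\<le> 2 * k\<close>.\<close>

definition total_deg :: "'n::finite rpoly \<Rightarrow> nat" where
  "total_deg p =
     Max (insert 0 ((\<lambda>m. \<Sum>i\<in>UNIV. Poly_Mapping.lookup m i) ` Poly_Mapping.keys p))"

text \<open>
  Formal partial derivative. The truncated subtraction of exponents is harmless: monomials not
  containing the variable get coefficient 0.
\<close>

definition partial_deriv :: "'n \<Rightarrow> 'n::finite rpoly \<Rightarrow> 'n rpoly" where
  "partial_deriv i p = (\<Sum>m\<in>Poly_Mapping.keys p.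
     Poly_Mapping.single (m - Poly_Mapping.single i 1)
       (of_nat (Poly_Mapping.lookup m i) * Poly_Mapping.lookup p m))"

definition gradient :: "'n::finite rpoly \<Rightarrow> real ^ 'n \<Rightarrow> real ^ 'n" where
  "gradient p u = (\<chi> i. peval (partial_deriv i p) u)"

definition hessian :: "'n::finite rpoly \<Rightarrow> real ^ 'n \<Rightarrow> real ^ 'n ^ 'n" where
  "hessian p u = (\<chi> i j. peval (partial_deriv i (partial_deriv j p)) u)"

definition sos :: "'n::finite rpoly set" where
  "sos = {\<Sum>q\<leftarrow>qs. q ^ 2 | qs. True}"

text \<open>
  A constraint tuple \<open>h\<^sub>1, \<dots>, h\<^sub>m\<close> is given by its length \<open>m\<close> (possibly 0) and a function \<open>h\<close> on
  indices, of which only the values on \<open>{1..m}\<close> matter. In the quadratic module the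
  value at index 0 is overridden by the convention \<open>g\<^sub>0 = 1\<close>.
\<close>

definition trunc_ideal :: "nat \<Rightarrow> nat \<Rightarrow> (nat \<Rightarrow> 'n::finite rpoly) \<Rightarrow> 'n rpoly set" where
  "trunc_ideal d m h =
     {\<Sum>i=1..m. \<phi> i * h i | \<phi>. \<forall>i\<in>{1..m}. total_deg (\<phi> i * h i) \<le> d}"

definition trunc_qmodule :: "nat \<Rightarrow> nat \<Rightarrow> (nat \<Rightarrow> 'n::finite rpoly) \<Rightarrow> 'n rpoly set" where
  "trunc_qmodule k m g =
     {\<Sum>j=0..m. \<sigma> j * (g(0 := 1)) j | \<sigma>.
        \<forall>j\<in>{0..m}. \<sigma> j \<in> sos \<and> total_deg (\<sigma> j * (g(0 := 1)) j) \<le> 2 * k}"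

definition feasible_set ::
    "nat \<Rightarrow> (nat \<Rightarrow> 'n::finite rpoly) \<Rightarrow> nat \<Rightarrow> (nat \<Rightarrow> 'n rpoly) \<Rightarrow> (real ^ 'n) set" where
  "feasible_set m1 h m2 g =
     {x. (\<forall>i\<in>{1..m1}. peval (h i) x = 0) \<and> (\<forall>j\<in>{1..m2}. peval (g j) x \<ge> 0)}"

definition global_minimizer :: "'n::finite rpoly \<Rightarrow> (real ^ 'n) set \<Rightarrow> real ^ 'n \<Rightarrow> bool" where
  "global_minimizer f K u \<longleftrightarrow> u \<in> K \<and> (\<forall>x\<in>K. peval f u \<le> peval f x)"

text \<open>
  Optimal values are extended reals, so that infeasible (\<open>-\<infinity>\<close>) and unbounded (\<open>\<infinity>\<close>) relaxations,
  and an empty feasible set (\<open>\<infinity>\<close>), are covered by the usual conventions.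
\<close>

definition f_min :: "'n::finite rpoly \<Rightarrow> (real ^ 'n) set \<Rightarrow> ereal" where
  "f_min f K = (INF x\<in>K. ereal (peval f x))"

definition lasserre_value ::
    "nat \<Rightarrow> 'n::finite rpoly \<Rightarrow> nat \<Rightarrow> (nat \<Rightarrow> 'n rpoly) \<Rightarrow> nat \<Rightarrow> (nat \<Rightarrow> 'n rpoly) \<Rightarrow> ereal" where
  "lasserre_value k f m1 h m2 g =
     (SUP \<gamma>\<in>{\<gamma>. f - pconst \<gamma> \<in> trunc_ideal (2 * k) m1 h + trunc_qmodule k m2 g}. ereal \<gamma>)"

definition archimedean ::
    "nat \<Rightarrow> (nat \<Rightarrow> 'n::finite rpoly) \<Rightarrow> nat \<Rightarrow> (nat \<Rightarrow> 'n rpoly) \<Rightarrow> bool" where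
  "archimedean m1 h m2 g \<longleftrightarrow> (\<exists>t. \<exists>R>0.
     pconst R - (\<Sum>i\<in>UNIV. pvar i ^ 2) \<in> trunc_ideal (2 * t) m1 h + trunc_qmodule t m2 g)"

definition active :: "nat \<Rightarrow> (nat \<Rightarrow> 'n::finite rpoly) \<Rightarrow> real ^ 'n \<Rightarrow> nat set" where
  "active m2 g u = {j\<in>{1..m2}. peval (g j) u = 0}"

text \<open>
  Linear independence of the gradients as a family (hence the injectivity clause), indexed by
  the disjoint sum of the equality constraints and the active inequality constraints.
\<close>

definition constraint_qualification ::
    "nat \<Rightarrow> (nat \<Rightarrow> 'n::finite rpoly) \<Rightarrow> nat \<Rightarrow> (nat \<Rightarrow> 'n rpoly) \<Rightarrow> real ^ 'n \<Rightarrow> bool" where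
  "constraint_qualification m1 h m2 g u \<longleftrightarrow>
     (let I = {1..m1} <+> active m2 g u;
          G = case_sum (\<lambda>i. gradient (h i) u) (\<lambda>j. gradient (g j) u)
      in inj_on G I \<and> independent (G ` I))"

definition lagrange_multipliers ::
    "'n::finite rpoly \<Rightarrow> nat \<Rightarrow> (nat \<Rightarrow> 'n rpoly) \<Rightarrow> nat \<Rightarrow> (nat \<Rightarrow> 'n rpoly) \<Rightarrow> real ^ 'n
      \<Rightarrow> (nat \<Rightarrow> real) \<Rightarrow> (nat \<Rightarrow> real) \<Rightarrow> bool" where
  "lagrange_multipliers f m1 h m2 g u lam mu \<longleftrightarrow>
     gradient f u =
       (\<Sum>i=1..m1. lam i *\<^sub>R gradient (h i) u) + (\<Sum>j=1..m2. mu j *\<^sub>R gradient (g j) u) \<and>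
     (\<forall>j\<in>{1..m2}. mu j * peval (g j) u = 0 \<and> mu j \<ge> 0)"

definition strict_complementarity ::
    "nat \<Rightarrow> (nat \<Rightarrow> 'n::finite rpoly) \<Rightarrow> real ^ 'n \<Rightarrow> (nat \<Rightarrow> real) \<Rightarrow> bool" where
  "strict_complementarity m2 g u mu \<longleftrightarrow> (\<forall>j\<in>{1..m2}. mu j + peval (g j) u > 0)"

definition lagrangian ::
    "'n::finite rpoly \<Rightarrow> nat \<Rightarrow> (nat \<Rightarrow> 'n rpoly) \<Rightarrow> nat \<Rightarrow> (nat \<Rightarrow> 'n rpoly) \<Rightarrow> real ^ 'n
      \<Rightarrow> (nat \<Rightarrow> real) \<Rightarrow> (nat \<Rightarrow> real) \<Rightarrow> 'n rpoly" where
  "lagrangian f m1 h m2 g u lam mu =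
     f - (\<Sum>i=1..m1. pconst (lam i) * h i) - (\<Sum>j\<in>active m2 g u. pconst (mu j) * g j)"

text \<open>The null space of \<open>G(u)\<close> is written out as orthogonality to every row of that matrix.\<close>

definition second_order_sufficiency ::
    "'n::finite rpoly \<Rightarrow> nat \<Rightarrow> (nat \<Rightarrow> 'n rpoly) \<Rightarrow> nat \<Rightarrow> (nat \<Rightarrow> 'n rpoly) \<Rightarrow> real ^ 'n
      \<Rightarrow> (nat \<Rightarrow> real) \<Rightarrow> (nat \<Rightarrow> real) \<Rightarrow> bool" where
  "second_order_sufficiency f m1 h m2 g u lam mu \<longleftrightarrow>
     (\<forall>v. v \<noteq> 0 \<longrightarrow>
        (\<forall>i\<in>{1..m1}. gradient (h i) u \<bullet> v = 0) \<longrightarrow>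
        (\<forall>j\<in>active m2 g u. gradient (g j) u \<bullet> v = 0) \<longrightarrow>
        v \<bullet> (hessian (lagrangian f m1 h m2 g u lam mu) u *v v) > 0)"

text \<open>
  Consistency checks: the formal gradient is the derivative of the evaluation map, and
  \<open>f_min\<close> is the minimum value whenever a global minimizer exists.
\<close>

lemma peval_superset:
  assumes "finite A" "Poly_Mapping.keys p \<subseteq> A"
  shows "peval p x = (\<Sum>m\<in>A.
     Poly_Mapping.lookup p m * (\<Prod>i\<in>UNIV. (x $ i) ^ Poly_Mapping.lookup m i))"
  unfolding peval_def using assms
  by (intro sum.mono_neutral_left) (auto simp: in_keys_iff)

lemma peval_add: "peval (p + q) x = peval p x + peval q x"
proof -
  let ?A = "Poly_Mapping.keys p \<union> Poly_Mapping.keys q"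
  have "Poly_Mapping.keys (p + q) \<subseteq> ?A" by (rule Poly_Mapping.keys_add)
  then show ?thesis
    by (simp add: peval_superset[of ?A] lookup_add sum.distrib algebra_simps)
qed

lemma peval_sum: "peval (\<Sum>a\<in>A. F a) x = (\<Sum>a\<in>A. peval (F a) x)"
  by (induction A rule: infinite_finite_induct) (simp_all add: peval_add, simp_all add: peval_def)

lemma peval_single:
  "peval (Poly_Mapping.single m c) x = c * (\<Prod>i\<in>UNIV. (x $ i) ^ Poly_Mapping.lookup m i)"
  by (cases "c = 0") (simp_all add: peval_def)

lemma has_derivative_peval: "(peval p has_derivative (\<lambda>v. gradient p u \<bullet> v)) (at u)"
proof -
  let ?L = Poly_Mapping.lookup and ?K = "Poly_Mapping.keys p"
  have prod: "(\<Prod>k\<in>UNIV. (u $ k) ^ ?L (m - Poly_Mapping.single i 1) k)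
      = u $ i ^ (?L m i - 1) * (\<Prod>k\<in>UNIV - {i}. (u $ k) ^ ?L m k)" for m :: "'a \<Rightarrow>\<^sub>0 nat" and i
    by (subst prod.remove[of UNIV i])
       (auto simp: lookup_minus lookup_single when_def intro!: prod.cong)
  have "((\<lambda>x. peval p x) has_derivative (\<lambda>v. \<Sum>m\<in>?K. ?L p m *
      (\<Sum>i\<in>UNIV. (of_nat (?L m i) * (v $ i) * u $ i ^ (?L m i - 1)) *
        (\<Prod>k\<in>UNIV - {i}. (u $ k) ^ ?L m k)))) (at u)"
    unfolding peval_def
    by (auto intro!: derivative_eq_intros bounded_linear_imp_has_derivative
          bounded_linear_vec_nth has_derivative_power
          simp: algebra_simps)
  moreover have "(\<lambda>v. \<Sum>m\<in>?K. ?L p m *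
      (\<Sum>i\<in>UNIV. (of_nat (?L m i) * (v $ i) * u $ i ^ (?L m i - 1)) *
        (\<Prod>k\<in>UNIV - {i}. (u $ k) ^ ?L m k))) = (\<lambda>v. gradient p u \<bullet> v)"
    unfolding gradient_def inner_vec_def partial_deriv_def peval_sum peval_single prod
    by (simp add: sum_distrib_left sum_distrib_right)
       (subst sum.swap, simp add: algebra_simps)
  ultimately show ?thesis by simp
qed

lemma f_min_eq:
  assumes "global_minimizer f K u"
  shows "f_min f K = ereal (peval f u)"
  using assms unfolding f_min_def global_minimizer_def
  by (intro antisym INF_greatest INF_lower2[of u]) auto

end

theory Submission
  imports Defs
begin

text \<open>
  Let \<open>M\<close> be the archimedean quadratic module generated by the constraints and assume
  \<open>f\<^sub>m\<^sub>i\<^sub>n = 0\<close>. It suffices to show \<open>f \<in> M\<close>, for then one truncation already contains \<open>f\<close>.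

  The optimality conditions allow one to subtract from \<open>f\<close> an element of \<open>M\<close> so that the rest
  vanishes at a given minimizer to second order, with positive definite Hessian in all directions.
  In particular the minimizers are isolated, hence finite in number, and after multiplying the
  subtracted elements by squares of bump polynomials, the rest \<open>F\<close> has this property at all
  minimizers and is positive on the remaining feasible points.

  To show \<open>F \<in> M\<close>, consider the ideal \<open>I\<close> of polynomials vanishing to second order at all
  minimizers; it has an order unit \<open>U\<close> with respect to \<open>M \<inter> I\<close>. If \<open>F \<notin> M\<close>, then a cone in \<open>I\<close> that
  contains \<open>M \<inter> I\<close> and \<open>-F\<close> but not \<open>-U\<close>, and that is maximal among those closed under
  multiplication by squares, yields a functional \<open>\<alpha>\<close> with \<open>\<alpha> F \<le> 0\<close> and a feasible point \<open>x\<close>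
  with \<open>\<alpha> (a p) = a(x) \<alpha> p\<close>. Either \<open>\<alpha>\<close> is evaluation at \<open>x\<close> up to a positive factor, or \<open>x\<close> is
  a minimizer and \<open>\<alpha>\<close> pairs Hessians at \<open>x\<close> with a nonzero positive semidefinite matrix; in both
  cases \<open>\<alpha> F > 0\<close>, a contradiction. For constraints without feasible points this
  is Putinar's theorem and gives infinite values.
\<close>

section \<open>Evaluation and Taylor expansion of polynomials\<close>

lemma pconst_0 [simp]: "pconst 0 = 0"
  and pconst_1 [simp]: "pconst 1 = 1"
  and pconst_add: "pconst (a + b) = pconst a + pconst b"
  and pconst_diff: "pconst (a - b) = pconst a - pconst b"
  and pconst_uminus: "pconst (- a) = - pconst a"
  and pconst_mult: "pconst (a * b) = pconst a * pconst b"
  by (simp_all add: pconst_def single_add single_diff single_uminus mult_single)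

lemma pconst_power: "pconst (a ^ k) = pconst a ^ k"
  by (induction k) (simp_all add: pconst_mult)

lemma pconst_numeral [simp]: "pconst (numeral n) = numeral n"
  by (simp add: pconst_def)

lemma pconst_inverse_cancel: "c \<noteq> 0 \<Longrightarrow> pconst (1 / c) * (pconst c * p) = p"
  by (simp flip: mult.assoc pconst_mult)

lemma pconst_eq_square: "c \<ge> 0 \<Longrightarrow> pconst c = (pconst (sqrt c))\<^sup>2"
  by (simp flip: pconst_power)

lemma peval_pconst [simp]: "peval (pconst c) x = c"
  by (simp add: pconst_def peval_single)

lemma peval_0 [simp]: "peval 0 x = 0"
  by (simp add: peval_def)

lemma peval_1 [simp]: "peval 1 x = 1"
  using peval_pconst[of 1 x] by simp

lemma peval_pvar [simp]: "peval (pvar i) x = x $ i"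
proof -
  have "(\<Prod>k\<in>UNIV. (x $ k) ^ Poly_Mapping.lookup (Poly_Mapping.single i (1::nat)) k)
      = (\<Prod>k\<in>UNIV. if k = i then x $ k else 1)"
    by (intro prod.cong) (auto simp: lookup_single when_def)
  then show ?thesis by (simp add: pvar_def peval_single)
qed

lemma poly_sum_singles:
  "p = (\<Sum>m\<in>Poly_Mapping.keys p. Poly_Mapping.single m (Poly_Mapping.lookup p m))"
  by (intro poly_mapping_eqI)
     (auto simp: lookup_sum lookup_single when_def in_keys_iff sum.delta)

lemma peval_mult: "peval (p * q) x = peval p x * peval q x"
proof -
  have mon: "peval (Poly_Mapping.single a c * Poly_Mapping.single b d) x
      = peval (Poly_Mapping.single a c) x * peval (Poly_Mapping.single b d) x" for a b c d
    by (simp add: mult_single peval_single lookup_add power_add prod.distrib)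
  have "peval (p * q) x = peval ((\<Sum>m\<in>Poly_Mapping.keys p. Poly_Mapping.single m (Poly_Mapping.lookup p m)) *
      (\<Sum>m\<in>Poly_Mapping.keys q. Poly_Mapping.single m (Poly_Mapping.lookup q m))) x"
    by (simp flip: poly_sum_singles)
  also have "\<dots> = peval (\<Sum>m\<in>Poly_Mapping.keys p. Poly_Mapping.single m (Poly_Mapping.lookup p m)) x *
      peval (\<Sum>m\<in>Poly_Mapping.keys q. Poly_Mapping.single m (Poly_Mapping.lookup q m)) x"
    by (simp only: sum_product peval_sum mon)
  finally show ?thesis by (simp flip: poly_sum_singles)
qed

lemma peval_uminus: "peval (- p) x = - peval p x"
  using peval_add[of p "- p" x] by simp

lemma peval_diff: "peval (p - q) x = peval p x - peval q x"
  using peval_add[of "p - q" q x] by simp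

lemma peval_power: "peval (p ^ k) x = peval p x ^ k"
  by (induction k) (simp_all add: peval_mult)

lemma peval_prod: "peval (\<Prod>a\<in>A. F a) x = (\<Prod>a\<in>A. peval (F a) x)"
  by (induction A rule: infinite_finite_induct) (simp_all add: peval_mult)

lemmas peval_simps = peval_add peval_diff peval_uminus peval_mult peval_power peval_sum peval_prod

lemma single_eq_prod_pvar:
  fixes m :: "'n::finite \<Rightarrow>\<^sub>0 nat"
  shows "Poly_Mapping.single m c = pconst c * (\<Prod>i\<in>UNIV. pvar i ^ Poly_Mapping.lookup m i)"
proof -
  have pow: "pvar i ^ k = Poly_Mapping.single (Poly_Mapping.single i k) 1" for i :: 'n and k
    by (induction k) (simp_all add: pvar_def mult_single flip: single_add)
  have prod: "(\<Prod>i\<in>S. Poly_Mapping.single (e i) 1) = Poly_Mapping.single (\<Sum>i\<in>S. e i) (1::real)"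
    if "finite S" for S :: "'n set" and e :: "'n \<Rightarrow> 'n \<Rightarrow>\<^sub>0 nat"
    using that by (induction S) (simp_all add: mult_single)
  have "(\<Sum>i\<in>UNIV. Poly_Mapping.single i (Poly_Mapping.lookup m i)) = m"
    by (intro poly_mapping_eqI) (simp add: lookup_sum lookup_single when_def)
  then show ?thesis
    by (simp add: pow prod pconst_def mult_single)
qed

text \<open>A polynomial is a finite sum of monomials, and \<open>single_eq_prod_pvar\<close>
  factors each monomial into a constant and powers of variables.\<close>

lemma rpoly_induct [case_names const var add mult]:
  fixes p :: "'n::finite rpoly"
  assumes const: "\<And>c. P (pconst c)"
    and var: "\<And>i. P (pvar i)"
    and add: "\<And>p q. P p \<Longrightarrow> P q \<Longrightarrow> P (p + q)"
    and mult: "\<And>p q. P p \<Longrightarrow> P q \<Longrightarrow> P (p * q)"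
  shows "P p"
proof -
  have one: "P 1" and zero: "P 0" using const[of 1] const[of 0] by simp_all
  have pow: "P (pvar i ^ k)" for i k
    by (induction k) (auto intro: one var mult)
  have prod: "finite S \<Longrightarrow> P (\<Prod>i\<in>S. pvar i ^ e i)" for S and e :: "'n \<Rightarrow> nat"
    by (induction S rule: finite_induct) (auto intro: one pow mult)
  have single: "P (Poly_Mapping.single m c)" for m c
    unfolding single_eq_prod_pvar by (intro mult const prod) simp
  have sum: "finite S \<Longrightarrow> P (\<Sum>m\<in>S. Poly_Mapping.single m (e m))" for S and e
    by (induction S rule: finite_induct) (auto intro: zero single add)
  show ?thesis
    by (subst poly_sum_singles) (intro sum finite_keys)
qed

lemma continuous_on_peval [continuous_intros]:
  fixes p :: "'n::finite rpoly"
  assumes "continuous_on S f"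
  shows "continuous_on S (\<lambda>x. peval p (f x))"
proof -
  have "continuous_on UNIV (peval p)"
    by (intro continuous_at_imp_continuous_on ballI) (rule has_derivative_continuous[OF has_derivative_peval])
  then show ?thesis using assms continuous_on_compose2 by blast
qed

lemma isCont_peval: "isCont (peval p) x"
  by (rule has_derivative_continuous[OF has_derivative_peval])

text \<open>Allows gradients to be computed by analytic derivative rules instead of the formal
  definition. Derivatives are unique, and two equal functionals are compared at the difference of
  their representing vectors.\<close>

lemma gradient_eqI:
  assumes "(peval p has_derivative (\<lambda>v. w \<bullet> v)) (at u)"
  shows "gradient p u = w"
proof -
  have "(\<lambda>v. gradient p u \<bullet> v) = (\<lambda>v. w \<bullet> v)"
    using has_derivative_unique[OF has_derivative_peval assms] .
  then have "(gradient p u - w) \<bullet> (gradient p u - w) = 0"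
    by (metis inner_diff_left right_minus_eq)
  then show ?thesis by simp
qed

section \<open>Taylor expansions at a point with polynomial coefficients\<close>

definition dvar :: "real ^ 'n \<Rightarrow> 'n \<Rightarrow> 'n rpoly" where
  "dvar u i = pvar i - pconst (u $ i)"

lemma peval_dvar [simp]: "peval (dvar u i) x = x $ i - u $ i"
  by (simp add: dvar_def peval_diff)

text \<open>Structural induction, where the product case rests on pq - p(u)q(u) = q (p - p(u)) +
  p(u) (q - q(u)). Differentiating the expansion at u then identifies the values of its coefficients
  there.\<close>

lemma first_order_expansion:
  fixes p :: "'n::finite rpoly" and u :: "real ^ 'n"
  obtains s where "p = pconst (peval p u) + (\<Sum>i\<in>UNIV. s i * dvar u i)"
    and "\<And>i. peval (s i) u = gradient p u $ i"
proof -
  have "\<exists>s. p - pconst (peval p u) = (\<Sum>i\<in>UNIV. s i * dvar u i)"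
  proof (induction p rule: rpoly_induct)
    case (const c)
    show ?case by (intro exI[of _ "\<lambda>_. 0"]) simp
  next
    case (var i)
    have "(\<Sum>j\<in>UNIV. (if j = i then 1 else 0) * dvar u j) = dvar u i"
      by (subst sum.remove[of UNIV i]) auto
    then show ?case
      by (intro exI[of _ "\<lambda>j. if j = i then 1 else 0"]) (simp add: dvar_def)
  next
    case (add p q)
    then obtain s t where st: "p - pconst (peval p u) = (\<Sum>i\<in>UNIV. s i * dvar u i)"
      "q - pconst (peval q u) = (\<Sum>i\<in>UNIV. t i * dvar u i)" by blast
    have "(p + q) - pconst (peval (p + q) u)
        = (p - pconst (peval p u)) + (q - pconst (peval q u))"
      by (simp add: peval_add pconst_add)
    also have "\<dots> = (\<Sum>i\<in>UNIV. (s i + t i) * dvar u i)"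
      unfolding st by (simp add: sum.distrib distrib_right)
    finally show ?case by (intro exI[of _ "\<lambda>i. s i + t i"])
  next
    case (mult p q)
    then obtain s t where st: "p - pconst (peval p u) = (\<Sum>i\<in>UNIV. s i * dvar u i)" 
      "q - pconst (peval q u) = (\<Sum>i\<in>UNIV. t i * dvar u i)" by blast
    have "p * q - pconst (peval (p * q) u) = q * (p - pconst (peval p u))
        + pconst (peval p u) * (q - pconst (peval q u))"
      by (simp add: peval_mult pconst_mult algebra_simps)
    also have "\<dots> = (\<Sum>i\<in>UNIV. (q * s i + pconst (peval p u) * t i) * dvar u i)"
      unfolding st by (simp add: sum.distrib sum_distrib_left algebra_simps)
    finally show ?case by (intro exI[of _ "\<lambda>i. q * s i + pconst (peval p u) * t i"])
  qed
  then have "\<exists>s. p = pconst (peval p u) + (\<Sum>i\<in>UNIV. s i * dvar u i)"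
    by (metis add.commute diff_add_cancel)
  then obtain s where s: "p = pconst (peval p u) + (\<Sum>i\<in>UNIV. s i * dvar u i)" by blast
  have ev: "peval p x = peval p u + (\<Sum>i\<in>UNIV. peval (s i) x * (x $ i - u $ i))" for x
  proof -
    have "peval p x = peval (pconst (peval p u) + (\<Sum>i\<in>UNIV. s i * dvar u i)) x"
      using s by simp
    then show ?thesis by (simp add: peval_simps)
  qed
  \<comment> \<open>Terms that differentiate \<open>s i\<close> keep the factor
    \<open>x $ i - u $ i\<close> and vanish at u.\<close>
  have "((\<lambda>x. peval p u + (\<Sum>i\<in>UNIV. peval (s i) x * (x $ i - u $ i))) has_derivative
      (\<lambda>v. (\<Sum>i\<in>UNIV. peval (s i) u * v $ i))) (at u)"
    by (auto intro!: derivative_eq_intros has_derivative_peval bounded_linear_imp_has_derivative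
          bounded_linear_vec_nth)
  then have "(peval p has_derivative (\<lambda>v. (\<chi> i. peval (s i) u) \<bullet> v)) (at u)"
    unfolding ev[abs_def, symmetric] by (simp add: inner_vec_def)
  then have "gradient p u = (\<chi> i. peval (s i) u)" by (rule gradient_eqI)
  then show ?thesis using that[OF s] by simp
qed

text \<open>The coefficients are themselves polynomials, so an expansion is exact and has no
  remainder term. They are not unique, hence the existential quantifiers in the notions built on
  it.\<close>

definition quad_expansion :: "real ^ 'n \<Rightarrow> ('n \<Rightarrow> 'n \<Rightarrow> 'n rpoly) \<Rightarrow> 'n::finite rpoly" where
  "quad_expansion u s = (\<Sum>i\<in>UNIV. \<Sum>j\<in>UNIV. s i j * (dvar u i * dvar u j))"

text \<open>Membership in the square of the maximal ideal at u; \<open>vanish3\<close> is membership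
  in its cube.\<close>

definition vanish2 :: "real ^ 'n \<Rightarrow> 'n::finite rpoly \<Rightarrow> bool" where
  "vanish2 u p \<longleftrightarrow> (\<exists>s. p = quad_expansion u s)"

definition vanish3 :: "real ^ 'n \<Rightarrow> 'n::finite rpoly \<Rightarrow> bool" where
  "vanish3 u p \<longleftrightarrow> (\<exists>s. p = quad_expansion u s \<and> (\<forall>i j. peval (s i j) u = 0))"

definition qform :: "('n::finite \<Rightarrow> 'n \<Rightarrow> real) \<Rightarrow> real ^ 'n \<Rightarrow> real" where
  "qform s v = (\<Sum>i\<in>UNIV. \<Sum>j\<in>UNIV. s i j * (v $ i * v $ j))"

lemma qform_scaleR: "qform s (c *\<^sub>R v) = c\<^sup>2 * qform s v"
  by (simp add: qform_def sum_distrib_left power2_eq_square mult_ac)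

lemma qform_add: "qform (\<lambda>i j. s i j + t i j) v = qform s v + qform t v"
  by (simp add: qform_def distrib_right sum.distrib)

lemma qform_cmult: "qform (\<lambda>i j. c * s i j) v = c * qform s v"
  by (simp add: qform_def sum_distrib_left mult_ac)

text \<open>The form given by the values \<open>s i j\<close> at u is half the Hessian form of p. So
  p and its gradient vanish at u, and the Hessian there is positive definite.\<close>

definition posdef_at :: "real ^ 'n \<Rightarrow> 'n::finite rpoly \<Rightarrow> bool" where
  "posdef_at u p \<longleftrightarrow> (\<exists>s. p = quad_expansion u s \<and>
     (\<forall>v. v \<noteq> 0 \<longrightarrow> 0 < qform (\<lambda>i j. peval (s i j) u) v))"

lemma quad_expansion_add: "quad_expansion u s + quad_expansion u t = quad_expansion u (\<lambda>i j. s i j + t i j)"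
  by (simp add: quad_expansion_def sum.distrib algebra_simps)

lemma quad_expansion_mult: "q * quad_expansion u s = quad_expansion u (\<lambda>i j. q * s i j)"
  by (simp add: quad_expansion_def sum_distrib_left algebra_simps)

lemma peval_quad_expansion:
  "peval (quad_expansion u s) x =
     (\<Sum>i\<in>UNIV. \<Sum>j\<in>UNIV. peval (s i j) x * ((x - u) $ i * (x - u) $ j))"
  by (simp add: quad_expansion_def peval_simps)

lemma vanish2_0: "vanish2 u 0"
  unfolding vanish2_def by (intro exI[of _ "\<lambda>_ _. 0"]) (simp add: quad_expansion_def)

lemma vanish2_add: "vanish2 u p \<Longrightarrow> vanish2 u q \<Longrightarrow> vanish2 u (p + q)"
  by (auto simp: vanish2_def quad_expansion_add)

lemma vanish2_mult_left: "vanish2 u p \<Longrightarrow> vanish2 u (q * p)"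
  by (auto simp: vanish2_def quad_expansion_mult)

lemma vanish2_sum: "(\<And>a. a \<in> A \<Longrightarrow> vanish2 u (F a)) \<Longrightarrow> vanish2 u (\<Sum>a\<in>A. F a)"
  by (induction A rule: infinite_finite_induct) (auto intro: vanish2_0 vanish2_add)

lemma vanish2_imp_zero: "vanish2 u p \<Longrightarrow> peval p u = 0"
  unfolding vanish2_def by (auto simp: peval_quad_expansion)

lemma first_order_expansion_zero:
  fixes p :: "'n::finite rpoly"
  assumes "peval p u = 0"
  obtains s where "p = (\<Sum>i\<in>UNIV. s i * dvar u i)" and "\<And>i. peval (s i) u = gradient p u $ i"
  using first_order_expansion[of p u] assms by (metis add_0 pconst_0)

lemma quad_expansion_product:
  "(\<Sum>i\<in>UNIV. s i * dvar u i) * (\<Sum>i\<in>UNIV. t i * dvar u i) = quad_expansion u (\<lambda>i j. s i * t j)"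
  by (simp add: quad_expansion_def sum_product algebra_simps)

lemma vanish2_mult:
  assumes "peval p u = 0" "peval q u = 0"
  shows "vanish2 u (p * q)"
proof -
  obtain s t where "p = (\<Sum>i\<in>UNIV. s i * dvar u i)" "q = (\<Sum>i\<in>UNIV. t i * dvar u i)"
    using first_order_expansion_zero[OF assms(1)] first_order_expansion_zero[OF assms(2)] by metis
  then show ?thesis
    by (auto simp: vanish2_def quad_expansion_product)
qed

lemma vanish3_0: "vanish3 u 0"
  unfolding vanish3_def by (intro exI[of _ "\<lambda>_ _. 0"]) (simp add: quad_expansion_def)

lemma vanish3_add: "vanish3 u p \<Longrightarrow> vanish3 u q \<Longrightarrow> vanish3 u (p + q)"
  unfolding vanish3_def
  by (elim exE conjE, rule exI, rule conjI, simp only: quad_expansion_add) (simp add: peval_add)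

lemma vanish3_mult: "peval q u = 0 \<Longrightarrow> vanish2 u p \<Longrightarrow> vanish3 u (q * p)"
  unfolding vanish2_def vanish3_def
  by (elim exE conjE, rule exI, rule conjI, simp only: quad_expansion_mult) (simp add: peval_mult)

lemma vanish3_mult_left: "vanish3 u p \<Longrightarrow> vanish3 u (q * p)"
  unfolding vanish3_def
  by (elim exE conjE, rule exI, rule conjI, simp only: quad_expansion_mult) (simp add: peval_mult)

lemma vanish3_uminus: "vanish3 u p \<Longrightarrow> vanish3 u (- p)"
  using vanish3_mult_left[of u p "- 1"] by simp

lemma vanish3_sum: "(\<And>a. a \<in> A \<Longrightarrow> vanish3 u (F a)) \<Longrightarrow> vanish3 u (\<Sum>a\<in>A. F a)"
  by (induction A rule: infinite_finite_induct) (auto intro: vanish3_0 vanish3_add)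

lemma posdef_at_imp_vanish2: "posdef_at u p \<Longrightarrow> vanish2 u p"
  unfolding posdef_at_def vanish2_def by blast

lemma posdef_at_add_vanish3: "posdef_at u p \<Longrightarrow> vanish3 u q \<Longrightarrow> posdef_at u (p + q)"
  unfolding posdef_at_def vanish3_def
  by (elim exE conjE, rule exI, rule conjI, simp only: quad_expansion_add)
     (simp add: peval_add)

text \<open>The coefficients of the first-order expansion vanish at u because the gradient does, so
  each can be expanded once more. The link to the Hessian comes from differentiating twice along the
  line through u in direction v.\<close>

lemma second_order_expansion:
  fixes p :: "'n::finite rpoly"
  assumes "gradient p u = 0"
  obtains s where "p = pconst (peval p u) + quad_expansion u s"
    and "\<And>v. 2 * qform (\<lambda>i j. peval (s i j) u) v = v \<bullet> (hessian p u *v v)"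
proof -
  obtain a where a: "p = pconst (peval p u) + (\<Sum>i\<in>UNIV. a i * dvar u i)" "\<And>i. peval (a i) u = gradient p u $ i"
    using first_order_expansion by blast
  have "\<exists>b. a i = (\<Sum>j\<in>UNIV. b j * dvar u j)" for i
    using first_order_expansion_zero[of "a i" u] a(2) assms by (metis zero_index)
  then obtain s where s: "\<And>i. a i = (\<Sum>j\<in>UNIV. s i j * dvar u j)" by metis
  have p: "p = pconst (peval p u) + quad_expansion u s"
    by (subst a(1)) (simp add: s quad_expansion_def sum_distrib_right sum_distrib_left algebra_simps)
  have "2 * qform (\<lambda>i j. peval (s i j) u) v = v \<bullet> (hessian p u *v v)" for v
  proof -
    \<comment> \<open>Along the line, p takes the value \<open>peval p u + t\<^sup>2 * B t\<close>,
      and \<open>B 0\<close> is the form in question.\<close>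
    define B where "B t = (\<Sum>i\<in>UNIV. \<Sum>j\<in>UNIV. peval (s i j) (u + t *\<^sub>R v) * (v $ i * v $ j))" for t
    define B' where "B' t = (\<Sum>i\<in>UNIV. \<Sum>j\<in>UNIV. (gradient (s i j) (u + t *\<^sub>R v) \<bullet> v) * (v $ i * v $ j))" for t
    have line: "((\<lambda>t. peval q (u + t *\<^sub>R v)) has_real_derivative gradient q (u + t *\<^sub>R v) \<bullet> v) (at t)" for q t
    proof -
      have "((\<lambda>t. u + t *\<^sub>R v) has_derivative (\<lambda>h. h *\<^sub>R v)) (at t)"
        by (auto intro!: derivative_eq_intros)
      from has_derivative_compose[OF this has_derivative_peval]
      have "((\<lambda>t. peval q (u + t *\<^sub>R v)) has_derivative (\<lambda>h. gradient q (u + t *\<^sub>R v) \<bullet> (h *\<^sub>R v))) (at t)" .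
      moreover have "(\<lambda>h. gradient q (u + t *\<^sub>R v) \<bullet> (h *\<^sub>R v)) = (*) (gradient q (u + t *\<^sub>R v) \<bullet> v)"
        by (auto simp: fun_eq_iff)
      ultimately show ?thesis by (simp only: has_field_derivative_def)
    qed
    have dB: "(B has_real_derivative B' t) (at t)" for t
      unfolding B_def B'_def by (auto intro!: derivative_eq_intros line)
    have "(\<lambda>t. peval p (u + t *\<^sub>R v)) = (\<lambda>t. peval p u + t\<^sup>2 * B t)"
      by (rule ext, subst p) (simp add: peval_add peval_quad_expansion B_def sum_distrib_left power2_eq_square algebra_simps)
    moreover have "((\<lambda>t. peval p u + t\<^sup>2 * B t) has_real_derivative (2 * t * B t + t\<^sup>2 * B' t)) (at t)" for t
      by (auto intro!: derivative_eq_intros dB)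
    ultimately have g: "(\<lambda>t. gradient p (u + t *\<^sub>R v) \<bullet> v) = (\<lambda>t. 2 * t * B t + t\<^sup>2 * B' t)"
      using line[of p] DERIV_unique by (metis (no_types, lifting))
    have cB': "isCont B' 0"
    proof -
      have "continuous_on UNIV B'"
        unfolding B'_def gradient_def inner_vec_def by (auto intro!: continuous_intros)
      then show ?thesis by (simp add: continuous_on_eq_continuous_at)
    qed
    \<comment> \<open>The second derivative at 0 is obtained as the limit of a difference quotient,
      which needs only continuity of \<open>B'\<close>.\<close>
    have "((\<lambda>t. (2 * t * B t + t\<^sup>2 * B' t) / t) \<longlongrightarrow> 2 * B 0 + 0 * B' 0) (at 0)"
    proof -
      have "((\<lambda>t. 2 * B t + t * B' t) \<longlongrightarrow> 2 * B 0 + 0 * B' 0) (at 0)"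
        using cB' DERIV_isCont[OF dB] unfolding isCont_def by (intro tendsto_intros) auto
      then show ?thesis
        by (rule filterlim_cong[THEN iffD1, OF refl refl, rotated])
           (auto simp: eventually_at_filter power2_eq_square field_simps)
    qed
    then have d1: "((\<lambda>t. gradient p (u + t *\<^sub>R v) \<bullet> v) has_real_derivative 2 * B 0) (at 0)"
      unfolding g has_field_derivative_iff by simp
    \<comment> \<open>The same derivative, computed from the formal second partial derivatives, is
      the Hessian form.\<close>
    have "((\<lambda>t. gradient p (u + t *\<^sub>R v) \<bullet> v) has_real_derivative
        (\<Sum>j\<in>UNIV. gradient (partial_deriv j p) (u + 0 *\<^sub>R v) \<bullet> v * v $ j)) (at 0)"
      unfolding gradient_def[of p] inner_vec_def[of _ v] vec_lambda_beta
      unfolding inner_real_def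
      by (rule derivative_eq_intros line | simp add: inner_vec_def)+
    with d1 have "2 * B 0 = (\<Sum>j\<in>UNIV. gradient (partial_deriv j p) u \<bullet> v * v $ j)"
      using DERIV_unique by fastforce
    also have "\<dots> = (\<Sum>j\<in>UNIV. \<Sum>i\<in>UNIV. v $ i * (peval (partial_deriv i (partial_deriv j p)) u * v $ j))"
      by (simp add: gradient_def inner_vec_def sum_distrib_right sum_distrib_left algebra_simps)
    also have "\<dots> = v \<bullet> (hessian p u *v v)"
      by (subst sum.swap) (simp add: hessian_def inner_vec_def matrix_vector_mult_def sum_distrib_left)
    finally show ?thesis by (simp add: B_def qform_def)
  qed
  then show ?thesis using that p by blast
qed

text \<open>The value at x is |x - u|^2 times a form whose coefficients are taken at x and whose
  argument is the unit direction of x - u. This form is positive on the compact sphere for x = u,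
  and the tube lemma keeps it positive on the whole sphere for x near u.\<close>

lemma posdef_at_local_pos:
  fixes p :: "'n::finite rpoly"
  assumes "posdef_at u p"
  obtains d where "d > 0" "\<And>x. dist x u < d \<Longrightarrow> x \<noteq> u \<Longrightarrow> peval p x > 0"
proof -
  obtain s where s: "p = quad_expansion u s"
    and pos: "\<And>v. v \<noteq> 0 \<Longrightarrow> 0 < qform (\<lambda>i j. peval (s i j) u) v"
    using assms unfolding posdef_at_def by blast
  define B where "B z = (\<Sum>i\<in>UNIV. \<Sum>j\<in>UNIV. peval (s i j) (fst z) * (snd z $ i * snd z $ j))" for z :: "(real^'n) \<times> (real^'n)"
  let ?S = "sphere (0::real^'n) 1"
  have cB: "continuous_on UNIV B"
    unfolding B_def by (auto intro!: continuous_intros)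
  have "open (B -` {0<..})"
    using cB by (simp add: continuous_on_open_vimage open_greaterThan)
  moreover have "B (u, v) > 0" if "norm v = 1" for v
  proof -
    have "v \<noteq> 0" using that by (metis norm_zero zero_neq_one)
    then show ?thesis using pos by (simp add: B_def qform_def)
  qed
  then have "{u} \<times> ?S \<subseteq> B -` {0<..}" by auto
  moreover have "compact ?S" by simp
  ultimately obtain X where X: "u \<in> X" "open X" "X \<times> ?S \<subseteq> B -` {0<..}"
    using Elementary_Topology.tube_lemma by metis
  then obtain d where d: "d > 0" "ball u d \<subseteq> X" using open_contains_ball by metis
  show ?thesis
  proof (rule that[OF d(1)])
    fix x assume x: "dist x u < d" "x \<noteq> u"
    define v where "v = (x - u) /\<^sub>R norm (x - u)"
    have n: "norm (x - u) > 0" using x by simp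
    have "(x, v) \<in> X \<times> ?S" using x d(2) by (auto simp: v_def dist_commute subset_iff)
    then have "(x, v) \<in> B -` {0<..}" using X(3) by (rule subsetD[rotated])
    then have "B (x, v) > 0" by simp
    moreover have xv: "x - u = norm (x - u) *\<^sub>R v" using n by (simp add: v_def)
    have e: "(x - u) $ i = norm (x - u) * v $ i" for i
      using arg_cong[OF xv, of "\<lambda>z. z $ i"] unfolding vector_scaleR_component real_scaleR_def .
    have "peval p x = norm (x - u) ^ 2 * B (x, v)"
      unfolding s peval_quad_expansion e B_def
      by (simp add: sum_distrib_left power2_eq_square algebra_simps)
    ultimately show "peval p x > 0" using n by simp
  qed
qed

section \<open>Archimedean quadratic modules and states on ideals\<close>

lemma sos_0 [simp]: "0 \<in> sos"
  unfolding sos_def by (auto intro: exI[of _ "[]"])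

lemma sos_square [simp]: "q\<^sup>2 \<in> sos"
  unfolding sos_def by (auto intro!: exI[of _ "[q]"])

lemma sos_1 [simp]: "1 \<in> sos"
  by (rule sos_square[of 1, simplified])

lemma sos_add: "s \<in> sos \<Longrightarrow> t \<in> sos \<Longrightarrow> s + t \<in> sos"
  unfolding sos_def by clarsimp (metis map_append sum_list_append)

lemma sos_induct [consumes 1, case_names zero add]:
  assumes "s \<in> sos" "P 0" "\<And>q s. s \<in> sos \<Longrightarrow> P s \<Longrightarrow> P (q\<^sup>2 + s)"
  shows "P s"
proof -
  obtain qs where "s = (\<Sum>q\<leftarrow>qs. q\<^sup>2)" using assms(1) unfolding sos_def by blast
  moreover have "(\<Sum>q\<leftarrow>qs. q\<^sup>2) \<in> sos \<and> P (\<Sum>q\<leftarrow>qs. q\<^sup>2)"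
    by (induction qs) (auto intro: assms sos_add)
  ultimately show ?thesis by (simp only:)
qed

lemma sos_mult_square: "s \<in> sos \<Longrightarrow> a\<^sup>2 * s \<in> sos"
  by (induction rule: sos_induct)
     (auto simp: distrib_left simp flip: power_mult_distrib intro: sos_add)

lemma sos_pconst_mult: "c \<ge> 0 \<Longrightarrow> s \<in> sos \<Longrightarrow> pconst c * s \<in> sos"
  by (metis pconst_eq_square sos_mult_square)

lemma peval_sos_nonneg: "s \<in> sos \<Longrightarrow> peval s x \<ge> 0"
  by (induction rule: sos_induct) (auto simp: peval_add peval_power)

section \<open>Archimedean quadratic modules\<close>

locale archimedean_quadratic_module =
  fixes M :: "'n::finite rpoly set"
  assumes one: "1 \<in> M"
    and add: "p \<in> M \<Longrightarrow> q \<in> M \<Longrightarrow> p + q \<in> M"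
    and square_mult: "p \<in> M \<Longrightarrow> a\<^sup>2 * p \<in> M"
    and arch: "\<exists>R. pconst R - (\<Sum>i\<in>UNIV. pvar i ^ 2) \<in> M"
begin

lemma square: "a\<^sup>2 \<in> M"
  using square_mult[OF one, of a] by simp

lemma zero: "0 \<in> M"
  using square[of 0] by simp

lemma scale: "c \<ge> 0 \<Longrightarrow> p \<in> M \<Longrightarrow> pconst c * p \<in> M"
  by (metis pconst_eq_square square_mult)

lemma pconst_in: "c \<ge> 0 \<Longrightarrow> pconst c \<in> M"
  using scale[OF _ one] by simp

lemma sum: "(\<And>a. a \<in> A \<Longrightarrow> F a \<in> M) \<Longrightarrow> (\<Sum>a\<in>A. F a) \<in> M"
  by (induction A rule: infinite_finite_induct) (auto intro: zero add)

lemma sos_mult: "s \<in> sos \<Longrightarrow> p \<in> M \<Longrightarrow> s * p \<in> M"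
  by (induction rule: sos_induct) (auto simp: distrib_right intro: zero add square_mult)

text \<open>The archimedean bound on the sum of squared variables bounds each variable. Two-sided
  boundedness survives sums, negation, positive scaling and squaring, and polarization turns squares
  into products, so it reaches all polynomials.\<close>

lemma bounded_both: "\<exists>N>0. pconst N - p \<in> M \<and> pconst N + p \<in> M"
proof -
  define B where "B p \<longleftrightarrow> (\<exists>N>0. pconst N - p \<in> M \<and> pconst N + p \<in> M)" for p
  have B_add: "B (p + q)" if "B p" "B q" for p q
  proof -
    obtain N L where *: "N > 0" "pconst N - p \<in> M" "pconst N + p \<in> M"
      "L > 0" "pconst L - q \<in> M" "pconst L + q \<in> M"
      using \<open>B p\<close> \<open>B q\<close> unfolding B_def by blast
    have "pconst (N + L) - (p + q) \<in> M" "pconst (N + L) + (p + q) \<in> M"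
      using add[OF *(2,5)] add[OF *(3,6)] by (simp_all add: pconst_add algebra_simps)
    then show ?thesis unfolding B_def using * by (metis add_pos_pos)
  qed
  have B_uminus: "B (- p)" if "B p" for p
    using that unfolding B_def by auto
  have B_scale: "B (pconst c * p)" if "B p" "c > 0" for p c
  proof -
    obtain N where *: "N > 0" "pconst N - p \<in> M" "pconst N + p \<in> M"
      using \<open>B p\<close> unfolding B_def by blast
    have "pconst (c * N) - pconst c * p \<in> M" "pconst (c * N) + pconst c * p \<in> M"
      using scale[OF _ *(2), of c] scale[OF _ *(3), of c] \<open>c > 0\<close>
      by (simp_all add: pconst_mult algebra_simps)
    then show ?thesis unfolding B_def using * that by (metis mult_pos_pos)
  qed
  have B_square: "B (p\<^sup>2)" if "B p" for p
  proof -
    obtain N where *: "N > 0" "pconst N - p \<in> M" "pconst N + p \<in> M"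
      using \<open>B p\<close> unfolding B_def by blast
    \<comment> \<open>This combination equals 2N (N^2 - p^2), so bounds on p yield an upper bound on
      its square.\<close>
    have "(pconst N - p)\<^sup>2 * (pconst N + p) + (pconst N + p)\<^sup>2 * (pconst N - p) \<in> M"
      by (intro add square_mult *)
    also have "(pconst N - p)\<^sup>2 * (pconst N + p) + (pconst N + p)\<^sup>2 * (pconst N - p)
        = pconst (2 * N) * ((pconst N)\<^sup>2 - p\<^sup>2)"
      by (simp add: power2_eq_square algebra_simps pconst_mult)
    finally have "pconst (1 / (2 * N)) * (pconst (2 * N) * ((pconst N)\<^sup>2 - p\<^sup>2)) \<in> M"
      by (rule scale[rotated]) (use \<open>N > 0\<close> in simp)
    then have "pconst (N\<^sup>2) - p\<^sup>2 \<in> M"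
      using \<open>N > 0\<close> by (simp add: pconst_inverse_cancel pconst_power)
    moreover have "pconst (N\<^sup>2) + p\<^sup>2 \<in> M"
      by (intro add pconst_in square) simp
    ultimately show ?thesis unfolding B_def using * by (metis zero_less_power)
  qed
  have "B p"
  proof (induction p rule: rpoly_induct)
    case (const c)
    have "pconst (\<bar>c\<bar> + 1) - pconst c \<in> M" "pconst (\<bar>c\<bar> + 1) + pconst c \<in> M"
      by (auto simp flip: pconst_diff pconst_add intro!: pconst_in)
    then show ?case unfolding B_def by (metis abs_ge_zero add_nonneg_pos zero_less_one)
  next
    case (var i)
    obtain R where R: "pconst R - (\<Sum>i\<in>UNIV. pvar i ^ 2) \<in> M" using arch by blast
    have split: "(\<Sum>j\<in>UNIV. pvar j ^ 2) = pvar i ^ 2 + (\<Sum>j\<in>UNIV - {i}. (pvar j)\<^sup>2 :: 'n rpoly)"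
      by (rule sum.remove) auto
    \<comment> \<open>The square of \<open>pvar i - e\<close> supplies the linear term and cancels
      the remaining square; adding \<open>\<bar>R\<bar> - R\<close> makes the constant positive
      whatever the sign of R. The cases e = 1 and e = -1 give the two bounds.\<close>
    have *: "pconst (\<bar>R\<bar> + 1) - 2 * e * pvar i \<in> M" if "e * e = 1" for e
    proof -
      have "(pconst R - (\<Sum>i\<in>UNIV. pvar i ^ 2)) + (\<Sum>j\<in>UNIV - {i}. (pvar j)\<^sup>2) + (pvar i - e)\<^sup>2 
          + pconst (\<bar>R\<bar> - R) \<in> M"
        by (intro add R sum square pconst_in) simp
      also have "(pconst R - (\<Sum>i\<in>UNIV. pvar i ^ 2)) + (\<Sum>j\<in>UNIV - {i}. (pvar j)\<^sup>2) + (pvar i - e)\<^sup>2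
          + pconst (\<bar>R\<bar> - R) = pconst (\<bar>R\<bar> + 1) - 2 * e * pvar i"
        unfolding split by (simp add: power2_eq_square algebra_simps that pconst_add pconst_diff)
      finally show ?thesis .
    qed
    have "B (2 * pvar i)"
      using *[of 1] *[of "- 1"] unfolding B_def
      by (intro exI[of _ "\<bar>R\<bar> + 1"]) (simp add: add_pos_nonneg)
    then have "B (pconst (1/2) * (2 * pvar i))" by (intro B_scale) auto
    moreover have "pconst (1/2) * (2 * pvar i) = (pvar i :: 'n rpoly)"
      using pconst_inverse_cancel[of 2 "pvar i"] by simp
    ultimately show ?case by simp
  next
    case (add p q)
    then show ?case by (rule B_add)
  next
    case (mult p q)
    \<comment> \<open>Polarization: 4pq = (p + q)^2 - (p - q)^2.\<close>
    have "B (pconst (1/4) * ((p + q)\<^sup>2 + - (p + - q)\<^sup>2))"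
      by (intro B_scale B_add B_uminus B_square mult) auto
    also have "pconst (1/4) * ((p + q)\<^sup>2 + - (p + - q)\<^sup>2) = pconst (1/4) * (pconst 4 * (p * q))"
      by (simp add: power2_eq_square algebra_simps pconst_def)
    also have "\<dots> = p * q"
      by (rule pconst_inverse_cancel) simp
    finally show ?case .
  qed
  then show ?thesis unfolding B_def .
qed

lemma bounded: obtains N where "N > 0" "pconst N - p \<in> M"
  using bounded_both[of p] by blast

end

section \<open>States on an ideal with an order unit\<close>

text \<open>\<open>U\<close> takes over the role of the constant 1, which is missing from a proper
  ideal: it bounds every element of \<open>I\<close> modulo \<open>M\<close>, and multiplication by
  it preserves \<open>M\<close>.\<close>

locale order_unit_ideal = archimedean_quadratic_module M for M :: "'n::finite rpoly set" +
  fixes I :: "'n rpoly set" and U :: "'n rpoly"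
  assumes I_add: "p \<in> I \<Longrightarrow> q \<in> I \<Longrightarrow> p + q \<in> I"
    and I_mult: "p \<in> I \<Longrightarrow> a * p \<in> I"
    and U_in_I: "U \<in> I"
    and U_mult: "p \<in> M \<Longrightarrow> p * U \<in> M"
    and order_unit: "p \<in> I \<Longrightarrow> \<exists>N. pconst N * U - p \<in> M"
begin

lemma U_in_M: "U \<in> M"
  using U_mult[OF one] by simp

lemma I_uminus: "p \<in> I \<Longrightarrow> - p \<in> I"
  using I_mult[of p "- 1"] by simp

lemma I_diff: "p \<in> I \<Longrightarrow> q \<in> I \<Longrightarrow> p - q \<in> I"
  using I_add[of p "- q"] I_uminus by simp

lemma order_unit_mono:
  assumes "pconst N * U - p \<in> M" "N \<le> L"
  shows "pconst L * U - p \<in> M"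
proof -
  have "(pconst N * U - p) + pconst (L - N) * U \<in> M"
    using assms by (intro add scale U_in_M) auto
  then show ?thesis by (simp add: pconst_diff algebra_simps)
qed

text \<open>Woermann's trick, with the constant 1 replaced by the order unit.\<close>

lemma in_module_if_multiple_minus_unit:
  assumes F: "F \<in> I" and s: "s \<in> sos" and sF: "s * F - U \<in> M"
  shows "F \<in> M"
proof -
  obtain N1 where N1: "N1 > 0" "pconst N1 - s \<in> M" using bounded .
  obtain N2 where N2: "pconst N2 * U - s\<^sup>2 * F \<in> M" using order_unit I_mult F by blast
  \<comment> \<open>One constant serves for both bounds: on \<open>s\<close> by \<open>2 * k\<close>
    and on \<open>s\<^sup>2 * F\<close> by \<open>k\<close> times \<open>U\<close>.\<close>
  define k where "k = max N1 N2"
  have k: "k > 0" "pconst k * U - s\<^sup>2 * F \<in> M"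
    using N1 order_unit_mono[OF N2] by (auto simp: k_def)
  have "(pconst N1 - s) + pconst (2 * k - N1) \<in> M"
    using N1 by (intro add pconst_in) (auto simp: k_def)
  then have k2: "pconst (2 * k) - s \<in> M" by (simp add: pconst_diff)
  \<comment> \<open>The sum of module elements below expands to \<open>k\<^sup>2\<close> times the
    claimed element, so the multiple of \<open>U\<close> needed to bring F into M drops by
    \<open>1 / k\<close>.\<close>
  have step: "F + pconst (r - 1 / k) * U \<in> M" if r: "r \<ge> 0" "F + pconst r * U \<in> M" for r
  proof -
    have "(pconst k - s)\<^sup>2 * (F + pconst r * U) + pconst (2 * k) * (s * F - U) 
        + (pconst k * U - s\<^sup>2 * F) + pconst r * (s * ((pconst (2 * k) - s) * U)) \<in> M"
      using k(1) by (intro add square_mult[OF r(2)] scale[OF _ sF] k(2)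
          scale[OF r(1)] sos_mult[OF s] U_mult[OF k2]) simp
    also have "(pconst k - s)\<^sup>2 * (F + pconst r * U) + pconst (2 * k) * (s * F - U) 
        + (pconst k * U - s\<^sup>2 * F) + pconst r * (s * ((pconst (2 * k) - s) * U))
        = (pconst k)\<^sup>2 * F + (pconst r * (pconst k)\<^sup>2 - pconst k) * U"
      by (simp add: power2_eq_square pconst_mult algebra_simps)
    also have "\<dots> = pconst (k\<^sup>2) * (F + pconst (r - 1 / k) * U)"
    proof -
      have "pconst (k\<^sup>2) * pconst (r - 1 / k) = (pconst r * (pconst k)\<^sup>2 - pconst k :: 'n rpoly)"
        using k by (simp flip: pconst_mult pconst_power pconst_diff) 
           (simp add: power2_eq_square algebra_simps)
      then show ?thesis
        by (simp only: distrib_left mult.assoc[symmetric]) (simp only: pconst_power)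
    qed
    finally have "pconst (1 / k\<^sup>2) * (pconst (k\<^sup>2) * (F + pconst (r - 1 / k) * U)) \<in> M"
      by (rule scale[rotated]) simp
    then show ?thesis using k by (simp add: pconst_inverse_cancel)
  qed
  obtain r0 where "pconst r0 * U - (- F) \<in> M" using order_unit I_uminus F by blast
  then have "pconst \<bar>r0\<bar> * U - (- F) \<in> M" by (rule order_unit_mono) simp
  then have r0: "F + pconst \<bar>r0\<bar> * U \<in> M" by (simp add: add.commute)
  \<comment> \<open>Iteration of the step, cut off at 0 because the step requires a nonnegative
    coefficient.\<close>
  have "F + pconst (max 0 (\<bar>r0\<bar> - real n / k)) * U \<in> M" for n
  proof (induction n)
    case 0
    then show ?case using r0 by simp
  next
    case (Suc n)
    let ?r = "max 0 (\<bar>r0\<bar> - real n / k)" and ?r' = "max 0 (\<bar>r0\<bar> - real (Suc n) / k)"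
    have "real (Suc n) / k = real n / k + 1 / k" by (simp add: add_divide_distrib)
    moreover have "1 / k > 0" using k by simp
    ultimately have "?r' - (?r - 1 / k) \<ge> 0" by linarith
    then have "(F + pconst (?r - 1 / k) * U) + pconst (?r' - (?r - 1 / k)) * U \<in> M"
      by (intro add step scale U_in_M Suc) auto
    moreover have "(F + pconst a * U) + pconst (b - a) * U = F + pconst b * U" for a b
      by (simp add: pconst_diff algebra_simps)
    ultimately show ?case by metis
  qed
  moreover obtain n where "real n \<ge> \<bar>r0\<bar> * k" using real_arch_simple by blast
  then have "max 0 (\<bar>r0\<bar> - real n / k) = 0" using k by (simp add: field_simps)
  ultimately show ?thesis by (metis add.right_neutral mult_zero_left pconst_0)
qed

text \<open>Candidates for the nonnegative cone of a state with \<alpha> F \<le> 0. Excluding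
  \<open>- U\<close> corresponds to excluding -1 from a proper quadratic module.\<close>

definition cones :: "'n rpoly \<Rightarrow> 'n rpoly set set" where
  "cones F = {Q. Q \<subseteq> I \<and> M \<inter> I \<subseteq> Q \<and> - F \<in> Q \<and> (\<forall>p\<in>Q. \<forall>q\<in>Q. p + q \<in> Q) \<and>
     (\<forall>p\<in>Q. \<forall>a. a\<^sup>2 * p \<in> Q) \<and> - U \<notin> Q}"

text \<open>The cone generated by M \<inter> I and \<open>- F\<close> contains \<open>- U\<close>
  only if \<open>s * F - U\<close> lies in M for some sum of squares s. By
  \<open>in_module_if_multiple_minus_unit\<close> this would put F into M.\<close>

lemma cones_nonempty:
  assumes F: "F \<in> I" "F \<notin> M"
  shows "cones F \<noteq> {}"
proof -
  define Q where "Q = {c - s * F | c s. c \<in> M \<inter> I \<and> s \<in> sos}"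
  have Qmem: "c - s * F \<in> Q" if "c \<in> M" "c \<in> I" "s \<in> sos" for c s
    using that unfolding Q_def by blast
  have "Q \<subseteq> I" unfolding Q_def using F I_mult I_diff by blast
  moreover have "M \<inter> I \<subseteq> Q"
    using Qmem[OF _ _ sos_0] by auto
  moreover have "- F \<in> Q"
    using Qmem[OF zero _ sos_square[of 1]] I_mult[OF F(1), of 0] by simp
  moreover have "p + q \<in> Q" if pq: "p \<in> Q" "q \<in> Q" for p q
  proof -
    obtain c s where c: "p = c - s * F" "c \<in> M \<inter> I" "s \<in> sos" using pq(1) unfolding Q_def by blast
    obtain d t where d: "q = d - t * F" "d \<in> M \<inter> I" "t \<in> sos" using pq(2) unfolding Q_def by blast
    have "p + q = (c + d) - (s + t) * F" unfolding c d by (simp add: algebra_simps)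
    also have "\<dots> \<in> Q" using c d by (intro Qmem add I_add sos_add) auto
    finally show ?thesis .
  qed
  moreover have "a\<^sup>2 * p \<in> Q" if pq: "p \<in> Q" for p a
  proof -
    obtain c s where c: "p = c - s * F" "c \<in> M \<inter> I" "s \<in> sos" using pq unfolding Q_def by blast
    have "a\<^sup>2 * p = a\<^sup>2 * c - (a\<^sup>2 * s) * F" unfolding c by (simp add: algebra_simps)
    also have "\<dots> \<in> Q" using c by (intro Qmem square_mult I_mult sos_mult_square) auto
    finally show ?thesis .
  qed
  moreover have "- U \<notin> Q"
  proof
    assume "- U \<in> Q"
    then obtain c s where c: "- U = c - s * F" "c \<in> M" "s \<in> sos" unfolding Q_def by blast
    then have "c = s * F - U" by (simp add: algebra_simps)
    then show False
      using in_module_if_multiple_minus_unit[OF F(1) c(3)] c(2) F(2) by simp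
  qed
  ultimately have "Q \<in> cones F" unfolding cones_def by simp
  then show ?thesis by blast
qed

lemma maximal_cone_exists:
  assumes "F \<in> I" "F \<notin> M"
  obtains Q where "Q \<in> cones F" "\<And>X. X \<in> cones F \<Longrightarrow> Q \<subseteq> X \<Longrightarrow> X = Q"
proof -
  have "\<exists>Q\<in>cones F. \<forall>X\<in>cones F. Q \<subseteq> X \<longrightarrow> X = Q"
  proof (rule subset_Zorn_nonempty[OF cones_nonempty[OF assms]])
    fix C assume C: "C \<noteq> {}" "subset.chain (cones F) C"
    have sub: "C \<subseteq> cones F" and lin: "\<And>X Y. X \<in> C \<Longrightarrow> Y \<in> C \<Longrightarrow> X \<subseteq> Y \<or> Y \<subseteq> X"
      using C(2) by (auto simp: subset_chain_def)
    have props: "\<And>X. X \<in> C \<Longrightarrow> X \<subseteq> I" "\<And>X. X \<in> C \<Longrightarrow> M \<inter> I \<subseteq> X" "\<And>X. X \<in> C \<Longrightarrow> - F \<in> X"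
      "\<And>X p q. X \<in> C \<Longrightarrow> p \<in> X \<Longrightarrow> q \<in> X \<Longrightarrow> p + q \<in> X"
      "\<And>X p a. X \<in> C \<Longrightarrow> p \<in> X \<Longrightarrow> a\<^sup>2 * p \<in> X" "\<And>X. X \<in> C \<Longrightarrow> - U \<notin> X"
      using sub unfolding cones_def by blast+
    have "p + q \<in> \<Union>C" if "p \<in> \<Union>C" "q \<in> \<Union>C" for p q
    proof -
      obtain X Y where "X \<in> C" "Y \<in> C" "p \<in> X" "q \<in> Y" using \<open>p \<in> \<Union>C\<close> \<open>q \<in> \<Union>C\<close> by blast
      then obtain Z where "Z \<in> C" "p \<in> Z" "q \<in> Z" using lin[of X Y] by blast
      then show ?thesis using props(4) by blast
    qed
    moreover obtain X where "X \<in> C" using C(1) by blast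
    then have "M \<inter> I \<subseteq> \<Union>C" "- F \<in> \<Union>C" using props(2)[of X] props(3)[of X] by auto
    moreover have "\<Union>C \<subseteq> I" using props(1) by (rule Union_least)
    moreover have "- U \<notin> \<Union>C" using props(6) by auto
    moreover have "\<forall>p\<in>\<Union>C. \<forall>a. a\<^sup>2 * p \<in> \<Union>C" using props(5) by auto
    ultimately show "\<Union>C \<in> cones F" unfolding cones_def by simp
  qed
  then show ?thesis using that by blast
qed

text \<open>Otherwise adjoining p and adjoining \<open>- p\<close> would both produce
  \<open>- U\<close>. Combining the two representations so that p cancels shows that Q itself
  already contains \<open>- U\<close>.\<close>

lemma maximal_cone_total:
  assumes Q: "Q \<in> cones F" "\<And>X. X \<in> cones F \<Longrightarrow> Q \<subseteq> X \<Longrightarrow> X = Q" and p: "p \<in> I"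
  shows "p \<in> Q \<or> - p \<in> Q"
proof (rule ccontr)
  assume neg: "\<not> (p \<in> Q \<or> - p \<in> Q)"
  have QI: "Q \<subseteq> I" and MQ: "M \<inter> I \<subseteq> Q" and FQ: "- F \<in> Q" and UQ: "- U \<notin> Q"
    and Qadd: "\<And>p q. p \<in> Q \<Longrightarrow> q \<in> Q \<Longrightarrow> p + q \<in> Q"
    and Qsq: "\<And>p a. p \<in> Q \<Longrightarrow> a\<^sup>2 * p \<in> Q"
    using Q(1) unfolding cones_def by blast+
  have Q0: "0 \<in> Q" using Qsq[OF FQ, of 0] by simp
  have Qsos: "s * q \<in> Q" if "s \<in> sos" "q \<in> Q" for s q
    using that by (induction rule: sos_induct) (auto simp: distrib_right intro: Q0 Qadd Qsq)
  \<comment> \<open>By maximality, the cone generated by Q and an element outside it can fail to be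
    a candidate only by containing \<open>- U\<close>.\<close>
  have ext: "\<exists>q\<in>Q. \<exists>s\<in>sos. - U = q + s * x" if x: "x \<in> I" "x \<notin> Q" for x
  proof -
    define X where "X = {q + s * x | q s. q \<in> Q \<and> s \<in> sos}"
    have Xmem: "q + s * x \<in> X" if "q \<in> Q" "s \<in> sos" for q s using that unfolding X_def by blast
    have QX: "Q \<subseteq> X" using Xmem[OF _ sos_0] by auto
    have "x \<in> X" using Xmem[OF Q0 sos_square[of 1]] by simp
    then have "X \<notin> cones F" using Q(2) QX x by blast
    moreover have "X \<subseteq> I" unfolding X_def using QI x I_add I_mult by blast
    moreover have "p + q \<in> X" if pq: "p \<in> X" "q \<in> X" for p q
    proof -
      obtain c s where c: "p = c + s * x" "c \<in> Q" "s \<in> sos" using pq(1) unfolding X_def by blast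
      obtain d t where d: "q = d + t * x" "d \<in> Q" "t \<in> sos" using pq(2) unfolding X_def by blast
      have "p + q = (c + d) + (s + t) * x" unfolding c d by (simp add: algebra_simps)
      also have "\<dots> \<in> X" using c d by (intro Xmem Qadd sos_add) auto
      finally show ?thesis .
    qed
    moreover have "a\<^sup>2 * p \<in> X" if pq: "p \<in> X" for p a
    proof -
      obtain c s where c: "p = c + s * x" "c \<in> Q" "s \<in> sos" using pq unfolding X_def by blast
      have "a\<^sup>2 * p = a\<^sup>2 * c + (a\<^sup>2 * s) * x" unfolding c by (simp add: algebra_simps)
      also have "\<dots> \<in> X" using c by (intro Xmem Qsq sos_mult_square) auto
      finally show ?thesis .
    qed
    ultimately have "- U \<in> X" using subset_trans[OF MQ QX] subsetD[OF QX FQ]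
      unfolding cones_def by simp
    then show ?thesis unfolding X_def by blast
  qed
  obtain q1 t1 where 1: "q1 \<in> Q" "t1 \<in> sos" "- U = q1 + t1 * p" using ext[of p] p neg by blast
  obtain q2 t2 where 2: "q2 \<in> Q" "t2 \<in> sos" "- U = q2 + t2 * (- p)"
    using ext[of "- p"] I_uminus[OF p] neg by blast
  have UQ': "U \<in> Q" using MQ U_in_M U_in_I by blast
  \<comment> \<open>Weighting each representation by the multiplier of the other cancels p.\<close>
  have "t2 * (- U) + t1 * (- U) = t2 * (q1 + t1 * p) + t1 * (q2 + t2 * (- p))"
    by (simp only: 1(3)[symmetric] 2(3)[symmetric])
  then have "- (t1 * U) = t2 * U + t2 * q1 + t1 * q2" by (simp add: algebra_simps)
  also have "\<dots> \<in> Q" by (intro Qadd Qsos 1 2 UQ')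
  finally have tU: "- (t1 * U) \<in> Q" .
  \<comment> \<open>The order unit bound trades \<open>- (t1 * U)\<close> for \<open>t1 * p\<close>,
    and adding \<open>q1\<close> gives the forbidden \<open>- U\<close>.\<close>
  obtain N where N: "pconst N * U - (- p) \<in> M" using order_unit I_uminus[OF p] by blast
  have "pconst \<bar>N\<bar> * U - (- p) \<in> M" by (rule order_unit_mono[OF N]) simp
  moreover have "pconst \<bar>N\<bar> * U - (- p) \<in> I" using I_mult U_in_I I_uminus p by (intro I_diff) auto
  ultimately have "pconst \<bar>N\<bar> * U - (- p) \<in> Q" using MQ by blast
  then have "t1 * (pconst \<bar>N\<bar> * U - (- p)) + (pconst (sqrt \<bar>N\<bar>))\<^sup>2 * (- (t1 * U)) \<in> Q"
    by (intro Qadd Qsos Qsq tU 1)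
  then have "t1 * p \<in> Q"
    by (simp add: pconst_eq_square[symmetric] algebra_simps)
  then have "q1 + t1 * p \<in> Q" by (intro Qadd 1)
  then show False using 1(3) UQ by simp
qed

text \<open>Totality of Q makes every p in I a cut among the real multiples of \<open>U\<close>; the
  state is the supremum of those r with \<open>p - pconst r * U\<close> in Q.\<close>

lemma maximal_cone_state:
  assumes Q: "Q \<in> cones F" "\<And>X. X \<in> cones F \<Longrightarrow> Q \<subseteq> X \<Longrightarrow> X = Q"
  obtains \<alpha> where "\<And>p q. p \<in> I \<Longrightarrow> q \<in> I \<Longrightarrow> \<alpha> (p + q) = \<alpha> p + \<alpha> q"
    and "\<And>p c. p \<in> I \<Longrightarrow> \<alpha> (pconst c * p) = c * \<alpha> p"
    and "\<And>p. p \<in> Q \<Longrightarrow> 0 \<le> \<alpha> p" and "\<alpha> U = (1::real)"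
proof -
  have QI: "Q \<subseteq> I" and MQ: "M \<inter> I \<subseteq> Q" and FQ: "- F \<in> Q" and UQ: "- U \<notin> Q"
    and Qadd: "\<And>p q. p \<in> Q \<Longrightarrow> q \<in> Q \<Longrightarrow> p + q \<in> Q"
    and Qsq: "\<And>p a. p \<in> Q \<Longrightarrow> a\<^sup>2 * p \<in> Q"
    using Q(1) unfolding cones_def by blast+
  have total: "p \<in> Q \<or> - p \<in> Q" if "p \<in> I" for p
    using maximal_cone_total[OF Q that] .
  have Q0: "0 \<in> Q" using Qsq[OF FQ, of 0] by simp
  have Qscale: "pconst c * p \<in> Q" if "c \<ge> 0" "p \<in> Q" for c p
    using that by (metis pconst_eq_square Qsq)
  have U: "U \<in> Q" using MQ U_in_M U_in_I by blast
  \<comment> \<open>A negative multiple of \<open>U\<close> in Q could be rescaled to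
    \<open>- U\<close>.\<close>
  have cU: "c \<ge> 0" if "pconst c * U \<in> Q" for c
  proof (rule ccontr)
    assume "\<not> c \<ge> 0"
    then have "pconst (- 1 / c) * (pconst c * U) \<in> Q" using \<open>\<not> c \<ge> 0\<close> by (intro Qscale[OF _ that]) simp
    also have "pconst (- 1 / c) * (pconst c * U) = - (pconst (1 / c) * (pconst c * U))"
      by (simp add: pconst_uminus)
    finally show False using UQ \<open>\<not> c \<ge> 0\<close> by (simp add: pconst_inverse_cancel)
  qed
  \<comment> \<open>The value is characterized up to every e > 0, since limits of elements of Q are
    not known to stay in Q. Uniqueness of the value then reduces each linearity law to a check of
    \<open>rel\<close>.\<close>
  define rel where "rel p a \<longleftrightarrow>
    (\<forall>e>0. p - pconst (a - e) * U \<in> Q \<and> pconst (a + e) * U - p \<in> Q)" for p a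
  have rel_mono: "a \<le> b" if ab: "rel p a" "rel q b" "q - p \<in> Q" for p q a b
  proof (rule field_le_epsilon)
    fix e :: real assume "e > 0"
    then have "(p - pconst (a - e / 2) * U) + (q - p) + (pconst (b + e / 2) * U - q) \<in> Q"
      using ab unfolding rel_def by (intro Qadd) auto
    also have "(p - pconst (a - e / 2) * U) + (q - p) + (pconst (b + e / 2) * U - q)
        = pconst (b + e / 2 - (a - e / 2)) * U"
      by (simp only: pconst_diff) (simp add: algebra_simps)
    finally show "a \<le> b + e" using cU by fastforce
  qed
  have rel_unique: "a = b" if "rel p a" "rel p b" for p a b
    using rel_mono[OF that] rel_mono[OF that(2,1)] Q0 by simp
  have rel_ex: "\<exists>a. rel p a" if p: "p \<in> I" for p
  proof -
    define S where "S = {r. p - pconst r * U \<in> Q}"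
    have up: "\<exists>N. pconst N * U - q \<in> Q" if "q \<in> I" for q
      using order_unit[OF that] MQ I_diff I_mult U_in_I that by blast
    obtain N where N: "pconst N * U - p \<in> Q" using up p by blast
    obtain L where L: "pconst L * U - (- p) \<in> Q" using up I_uminus p by blast
    have "- L \<in> S" using L by (simp add: S_def pconst_uminus algebra_simps)
    then have ne: "S \<noteq> {}" by blast
    have "r \<le> N" if "r \<in> S" for r
    proof -
      have "(p - pconst r * U) + (pconst N * U - p) \<in> Q"
        using that N unfolding S_def by (intro Qadd) auto
      then have "pconst (N - r) * U \<in> Q" by (simp add: pconst_diff algebra_simps)
      then show ?thesis using cU by fastforce
    qed
    then have bdd: "bdd_above S" by (rule bdd_aboveI)
    have "rel p (Sup S)" unfolding rel_def
    proof (intro allI impI conjI)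
      fix e :: real assume e: "e > 0"
      have "Sup S - e < Sup S" using e by simp
      then obtain r where r: "r \<in> S" "Sup S - e < r" using less_cSupD[OF ne] by blast
      then have "(p - pconst r * U) + pconst (r - (Sup S - e)) * U \<in> Q"
        unfolding S_def by (intro Qadd Qscale U) auto
      then show "p - pconst (Sup S - e) * U \<in> Q"
        by (simp only: pconst_diff) (simp add: algebra_simps)
      have "Sup S + e \<notin> S" using cSup_upper[OF _ bdd] e by fastforce
      then have "- (p - pconst (Sup S + e) * U) \<in> Q"
        using total[of "p - pconst (Sup S + e) * U"] I_diff I_mult U_in_I p unfolding S_def by blast
      then show "pconst (Sup S + e) * U - p \<in> Q" by simp
    qed
    then show ?thesis by blast
  qed
  then obtain \<alpha> where \<alpha>: "\<And>p. p \<in> I \<Longrightarrow> rel p (\<alpha> p)" by metis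
  have eq: "\<alpha> p = a" if "rel p a" "p \<in> I" for p a
    using rel_unique[OF \<alpha> that(1)] that(2) by simp
  have rel_add: "rel (p + q) (a + b)" if ab: "rel p a" "rel q b" for p q a b
    unfolding rel_def
  proof (intro allI impI conjI)
    fix e :: real assume e: "e > 0"
    have "(p - pconst (a - e / 2) * U) + (q - pconst (b - e / 2) * U) \<in> Q"
      using ab e unfolding rel_def by (intro Qadd) auto
    moreover have "pconst (a + b - e) = (pconst (a - e / 2) + pconst (b - e / 2) :: 'n rpoly)"
      by (simp flip: pconst_add)
    ultimately show "p + q - pconst (a + b - e) * U \<in> Q"
      by (simp add: algebra_simps)
    have "(pconst (a + e / 2) * U - p) + (pconst (b + e / 2) * U - q) \<in> Q"
      using ab e unfolding rel_def by (intro Qadd) auto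
    moreover have "pconst (a + b + e) = (pconst (a + e / 2) + pconst (b + e / 2) :: 'n rpoly)"
      by (simp add: algebra_simps flip: pconst_add)
    ultimately show "pconst (a + b + e) * U - (p + q) \<in> Q"
      by (simp add: algebra_simps)
  qed
  have rel_U: "rel (pconst c * U) c" for c
    unfolding rel_def
  proof (intro allI impI conjI)
    fix e :: real assume e: "e > 0"
    have "pconst e * U \<in> Q" using e by (intro Qscale U) auto
    then show "pconst c * U - pconst (c - e) * U \<in> Q" "pconst (c + e) * U - pconst c * U \<in> Q"
      by (simp_all add: pconst_diff pconst_add algebra_simps)
  qed
  have rel_pos: "rel (pconst c * p) (c * a)" if a: "rel p a" and c: "c > 0" for p a c
    unfolding rel_def
  proof (intro allI impI conjI)
    fix e :: real assume e: "e > 0"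
    have "pconst c * (p - pconst (a - e / c) * U) \<in> Q" "pconst c * (pconst (a + e / c) * U - p) \<in> Q"
      using a c e unfolding rel_def by (auto intro!: Qscale)
    moreover have "pconst (c * a - e) = (pconst c * pconst (a - e / c) :: 'n rpoly)"
      "pconst (c * a + e) = (pconst c * pconst (a + e / c) :: 'n rpoly)"
      using c by (simp_all flip: pconst_mult add: right_diff_distrib distrib_left)
    ultimately show "pconst c * p - pconst (c * a - e) * U \<in> Q" 
      "pconst (c * a + e) * U - pconst c * p \<in> Q"
      by (simp_all add: right_diff_distrib mult.assoc)
  qed
  have rel_uminus: "rel (- p) (- a)" if a: "rel p a" for p a
    unfolding rel_def
  proof (intro allI impI conjI)
    fix e :: real assume e: "e > 0"
    have "pconst (a + e) * U - p \<in> Q" "p - pconst (a - e) * U \<in> Q"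
      using a e unfolding rel_def by auto
    then show "- p - pconst (- a - e) * U \<in> Q" "pconst (- a + e) * U - (- p) \<in> Q"
      by (simp_all add: pconst_diff pconst_add pconst_uminus algebra_simps)
  qed
  show ?thesis
  proof (rule that)
    show "\<alpha> (p + q) = \<alpha> p + \<alpha> q" if "p \<in> I" "q \<in> I" for p q
      using that by (intro eq rel_add \<alpha> I_add)
    show "\<alpha> (pconst c * p) = c * \<alpha> p" if p: "p \<in> I" for p c
    proof (rule eq[OF _ I_mult[OF p]])
      consider "c > 0" | "c = 0" | "- c > 0" by linarith
      then show "rel (pconst c * p) (c * \<alpha> p)"
      proof cases
        case 1
        then show ?thesis using rel_pos \<alpha> p by blast
      next
        case 2
        then show ?thesis using rel_U[of 0] by simp
      next
        case 3
        have "rel (- (pconst (- c) * p)) (- ((- c) * \<alpha> p))"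
          using 3 rel_pos \<alpha> p by (intro rel_uminus) blast
        then show ?thesis by (simp add: pconst_uminus)
      qed
    qed
    show "0 \<le> \<alpha> p" if p: "p \<in> Q" for p
      using rel_mono[of 0 0 p "\<alpha> p"] rel_U[of 0] \<alpha> p QI by auto
    show "\<alpha> U = 1" using eq[OF _ U_in_I, of 1] rel_U[of 1] by simp
  qed
qed

text \<open>Maximality among the cones closed under multiplication by squares forces polynomials to
  act on the state through a point of the nonnegativity set.\<close>

theorem separating_state_exists:
  assumes F: "F \<in> I" "F \<notin> M"
  obtains \<alpha> x where "\<And>p q. p \<in> I \<Longrightarrow> q \<in> I \<Longrightarrow> \<alpha> (p + q) = \<alpha> p + \<alpha> q"
    and "\<And>a p. p \<in> I \<Longrightarrow> \<alpha> (a * p) = peval a x * \<alpha> p"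
    and "\<And>p. p \<in> M \<Longrightarrow> p \<in> I \<Longrightarrow> 0 \<le> \<alpha> p"
    and "\<alpha> U = (1::real)" and "\<alpha> F \<le> 0" and "\<And>m. m \<in> M \<Longrightarrow> 0 \<le> peval m x"
proof -
  obtain Q where Q: "Q \<in> cones F" "\<And>X. X \<in> cones F \<Longrightarrow> Q \<subseteq> X \<Longrightarrow> X = Q"
    using maximal_cone_exists[OF F] by blast
  have QI: "Q \<subseteq> I" and MQ: "M \<inter> I \<subseteq> Q" and FQ: "- F \<in> Q"
    and Qadd: "\<And>p q. p \<in> Q \<Longrightarrow> q \<in> Q \<Longrightarrow> p + q \<in> Q"
    and Qsq: "\<And>p a. p \<in> Q \<Longrightarrow> a\<^sup>2 * p \<in> Q"
    using Q(1) unfolding cones_def by blast+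
  obtain \<alpha> where \<alpha>_add: "\<And>p q. p \<in> I \<Longrightarrow> q \<in> I \<Longrightarrow> \<alpha> (p + q) = \<alpha> p + \<alpha> q"
    and \<alpha>_scale: "\<And>p c. p \<in> I \<Longrightarrow> \<alpha> (pconst c * p) = c * \<alpha> p"
    and \<alpha>_nonneg: "\<And>p. p \<in> Q \<Longrightarrow> 0 \<le> \<alpha> p" and \<alpha>_U: "\<alpha> U = (1::real)"
    using maximal_cone_state[OF Q] by blast
  have \<alpha>_uminus: "\<alpha> (- p) = - \<alpha> p" if "p \<in> I" for p
    using \<alpha>_scale[OF that, of "- 1"] by (simp add: pconst_uminus)
  have \<alpha>_diff: "\<alpha> (p - q) = \<alpha> p - \<alpha> q" if "p \<in> I" "q \<in> I" for p q
    using \<alpha>_add[of p "- q"] \<alpha>_uminus[of q] I_uminus that by simp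
  \<comment> \<open>This functional on all polynomials will turn out to be evaluation at the point
    sought.\<close>
  define \<rho> where "\<rho> a = \<alpha> (a * U)" for a
  have aU: "a * U \<in> I" for a by (intro I_mult U_in_I)
  have Q_if_pos: "p \<in> Q" if "p \<in> I" "\<alpha> p > 0" for p
    using maximal_cone_total[OF Q that(1)] \<alpha>_nonneg[of "- p"] \<alpha>_uminus[of p] that by auto
  \<comment> \<open>For \<rho> a = 0 and r > 0 the state is strictly positive on (r - a) U and (r +
    a) U, so both lie in Q. The identity used for bounding squares then yields \<alpha> (a^2 U)
    \<le> r^2 for every r > 0.\<close>
  have sq0: "\<alpha> (a\<^sup>2 * U) = 0" if a: "\<rho> a = 0" for a
  proof (rule antisym)
    show "\<alpha> (a\<^sup>2 * U) \<ge> 0"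
      using MQ U_in_M U_in_I by (intro \<alpha>_nonneg Qsq) blast
    have "\<alpha> (a\<^sup>2 * U) \<le> r\<^sup>2" if r: "r > 0" for r
    proof -
      have "(pconst r - a) * U \<in> Q" "(pconst r + a) * U \<in> Q"
        using a r unfolding \<rho>_def
        by (auto intro!: Q_if_pos I_diff I_add aU simp: left_diff_distrib distrib_right \<alpha>_diff \<alpha>_add \<alpha>_scale \<alpha>_U aU U_in_I)
      then have "(pconst r + a)\<^sup>2 * ((pconst r - a) * U) + (pconst r - a)\<^sup>2 * ((pconst r + a) * U) \<in> Q"
        by (intro Qadd Qsq)
      also have "(pconst r + a)\<^sup>2 * ((pconst r - a) * U) + (pconst r - a)\<^sup>2 * ((pconst r + a) * U)
          = pconst (2 * r) * (pconst (r\<^sup>2) * U - a\<^sup>2 * U)"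
        by (simp add: power2_eq_square pconst_mult algebra_simps)
      finally have "0 \<le> \<alpha> (pconst (2 * r) * (pconst (r\<^sup>2) * U - a\<^sup>2 * U))" by (rule \<alpha>_nonneg)
      also have "\<dots> = 2 * r * (r\<^sup>2 - \<alpha> (a\<^sup>2 * U))"
        by (subst \<alpha>_scale) (auto intro!: I_diff aU simp: \<alpha>_diff \<alpha>_scale \<alpha>_U aU U_in_I)
      finally show ?thesis using r by (simp add: zero_le_mult_iff)
    qed
    then have "\<alpha> (a\<^sup>2 * U) \<le> e" if "e > 0" for e
      using that by (metis real_sqrt_gt_0_iff real_sqrt_pow2 less_imp_le)
    then show "\<alpha> (a\<^sup>2 * U) \<le> 0" by (rule field_le_epsilon[of _ 0, simplified])
  qed
  \<comment> \<open>Since p is dominated by a multiple of \<open>U\<close>, \<alpha> (a^2 p) \<le>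
    0. Nonnegativity of \<alpha> ((a + t)^2 p) for all t then forces the coefficient of the linear
    term in t to vanish.\<close>
  have null: "\<alpha> (a * p) = 0" if a: "\<rho> a = 0" and p: "p \<in> M" "p \<in> I" for a p
  proof -
    obtain N where N: "pconst N * U - p \<in> M" using order_unit p by blast
    have "pconst N * U - p \<in> Q"
      using N MQ I_diff[OF aU p(2)] by blast
    then have "0 \<le> \<alpha> (a\<^sup>2 * (pconst N * U - p))"
      by (intro \<alpha>_nonneg Qsq)
    also have "a\<^sup>2 * (pconst N * U - p) = pconst N * (a\<^sup>2 * U) - a\<^sup>2 * p"
      by (simp add: algebra_simps)
    also have "\<alpha> \<dots> = - \<alpha> (a\<^sup>2 * p)"
      using p(2) by (simp add: \<alpha>_diff \<alpha>_scale sq0[OF a] I_mult aU)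
    finally have le: "\<alpha> (a\<^sup>2 * p) \<le> 0" by simp
    have quad: "0 \<le> 2 * t * \<alpha> (a * p) + t\<^sup>2 * \<alpha> p" for t
    proof -
      have "0 \<le> \<alpha> ((a + pconst t)\<^sup>2 * p)"
        using p MQ by (intro \<alpha>_nonneg Qsq) blast
      also have "(a + pconst t)\<^sup>2 * p = a\<^sup>2 * p + (pconst (2 * t) * (a * p) + pconst (t\<^sup>2) * p)"
        by (simp add: power2_eq_square pconst_mult algebra_simps)
      also have "\<alpha> \<dots> = \<alpha> (a\<^sup>2 * p) + (2 * t * \<alpha> (a * p) + t\<^sup>2 * \<alpha> p)"
        using p(2) by (simp only: \<alpha>_add \<alpha>_scale I_mult I_add)
      finally show ?thesis using le by simp
    qed
    have \<alpha>p: "\<alpha> p \<ge> 0" using p MQ by (intro \<alpha>_nonneg) blast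
    \<comment> \<open>The denominator has an added 1 because \<alpha> p may be 0; this choice turns
      \<open>quad\<close> into (\<alpha> p + 2) t^2 \<le> 0.\<close>
    define t where "t = - \<alpha> (a * p) / (\<alpha> p + 1)"
    have t: "\<alpha> (a * p) = - (\<alpha> p + 1) * t" using \<alpha>p by (simp add: t_def field_simps)
    have "(\<alpha> p + 2) * t\<^sup>2 \<le> 0"
      using quad[of t] unfolding t by (simp add: power2_eq_square algebra_simps)
    then have "t = 0" using \<alpha>p by (simp add: mult_le_0_iff)
    then show ?thesis using t by simp
  qed
  \<comment> \<open>A general element of I becomes an element of M after adding a multiple of
    \<open>U\<close>, on which \<open>a\<close> acts as zero.\<close>
  have null': "\<alpha> (a * p) = 0" if a: "\<rho> a = 0" and p: "p \<in> I" for a p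
  proof -
    obtain N where N: "pconst N * U - (- p) \<in> M" using order_unit I_uminus[OF p] by blast
    have "\<alpha> (a * (pconst N * U - (- p))) = 0"
      using p by (intro null a N I_diff aU I_uminus)
    also have "a * (pconst N * U - (- p)) = pconst N * (a * U) + a * p"
      by (simp add: algebra_simps)
    finally show ?thesis
      using a p by (simp add: \<alpha>_add \<alpha>_scale I_mult aU \<rho>_def)
  qed
  have \<rho>_const: "\<rho> (pconst c) = c" for c by (simp add: \<rho>_def \<alpha>_scale \<alpha>_U U_in_I)
  have \<rho>_add: "\<rho> (a + b) = \<rho> a + \<rho> b" for a b
    by (simp add: \<rho>_def distrib_right \<alpha>_add aU)
  have hom: "\<alpha> (a * p) = \<rho> a * \<alpha> p" if p: "p \<in> I" for a p
  proof -
    \<comment> \<open>Subtracting its own value from \<open>a\<close> reduces to the null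
      case.\<close>
    have "\<rho> (a + pconst (- \<rho> a)) = 0" by (simp add: \<rho>_add \<rho>_const)
    then have "\<alpha> ((a + pconst (- \<rho> a)) * p) = 0" using p by (rule null')
    then show ?thesis using p by (simp only: distrib_right \<alpha>_add \<alpha>_scale I_mult)
  qed
  define x where "x = vec_lambda (\<lambda>i. \<rho> (pvar i))"
  have \<rho>_mult: "\<rho> (a * b) = \<rho> a * \<rho> b" for a b
    using hom[OF aU, of a b] by (simp add: \<rho>_def mult.assoc)
  \<comment> \<open>A ring homomorphism to the reals that fixes constants is evaluation at its
    values on the variables.\<close>
  have \<rho>_eval: "\<rho> a = peval a x" for a
    by (induction a rule: rpoly_induct) (simp_all add: \<rho>_const \<rho>_add \<rho>_mult peval_simps x_def)
  show ?thesis
  proof (rule that[of \<alpha> x])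
    show "\<alpha> (a * p) = peval a x * \<alpha> p" if "p \<in> I" for a p
      using hom[OF that] \<rho>_eval by simp
    show "\<alpha> F \<le> 0" using \<alpha>_nonneg[OF FQ] \<alpha>_uminus[OF F(1)] by simp
    show "0 \<le> peval m x" if "m \<in> M" for m
    proof -
      have "m * U \<in> Q" using MQ U_mult[OF that] aU by blast
      then show ?thesis using \<alpha>_nonneg \<rho>_eval by (simp add: \<rho>_def flip: \<rho>_eval)
    qed
  qed (use MQ in \<open>auto intro: \<alpha>_add \<alpha>_nonneg \<alpha>_U\<close>)
qed

end

section \<open>Polynomials with positive definite zeros\<close>

text \<open>The quotient of the two forms is bounded on the compact unit sphere, and homogeneity
  carries the bound to all vectors.\<close>

lemma posdef_dominates:
  fixes r s :: "'n::finite \<Rightarrow> 'n \<Rightarrow> real"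
  assumes pos: "\<And>v. v \<noteq> 0 \<Longrightarrow> 0 < qform s v"
  obtains N where "N > 0" "\<And>v. qform r v \<le> N * qform s v"
proof -
  let ?S = "sphere (0::real^'n) 1"
  have pos': "0 < qform s v" if "v \<in> ?S" for v
    using that by (intro pos) auto
  have cont: "continuous_on ?S (qform t)" for t :: "'n \<Rightarrow> 'n \<Rightarrow> real"
    unfolding qform_def by (intro continuous_intros)
  have "continuous_on ?S (\<lambda>v. qform r v / qform s v)"
    using pos' by (intro continuous_on_divide cont) fastforce
  moreover have "?S \<noteq> {}" by simp
  ultimately obtain v0 where v0: "\<And>v. v \<in> ?S \<Longrightarrow> qform r v / qform s v \<le> qform r v0 / qform s v0"
    using continuous_attains_sup[OF compact_sphere] by blast
  define N where "N = \<bar>qform r v0 / qform s v0\<bar> + 1"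
  have sphere: "qform r v \<le> N * qform s v" if "v \<in> ?S" for v
  proof -
    have "qform r v / qform s v \<le> N" using v0[OF that] unfolding N_def by linarith
    then show ?thesis using pos'[OF that] by (simp add: pos_divide_le_eq)
  qed
  have "qform r v \<le> N * qform s v" for v
  proof (cases "v = 0")
    case False
    define z where "z = v /\<^sub>R norm v"
    have v: "v = norm v *\<^sub>R z" and z: "z \<in> ?S" using False by (simp_all add: z_def)
    have "(norm v)\<^sup>2 * qform r z \<le> (norm v)\<^sup>2 * (N * qform s z)"
      by (intro mult_left_mono sphere z) auto
    then have "qform r (norm v *\<^sub>R z) \<le> N * qform s (norm v *\<^sub>R z)"
      unfolding qform_scaleR by (simp add: mult_ac)
    then show ?thesis using v by simp
  qed (simp add: qform_def)
  moreover have "N > 0" unfolding N_def by (intro add_nonneg_pos) auto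
  ultimately show ?thesis using that by blast
qed

text \<open>The trace pairing of two positive semidefinite matrices is nonnegative. Induction on the
  size removes a rank-one matrix from T, leaving the Schur complement of the pivot
  \<open>T a a\<close>.\<close>

lemma trace_product_nonneg:
  fixes s T :: "'a \<Rightarrow> 'a \<Rightarrow> real"
  assumes "finite S"
    and "\<And>v. 0 \<le> (\<Sum>i\<in>S. \<Sum>j\<in>S. s i j * (v i * v j))"
    and "\<And>v. 0 \<le> (\<Sum>i\<in>S. \<Sum>j\<in>S. T i j * (v i * v j))"
    and "\<And>i j. T i j = T j i"
  shows "0 \<le> (\<Sum>i\<in>S. \<Sum>j\<in>S. s i j * T i j)"
  using assms
proof (induction S arbitrary: T)
  case empty
  then show ?case by simp
next
  case (insert a S)
  have split: "(\<Sum>i\<in>insert a S. \<Sum>j\<in>insert a S. g i j)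
      = g a a + (\<Sum>j\<in>S. g a j) + (\<Sum>j\<in>S. g j a) + (\<Sum>i\<in>S. \<Sum>j\<in>S. g i j)" for g :: "'a \<Rightarrow> 'a \<Rightarrow> real"
    using insert.hyps by (simp add: sum.distrib)
  note T_nonneg = insert.prems(2)[unfolded split]
  have s_nonneg: "0 \<le> (\<Sum>i\<in>S. \<Sum>j\<in>S. s i j * (v i * v j))" for v
  proof -
    have "(\<Sum>i\<in>S. \<Sum>j\<in>S. s i j * ((v(a := 0)) i * (v(a := 0)) j)) = (\<Sum>i\<in>S. \<Sum>j\<in>S. s i j * (v i * v j))"
      using insert.hyps by (intro sum.cong refl) auto
    moreover have "(\<Sum>j\<in>S. s a j * ((v(a := 0)) a * (v(a := 0)) j)) = 0"
      "(\<Sum>j\<in>S. s j a * ((v(a := 0)) j * (v(a := 0)) a)) = 0" by simp_all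
    ultimately show ?thesis using insert.prems(1)[of "v(a := 0)"] unfolding split by simp
  qed
  have form: "0 \<le> T a a * t\<^sup>2 + 2 * t * (\<Sum>j\<in>S. T a j * v j) + (\<Sum>i\<in>S. \<Sum>j\<in>S. T i j * (v i * v j))" for v t
  proof -
    have "(\<Sum>i\<in>S. \<Sum>j\<in>S. T i j * ((v(a := t)) i * (v(a := t)) j)) = (\<Sum>i\<in>S. \<Sum>j\<in>S. T i j * (v i * v j))"
      using insert.hyps by (intro sum.cong refl) auto
    moreover have "(\<Sum>j\<in>S. T a j * ((v(a := t)) a * (v(a := t)) j)) = t * (\<Sum>j\<in>S. T a j * v j)"
      unfolding sum_distrib_left using insert.hyps by (intro sum.cong refl) auto
    moreover have "(\<Sum>j\<in>S. T j a * ((v(a := t)) j * (v(a := t)) a)) = t * (\<Sum>j\<in>S. T a j * v j)"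
      unfolding sum_distrib_left using insert.hyps insert.prems(3) by (intro sum.cong refl) auto
    ultimately show ?thesis using T_nonneg[of "v(a := t)"] by (simp add: power2_eq_square)
  qed
  have T_S: "0 \<le> (\<Sum>i\<in>S. \<Sum>j\<in>S. T i j * (v i * v j))" for v
    using form[of 0 v] by simp
  have Taa: "T a a \<ge> 0" using form[of 1 "\<lambda>_. 0"] by simp
  show ?case
  proof (cases "T a a = 0")
    case True
    \<comment> \<open>With a zero pivot the form is affine in t, and a nonnegative affine function
      of t has slope 0.\<close>
    have row: "T a j = 0" if j: "j \<in> S" for j
    proof -
      define v where "v = (\<lambda>i. if i = j then 1 else 0 :: real)"
      have v: "(\<Sum>i\<in>S. c i * v i) = c j" for c
        using insert.hyps(1) j by (simp add: v_def if_distrib cong: if_cong)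
      have vv: "(\<Sum>i\<in>S. \<Sum>k\<in>S. T i k * (v i * v k)) = T j j"
      proof -
        have "(\<Sum>i\<in>S. \<Sum>k\<in>S. T i k * (v i * v k)) = (\<Sum>i\<in>S. (\<Sum>k\<in>S. T i k * v k) * v i)"
          by (simp add: sum_distrib_left sum_distrib_right mult_ac)
        then show ?thesis by (simp add: v)
      qed
      have *: "0 \<le> 2 * t * T a j + T j j" for t
        using form[of t v] True by (simp add: v vv)
      show ?thesis
      proof (rule ccontr)
        assume ne: "T a j \<noteq> 0"
        show False using *[of "- (T j j + 1) / (2 * T a j)"] ne by (simp add: field_simps)
      qed
    qed
    have col: "T j a = 0" if "j \<in> S" for j
      using row[OF that] insert.prems(3)[of j a] by simp
    have "0 \<le> (\<Sum>i\<in>S. \<Sum>j\<in>S. s i j * T i j)"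
      by (rule insert.IH[OF s_nonneg T_S insert.prems(3)])
    then show ?thesis unfolding split by (simp add: True row col)
  next
    case False
    with Taa have pos: "T a a > 0" by simp
    \<comment> \<open>The Schur complement is positive semidefinite because its form is the minimum
      of the form of T over the entry at \<open>a\<close>, attained at
      \<open>- b / T a a\<close>.\<close>
    define T' where "T' i j = T i j - T a i * T a j / T a a" for i j
    have "0 \<le> (\<Sum>i\<in>S. \<Sum>j\<in>S. T' i j * (v i * v j))" for v
    proof -
      define b where "b = (\<Sum>j\<in>S. T a j * v j)"
      have "(\<Sum>i\<in>S. \<Sum>j\<in>S. T' i j * (v i * v j)) = (\<Sum>i\<in>S. \<Sum>j\<in>S. T i j * (v i * v j)) - b * b / T a a"
        unfolding T'_def b_def sum_product sum_divide_distrib 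
        by (simp add: sum_subtractf algebra_simps)
      moreover have "T a a * (- b / T a a)\<^sup>2 + 2 * (- b / T a a) * b = - (b * b / T a a)"
        using pos by (simp add: power2_eq_square)
      ultimately show ?thesis using form[of "- b / T a a" v] unfolding b_def by simp
    qed
    moreover have "T' i j = T' j i" for i j
      unfolding T'_def using insert.prems(3)[of i j] by simp
    ultimately have "0 \<le> (\<Sum>i\<in>S. \<Sum>j\<in>S. s i j * T' i j)"
      using insert.IH[OF s_nonneg] by blast
    \<comment> \<open>T is a rank-one matrix plus T' on S, and pairing s with the rank-one matrix
      gives the form of s at the row \<open>T a\<close>.\<close>
    moreover have "(\<Sum>i\<in>insert a S. \<Sum>j\<in>insert a S. s i j * T i j)
        = (\<Sum>i\<in>insert a S. \<Sum>j\<in>insert a S. s i j * (T a i * T a j)) / T a a + (\<Sum>i\<in>S. \<Sum>j\<in>S. s i j * T' i j)"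
    proof -
      have "(\<Sum>i\<in>S. \<Sum>j\<in>S. s i j * T' i j) 
          = (\<Sum>i\<in>S. \<Sum>j\<in>S. s i j * T i j) - (\<Sum>i\<in>S. \<Sum>j\<in>S. s i j * (T a i * T a j)) / T a a"
        unfolding T'_def sum_divide_distrib by (simp add: sum_subtractf algebra_simps)
      moreover have "(\<Sum>j\<in>S. s j a * T j a) = (\<Sum>j\<in>S. s j a * T a j)"
        using insert.prems(3) by (intro sum.cong refl) metis
      ultimately show ?thesis
        unfolding split using pos by (simp add: add_divide_distrib sum_divide_distrib)
    qed
    ultimately show ?thesis
      using insert.prems(1)[of "T a"] pos by simp
  qed
qed

section \<open>Bump polynomials for finite sets of points\<close>

definition sqdist_poly :: "real ^ 'n \<Rightarrow> 'n::finite rpoly" where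
  "sqdist_poly v = (\<Sum>i\<in>UNIV. (dvar v i)\<^sup>2)"

lemma peval_sqdist_poly: "peval (sqdist_poly v) x = (dist x v)\<^sup>2"
  by (simp add: sqdist_poly_def peval_simps dist_norm norm_vec_def L2_set_def sum_nonneg)

lemma vanish2_sqdist_poly: "vanish2 v (sqdist_poly v)"
  unfolding sqdist_poly_def power2_eq_square by (intro vanish2_sum vanish2_mult) auto

lemma vanish2_prod_sqdist_poly:
  assumes "finite Z" "v \<in> Z"
  shows "vanish2 v (\<Prod>u\<in>Z. sqdist_poly u)"
proof -
  have "(\<Prod>u\<in>Z. sqdist_poly u) = (\<Prod>u\<in>Z - {v}. sqdist_poly u) * sqdist_poly v"
    using assms by (simp add: prod.remove mult.commute)
  then show ?thesis by (simp add: vanish2_mult_left vanish2_sqdist_poly)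
qed

text \<open>The product P of squared distances to the other points vanishes there to second order.
  Normalized to P/c with value 1 at u, it yields w = 1 - (1 - P/c)^2, which equals 1 at u to second
  order and is still a multiple of P.\<close>

lemma bump_polynomial_exists:
  fixes u :: "real ^ 'n::finite"
  assumes Z: "finite Z"
  obtains w where "vanish2 u (1 - w)" "\<And>v. v \<in> Z \<Longrightarrow> v \<noteq> u \<Longrightarrow> vanish2 v w"
proof -
  define P where "P = (\<Prod>v\<in>Z - {u}. sqdist_poly v)"
  define c where "c = peval P u"
  have c: "c \<noteq> 0" using Z by (simp add: c_def P_def peval_prod peval_sqdist_poly)
  define w where "w = pconst (1 / c) * P * (2 - pconst (1 / c) * P)"
  have "peval (1 - pconst (1 / c) * P) u = 0"
    using c by (simp add: peval_simps c_def)
  then have "vanish2 u ((1 - pconst (1 / c) * P) * (1 - pconst (1 / c) * P))"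
    by (intro vanish2_mult)
  also have "(1 - pconst (1 / c) * P) * (1 - pconst (1 / c) * P) = 1 - w"
    by (simp add: w_def algebra_simps)
  finally have "vanish2 u (1 - w)" .
  moreover have "vanish2 v w" if "v \<in> Z" "v \<noteq> u" for v
  proof -
    have "vanish2 v P" unfolding P_def using that Z by (intro vanish2_prod_sqdist_poly) auto
    then have "vanish2 v ((2 - pconst (1 / c) * P) * (pconst (1 / c) * P))"
      by (intro vanish2_mult_left)
    then show ?thesis by (simp add: w_def mult_ac)
  qed
  ultimately show ?thesis using that by blast
qed

context archimedean_quadratic_module
begin

text \<open>Any polynomial vanishing to second order on a finite set is bounded by multiples of one
  sum of squares, because the squares \<open>(w u)\<^sup>2\<close> and \<open>r\<^sup>2\<close> below generate the unit ideal.\<close>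

lemma order_unit_vanish2:
  assumes Z: "finite Z"
  obtains U where "order_unit_ideal M {p. \<forall>u\<in>Z. vanish2 u p} U" "\<And>x. x \<notin> Z \<Longrightarrow> peval U x > 0"
proof -
  have "\<exists>w. vanish2 u (1 - w) \<and> (\<forall>v\<in>Z. v \<noteq> u \<longrightarrow> vanish2 v w)" for u
    using bump_polynomial_exists[OF Z, of u] by metis
  then obtain w where w1: "\<And>u. vanish2 u (1 - w u)" and w0: "\<And>u v. v \<in> Z \<Longrightarrow> v \<noteq> u \<Longrightarrow> vanish2 v (w u)"
    by metis
  have ew1: "peval (w u) u = 1" for u
    using vanish2_imp_zero[OF w1[of u]] by (simp add: peval_diff)
  have ew0: "peval (w u) v = 0" if "v \<in> Z" "v \<noteq> u" for u v
    using w0[OF that] by (rule vanish2_imp_zero)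
  \<comment> \<open>This makes r + \<Sum> (w u)^2 = 1 an exact identity, with r vanishing on all of
    Z.\<close>
  define r where "r = 1 - (\<Sum>u\<in>Z. (w u)\<^sup>2)"
  define e where "e u i = w u * dvar u i" for u i
  define U where "U = r\<^sup>2 + (\<Sum>u\<in>Z. \<Sum>i\<in>UNIV. (e u i)\<^sup>2)"
  let ?I = "{p. \<forall>u\<in>Z. vanish2 u p}"
  have r0: "peval r v = 0" if "v \<in> Z" for v
  proof -
    have "(\<Sum>u\<in>Z. (peval (w u) v)\<^sup>2) = (\<Sum>u\<in>Z. if u = v then 1 else 0)"
      using that by (intro sum.cong) (auto simp: ew1 ew0)
    then show ?thesis using that Z by (simp add: r_def peval_simps)
  qed
  have e0: "peval (e u i) v = 0" if "v \<in> Z" for u v i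
    using that ew0[OF that, of u] by (auto simp: e_def peval_mult)
  have sq: "vanish2 v (p\<^sup>2)" if "peval p v = 0" for p v
    using vanish2_mult[OF that that] by (simp add: power2_eq_square)
  have ineq_r: "U - r\<^sup>2 \<in> M"
    unfolding U_def by (simp add: sum square)
  have ineq_e: "U - (e u i)\<^sup>2 \<in> M" if u: "u \<in> Z" for u i
  proof -
    have "U - (e u i)\<^sup>2 = r\<^sup>2 + ((\<Sum>j\<in>UNIV - {i}. (e u j)\<^sup>2) + (\<Sum>v\<in>Z - {u}. \<Sum>j\<in>UNIV. (e v j)\<^sup>2))"
      unfolding U_def sum.remove[OF Z u] sum.remove[OF finite UNIV_I[of i]] by simp
    also have "\<dots> \<in> M" by (intro add sum square)
    finally show ?thesis .
  qed
  define D where "D p \<longleftrightarrow> (\<exists>N. pconst N * U - p \<in> M)" for p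
  have D_add: "D (p + q)" if pq: "D p" "D q" for p q
  proof -
    obtain N L where "pconst N * U - p \<in> M" "pconst L * U - q \<in> M"
      using pq unfolding D_def by blast
    then have "(pconst N * U - p) + (pconst L * U - q) \<in> M" by (rule add)
    then have "pconst (N + L) * U - (p + q) \<in> M" by (simp add: pconst_add algebra_simps)
    then show ?thesis unfolding D_def by blast
  qed
  have D_0: "D 0" unfolding D_def using zero by (intro exI[of _ 0]) simp
  have D_sum: "D (\<Sum>a\<in>A. p a)" if "\<And>a. a \<in> A \<Longrightarrow> D (p a)" for A :: "'c set" and p
    using that by (induction A rule: infinite_finite_induct) (auto intro: D_0 D_add)
  \<comment> \<open>With s = 2t, the product s a b is at most t^2 a^2 + b^2, since (ta - b)^2 is a
    square; then t^2 is bounded by N and both squares by \<open>U\<close>.\<close>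
  have D_mult: "D (s * (a * b))" if "U - a\<^sup>2 \<in> M" "U - b\<^sup>2 \<in> M" for s a b
  proof -
    define t where "t = pconst (1/2) * s"
    have st: "s = 2 * t" using pconst_inverse_cancel[of 2 s]
      by (simp add: t_def mult.left_commute)
    obtain N where N: "N > 0" "pconst N - t\<^sup>2 \<in> M" using bounded .
    have "pconst N * (U - a\<^sup>2) + (U - b\<^sup>2) + a\<^sup>2 * (pconst N - t\<^sup>2) + (t * a - b)\<^sup>2 \<in> M"
      using that N by (intro add square_mult square scale) auto
    also have "pconst N * (U - a\<^sup>2) + (U - b\<^sup>2) + a\<^sup>2 * (pconst N - t\<^sup>2) + (t * a - b)\<^sup>2
        = pconst (N + 1) * U - s * (a * b)"
      by (simp add: st pconst_add power2_eq_square algebra_simps)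
    finally show ?thesis unfolding D_def by blast
  qed
  have D_I: "D p" if p: "p \<in> ?I" for p
  proof -
    define p' where "p' = (1 + r) * p"
    \<comment> \<open>This is 1 = r^2 + (1 - r)(1 + r), with 1 - r the sum of the squares of the
      bumps.\<close>
    have "p = r\<^sup>2 * p + (\<Sum>u\<in>Z. (w u)\<^sup>2) * p'"
      by (simp add: p'_def r_def power2_eq_square algebra_simps)
    also have "\<dots> = p * (r * r) + (\<Sum>u\<in>Z. (w u)\<^sup>2 * p')"
      by (simp add: power2_eq_square sum_distrib_right sum_distrib_left mult_ac)
    also have "D \<dots>"
    proof (intro D_add D_mult D_sum ineq_r)
      fix u assume u: "u \<in> Z"
      have "vanish2 u p'" unfolding p'_def using p u by (intro vanish2_mult_left) auto
      then obtain s where "p' = quad_expansion u s" unfolding vanish2_def by blast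
      then have "(w u)\<^sup>2 * p' = (\<Sum>i\<in>UNIV. \<Sum>j\<in>UNIV. s i j * (e u i * e u j))"
        by (simp add: quad_expansion_def e_def sum_distrib_left power2_eq_square mult_ac)
      also have "D \<dots>" by (intro D_sum D_mult ineq_e u)
      finally show "D ((w u)\<^sup>2 * p')" .
    qed
    finally show ?thesis .
  qed
  have "order_unit_ideal M ?I U"
  proof unfold_locales
    show "U \<in> ?I"
      unfolding U_def by (auto intro!: vanish2_add vanish2_sum sq simp: r0 e0)
    show "p * U \<in> M" if "p \<in> M" for p
    proof -
      have "p * U = r\<^sup>2 * p + (\<Sum>u\<in>Z. \<Sum>i\<in>UNIV. (e u i)\<^sup>2 * p)"
        by (simp add: U_def sum_distrib_left distrib_left mult_ac)
      also have "\<dots> \<in> M" by (intro add sum square_mult that)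
      finally show ?thesis .
    qed
    show "\<exists>N. pconst N * U - p \<in> M" if "p \<in> ?I" for p
      using D_I[OF that] unfolding D_def .
  qed (auto intro: vanish2_add vanish2_mult_left)
  \<comment> \<open>If every square in \<open>U\<close> vanished at x, then r(x) = 0 would make some
    \<open>w u\<close> nonzero at x, and its terms \<open>e u i\<close> would force x = u.\<close>
  moreover have "peval U x > 0" if x: "x \<notin> Z" for x
  proof (rule ccontr)
    assume neg: "\<not> peval U x > 0"
    have U: "peval U x = (peval r x)\<^sup>2 + (\<Sum>u\<in>Z. \<Sum>i\<in>UNIV. (peval (e u i) x)\<^sup>2)"
      by (simp add: U_def peval_simps)
    have nn: "(\<Sum>u\<in>Z. \<Sum>i\<in>UNIV. (peval (e u i) x)\<^sup>2) \<ge> 0" by (intro sum_nonneg) auto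
    have "(peval r x)\<^sup>2 = 0" "(\<Sum>u\<in>Z. \<Sum>i\<in>UNIV. (peval (e u i) x)\<^sup>2) = 0"
      using neg nn zero_le_power2[of "peval r x"] unfolding U by linarith+
    then have all: "peval (e u i) x = 0" if "u \<in> Z" for u i
      using that Z by (simp add: sum_nonneg_eq_0_iff sum_nonneg)
    have "(\<Sum>u\<in>Z. (peval (w u) x)\<^sup>2) = 1"
      using \<open>(peval r x)\<^sup>2 = 0\<close> by (simp add: r_def peval_simps)
    then obtain u where u: "u \<in> Z" "peval (w u) x \<noteq> 0"
      by (metis (no_types, lifting) sum.neutral zero_neq_one zero_power2)
    obtain i where "x $ i \<noteq> u $ i" using u x by (metis vec_eq_iff)
    then show False using all[OF u(1), of i] u(2) by (simp add: e_def peval_mult)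
  qed
  ultimately show ?thesis using that by blast
qed

text \<open>Otherwise a separating state \<alpha> acts through a point x. Off Z it is a positive
  multiple of evaluation at x. On Z it pairs second-order coefficients with a positive semidefinite
  matrix T, and dominating the form of \<open>U\<close> by N times that of F gives 1 = \<alpha> U
  \<le> N \<alpha> F \<le> 0.\<close>

theorem posdef_zeros_in_module:
  assumes Z: "finite Z" and posdef: "\<And>u. u \<in> Z \<Longrightarrow> posdef_at u F"
    and pos: "\<And>x. (\<And>m. m \<in> M \<Longrightarrow> 0 \<le> peval m x) \<Longrightarrow> x \<notin> Z \<Longrightarrow> 0 < peval F x"
  shows "F \<in> M"
proof (rule ccontr)
  assume FM: "F \<notin> M"
  define I where "I = {p. \<forall>u\<in>Z. vanish2 u p}"
  obtain U where "order_unit_ideal M I U" and Upos: "\<And>x. x \<notin> Z \<Longrightarrow> peval U x > 0"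
    unfolding I_def using order_unit_vanish2[OF Z] by blast
  then interpret order_unit_ideal M I U by simp
  have FI: "F \<in> I" unfolding I_def using posdef posdef_at_imp_vanish2 by blast
  obtain \<alpha> x where \<alpha>_add: "\<And>p q. p \<in> I \<Longrightarrow> q \<in> I \<Longrightarrow> \<alpha> (p + q) = \<alpha> p + \<alpha> q"
    and \<alpha>_mult: "\<And>a p. p \<in> I \<Longrightarrow> \<alpha> (a * p) = peval a x * \<alpha> p"
    and \<alpha>_nonneg: "\<And>p. p \<in> M \<Longrightarrow> p \<in> I \<Longrightarrow> 0 \<le> \<alpha> p"
    and \<alpha>_U: "\<alpha> U = (1::real)" and \<alpha>_F: "\<alpha> F \<le> 0" and x: "\<And>m. m \<in> M \<Longrightarrow> 0 \<le> peval m x"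
    using separating_state_exists[OF FI FM] by blast
  show False
  proof (cases "x \<in> Z")
    case False
    \<comment> \<open>Both factors of F U lie in I, so its state can be computed in two
      ways.\<close>
    have "peval F x = \<alpha> (F * U)" using \<alpha>_mult[OF U_in_I, of F] \<alpha>_U by simp
    also have "\<dots> = peval U x * \<alpha> F" using \<alpha>_mult[OF FI, of U] by (simp add: mult.commute)
    also have "\<dots> \<le> 0" using Upos[OF False] \<alpha>_F by (simp add: mult_nonneg_nonpos)
    finally show False using pos[OF x False] by simp
  next
    case True
    have \<alpha>_0: "\<alpha> 0 = 0" using \<alpha>_mult[OF FI, of 0] by simp
    have I_sum: "(\<Sum>a\<in>A. p a) \<in> I" if "\<And>a. a \<in> A \<Longrightarrow> p a \<in> I" for A :: "'n set" and p
      unfolding I_def using that by (auto intro!: vanish2_sum simp: I_def)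
    have \<alpha>_sum: "\<alpha> (\<Sum>a\<in>A. p a) = (\<Sum>a\<in>A. \<alpha> (p a))" if "\<And>a. a \<in> A \<Longrightarrow> p a \<in> I" for A :: "'n set" and p
      using finite[of A] that by induction (simp_all add: \<alpha>_0 \<alpha>_add I_sum)
    \<comment> \<open>Products of \<open>dvar x\<close> need not lie in I. Multiplying each factor
      by a bump w puts them there, and leaves the state unchanged because w(x) = 1.\<close>
    obtain w where w: "vanish2 x (1 - w)" "\<And>v. v \<in> Z \<Longrightarrow> v \<noteq> x \<Longrightarrow> vanish2 v w"
      using bump_polynomial_exists[OF Z] by metis
    have wx: "peval w x = 1" using vanish2_imp_zero[OF w(1)] by (simp add: peval_diff)
    define y where "y i = w * dvar x i" for i
    have y0: "peval (y i) v = 0" if "v \<in> Z" for i v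
      using vanish2_imp_zero[OF w(2)[OF that]] by (cases "v = x") (auto simp: y_def peval_mult)
    have yI: "y i * y j \<in> I" for i j
      unfolding I_def using y0 by (auto intro!: vanish2_mult)
    define T where "T i j = \<alpha> (y i * y j)" for i j
    have \<alpha>_expansion: "\<alpha> p = (\<Sum>i\<in>UNIV. \<Sum>j\<in>UNIV. peval (s i j) x * T i j)"
      if p: "p \<in> I" "p = quad_expansion x s" for p s
    proof -
      have "\<alpha> p = \<alpha> (w\<^sup>2 * p)" using \<alpha>_mult[OF p(1), of "w\<^sup>2"] wx by (simp add: peval_power)
      also have "w\<^sup>2 * p = (\<Sum>i\<in>UNIV. \<Sum>j\<in>UNIV. s i j * (y i * y j))"
        by (simp add: p(2) quad_expansion_def y_def sum_distrib_left power2_eq_square mult_ac)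
      also have "\<alpha> \<dots> = (\<Sum>i\<in>UNIV. \<Sum>j\<in>UNIV. peval (s i j) x * T i j)"
        by (simp add: \<alpha>_sum I_sum I_mult yI \<alpha>_mult T_def)
      finally show ?thesis .
    qed
    have T_psd: "0 \<le> (\<Sum>i\<in>UNIV. \<Sum>j\<in>UNIV. T i j * (v i * v j))" for v
    proof -
      have eq: "(\<Sum>i\<in>UNIV. pconst (v i) * y i)\<^sup>2 = (\<Sum>i\<in>UNIV. \<Sum>j\<in>UNIV. pconst (v i * v j) * (y i * y j))"
        by (simp add: power2_eq_square sum_product pconst_mult mult_ac)
      have "0 \<le> \<alpha> ((\<Sum>i\<in>UNIV. pconst (v i) * y i)\<^sup>2)"
        by (rule \<alpha>_nonneg[OF square]) (simp add: eq I_sum I_mult yI)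
      also have "\<dots> = (\<Sum>i\<in>UNIV. \<Sum>j\<in>UNIV. T i j * (v i * v j))"
        unfolding eq by (simp add: \<alpha>_sum I_sum I_mult yI \<alpha>_mult T_def) (simp add: mult.commute)
      finally show ?thesis .
    qed
    obtain s where s: "F = quad_expansion x s" "\<And>v::real^'n. v \<noteq> 0 \<Longrightarrow> 0 < qform (\<lambda>i j. peval (s i j) x) v"
      using posdef[OF True] unfolding posdef_at_def by blast
    obtain r where r: "U = quad_expansion x r"
      using U_in_I True unfolding I_def vanish2_def by blast
    obtain N where N: "N > 0" "\<And>v::real^'n. qform (\<lambda>i j. peval (r i j) x) v \<le> N * qform (\<lambda>i j. peval (s i j) x) v"
      using posdef_dominates[OF s(2)] by blast
    have "0 \<le> (\<Sum>i\<in>UNIV. \<Sum>j\<in>UNIV. (N * peval (s i j) x - peval (r i j) x) * T i j)"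
    proof (rule trace_product_nonneg[OF finite _ T_psd])
      show "0 \<le> (\<Sum>i\<in>UNIV. \<Sum>j\<in>UNIV. (N * peval (s i j) x - peval (r i j) x) * (v i * v j))" for v
        using N(2)[of "vec_lambda v"] by (simp add: qform_def sum_distrib_left left_diff_distrib sum_subtractf mult.assoc)
      show "T i j = T j i" for i j by (simp add: T_def mult.commute)
    qed
    also have "\<dots> = N * \<alpha> F - \<alpha> U"
      unfolding \<alpha>_expansion[OF FI s(1)] \<alpha>_expansion[OF U_in_I r]
      by (simp add: sum_distrib_left left_diff_distrib sum_subtractf mult.assoc)
    finally show False using mult_nonneg_nonpos[of N "\<alpha> F"] \<alpha>_F N(1) \<alpha>_U by linarith
  qed
qed

end

section \<open>Lagrange multipliers\<close>

text \<open>Independence allows prescribing a linear functional on the family, and the adjoint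
  represents it as a vector. Injectivity lets indices be told apart by their vectors.\<close>

lemma dual_vectors_exist:
  fixes G :: "'b \<Rightarrow> real ^ 'n::finite"
  assumes "inj_on G I" "independent (G ` I)"
  obtains w where "\<And>k l. k \<in> I \<Longrightarrow> l \<in> I \<Longrightarrow> G k \<bullet> w l = (if k = l then 1 else 0)"
proof -
  have "\<exists>z. \<forall>k\<in>I. G k \<bullet> z = (if k = l then 1 else 0)" if l: "l \<in> I" for l
  proof -
    obtain \<phi> where \<phi>: "linear \<phi>" "\<And>x. x \<in> G ` I \<Longrightarrow> \<phi> x = (if x = G l then 1 else 0 :: real)"
      using linear_independent_extend[OF assms(2), of "\<lambda>x. if x = G l then 1 else 0"] by blast
    have "G k \<bullet> adjoint \<phi> 1 = (if k = l then 1 else 0)" if "k \<in> I" for k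
      using adjoint_works[OF \<phi>(1), of "G k" 1] \<phi>(2)[of "G k"] inj_onD[OF assms(1), of k l] that l
      by auto
    then show ?thesis by blast
  qed
  then obtain w where "\<forall>l\<in>I. \<forall>k\<in>I. G k \<bullet> w l = (if k = l then 1 else 0)" by metis
  then show ?thesis by (intro that[of w]) auto
qed

text \<open>Supplies points near \<open>u + t *\<^sub>R v\<close> at which all constraints take
  exactly their linearized values. They are preimages of \<open>t *\<^sub>R v\<close> under a map
  tangent to the identity at u.\<close>

lemma constraint_arc_exists:
  fixes C :: "'b \<Rightarrow> 'n::finite rpoly" and u v :: "real ^ 'n"
  assumes I: "finite I" and zero: "\<And>k. k \<in> I \<Longrightarrow> peval (C k) u = 0"
    and inj: "inj_on (\<lambda>k. gradient (C k) u) I" and indep: "independent ((\<lambda>k. gradient (C k) u) ` I)"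
    and \<epsilon>: "\<epsilon> > 0"
  obtains \<delta> where "\<delta> > 0"
    and "\<And>t. 0 < t \<Longrightarrow> t < \<delta> \<Longrightarrow>
      \<exists>x. norm (x - u - t *\<^sub>R v) \<le> \<epsilon> * t \<and> (\<forall>k\<in>I. peval (C k) x = t * (gradient (C k) u \<bullet> v))"
proof -
  let ?G = "\<lambda>k. gradient (C k) u"
  obtain w where w: "\<And>k l. k \<in> I \<Longrightarrow> l \<in> I \<Longrightarrow> ?G k \<bullet> w l = (if k = l then 1 else 0)"
    using dual_vectors_exist[OF inj indep] by blast
  text \<open>A local diffeomorphism straightening all constraints at once.\<close>
  define \<Phi> where "\<Phi> x = (x - u) + (\<Sum>k\<in>I. (peval (C k) x - ?G k \<bullet> (x - u)) *\<^sub>R w k)" for x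
  have G\<Phi>: "?G l \<bullet> \<Phi> x = peval (C l) x" if "l \<in> I" for l x
  proof -
    have "(\<Sum>k\<in>I. (peval (C k) x - ?G k \<bullet> (x - u)) * (?G l \<bullet> w k))
        = (\<Sum>k\<in>I. if k = l then peval (C l) x - ?G l \<bullet> (x - u) else 0)"
      using that by (intro sum.cong) (auto simp: w)
    then show ?thesis
      using that I by (simp add: \<Phi>_def inner_add_right inner_sum_right)
  qed
  have \<Phi>u: "\<Phi> u = 0" using zero by (simp add: \<Phi>_def)
  have cont: "continuous_on UNIV \<Phi>"
    unfolding \<Phi>_def by (intro continuous_intros)
  have "(\<Phi> has_derivative (\<lambda>z. z + (\<Sum>k\<in>I. (?G k \<bullet> z - ?G k \<bullet> z) *\<^sub>R w k))) (at u)"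
    unfolding \<Phi>_def by (auto intro!: derivative_eq_intros has_derivative_peval)
  then have der: "(\<Phi> has_derivative (\<lambda>z. z)) (at u)" by simp
  \<comment> \<open>The bound 1/2 gives |x - u| \<le> 2t |v|; the other bound then makes the
    linearization error at most \<epsilon> t.\<close>
  define e where "e = min (1/2) (\<epsilon> / (2 * (norm v + 1)))"
  have e: "e > 0" "e \<le> 1/2" "2 * e * norm v \<le> \<epsilon>"
  proof -
    show "e \<le> 1/2" unfolding e_def by (rule min.cobounded1)
    show "e > 0" using \<epsilon> by (auto simp: e_def intro!: divide_pos_pos add_nonneg_pos)
    have "2 * e * norm v \<le> 2 * e * (norm v + 1)" using \<open>e > 0\<close> by simp
    also have "\<dots> \<le> 2 * (\<epsilon> / (2 * (norm v + 1))) * (norm v + 1)"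
      by (intro mult_right_mono mult_left_mono) (auto simp: e_def)
    also have "\<dots> = \<epsilon>"
    proof -
      have "norm v + 1 > 0" by (simp add: add_nonneg_pos)
      then show ?thesis by (simp add: field_simps)
    qed
    finally show "2 * e * norm v \<le> \<epsilon>" .
  qed
  obtain d where d: "d > 0" "\<And>x. norm (x - u) < d \<Longrightarrow> norm (\<Phi> x - \<Phi> u - (x - u)) \<le> e * norm (x - u)"
    using der e(1) unfolding has_derivative_at_alt by blast
  \<comment> \<open>The derivative at u is the identity, hence surjective, so Sussmann's open
    mapping theorem makes the image of the ball a neighbourhood of 0.\<close>
  have "\<Phi> u \<in> interior (\<Phi> ` ball u d)"
    using d(1) by (intro sussmann_open_mapping[OF open_UNIV cont _ der bounded_linear_ident])
      (auto simp: fun_eq_iff interior_open)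
  then obtain \<rho> where \<rho>: "\<rho> > 0" "ball 0 \<rho> \<subseteq> \<Phi> ` ball u d"
    unfolding \<Phi>u mem_interior by blast
  have "norm v + 1 > 0" by (simp add: add_nonneg_pos)
  show ?thesis
  proof (rule that)
    show "\<rho> / (norm v + 1) > 0" using \<rho>(1) \<open>norm v + 1 > 0\<close> by simp
    fix t :: real assume t: "0 < t" "t < \<rho> / (norm v + 1)"
    have "t * norm v \<le> t * (norm v + 1)" using t by simp
    also have "\<dots> < \<rho>" using t(2) \<open>norm v + 1 > 0\<close> by (simp add: pos_less_divide_eq)
    finally have "t *\<^sub>R v \<in> ball 0 \<rho>" using t by simp
    then obtain x where x: "x \<in> ball u d" "\<Phi> x = t *\<^sub>R v" using \<rho>(2) by (metis imageE subsetD)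
    have n: "norm (t *\<^sub>R v - (x - u)) \<le> e * norm (x - u)"
      using d(2)[of x] x \<Phi>u by (simp add: dist_norm norm_minus_commute)
    have "norm (x - u) \<le> norm (t *\<^sub>R v) + norm (t *\<^sub>R v - (x - u))"
      using norm_triangle_ineq4[of "t *\<^sub>R v" "t *\<^sub>R v - (x - u)"] by simp
    also have "\<dots> \<le> t * norm v + (1/2) * norm (x - u)"
      using n mult_right_mono[OF e(2), of "norm (x - u)"] t by simp
    finally have "norm (x - u) \<le> 2 * (t * norm v)" by simp
    then have "e * norm (x - u) \<le> e * (2 * (t * norm v))" using e(1) by (intro mult_left_mono) auto
    also have "\<dots> = (2 * e * norm v) * t" by simp
    also have "\<dots> \<le> \<epsilon> * t" using e(3) t by (intro mult_right_mono) auto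
    finally have "norm (x - u - t *\<^sub>R v) \<le> \<epsilon> * t"
      using n norm_minus_commute[of "t *\<^sub>R v" "x - u"] by simp
    moreover have "\<forall>k\<in>I. peval (C k) x = t * (?G k \<bullet> v)"
      using G\<Phi> x(2) by (metis inner_scaleR_right)
    ultimately show "\<exists>x. norm (x - u - t *\<^sub>R v) \<le> \<epsilon> * t \<and> (\<forall>k\<in>I. peval (C k) x = t * (?G k \<bullet> v))"
      by blast
  qed
qed

text \<open>If f had slope -\<kappa> < 0 along v, the points from
  \<open>constraint_arc_exists\<close> would be feasible for small t and lower f by at least
  \<kappa> t / 2. Of the loss, one quarter of \<kappa> t covers the deviation from
  \<open>t *\<^sub>R v\<close> and one quarter the error of linearizing f.\<close>

lemma first_order_necessary:
  fixes f :: "'n::finite rpoly"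
  assumes min: "global_minimizer f (feasible_set m1 h m2 g) u"
    and cq: "constraint_qualification m1 h m2 g u"
    and v: "\<And>i. i \<in> {1..m1} \<Longrightarrow> gradient (h i) u \<bullet> v = 0"
      "\<And>j. j \<in> active m2 g u \<Longrightarrow> gradient (g j) u \<bullet> v \<ge> 0"
  shows "gradient f u \<bullet> v \<ge> 0"
proof (rule ccontr)
  let ?J = "active m2 g u"
  let ?I = "{1..m1} <+> ?J"
  define C where "C = case_sum h g"
  assume "\<not> gradient f u \<bullet> v \<ge> 0"
  define \<kappa> where "\<kappa> = - (gradient f u \<bullet> v)"
  have \<kappa>: "\<kappa> > 0" using \<open>\<not> _\<close> by (simp add: \<kappa>_def)
  have uK: "u \<in> feasible_set m1 h m2 g" using min by (simp add: global_minimizer_def)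
  have G: "(\<lambda>k. gradient (C k) u) = case_sum (\<lambda>i. gradient (h i) u) (\<lambda>j. gradient (g j) u)"
    by (auto simp: C_def fun_eq_iff split: sum.split)
  have zero: "peval (C k) u = 0" if "k \<in> ?I" for k
    using that uK by (auto simp: C_def feasible_set_def active_def)
  have fin: "finite ?I" by (simp add: active_def)
  have pn: "norm (gradient f u) + 1 > 0" "norm v + 1 > 0" by (simp_all add: add_nonneg_pos)
  define \<epsilon> where "\<epsilon> = min 1 (\<kappa> / (4 * (norm (gradient f u) + 1)))"
  define e where "e = \<kappa> / (4 * (norm v + 1))"
  have \<epsilon>: "\<epsilon> > 0" "\<epsilon> \<le> 1" "norm (gradient f u) * \<epsilon> \<le> \<kappa> / 4"
  proof -
    show "\<epsilon> \<le> 1" unfolding \<epsilon>_def by (rule min.cobounded1)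
    show "\<epsilon> > 0" using \<kappa> pn by (auto simp: \<epsilon>_def)
    have "norm (gradient f u) * \<epsilon> \<le> (norm (gradient f u) + 1) * \<epsilon>" using \<open>\<epsilon> > 0\<close> by simp
    also have "\<dots> \<le> (norm (gradient f u) + 1) * (\<kappa> / (4 * (norm (gradient f u) + 1)))"
      using pn by (intro mult_left_mono) (auto simp: \<epsilon>_def)
    also have "\<dots> = \<kappa> / 4" using pn by (simp add: field_simps)
    finally show "norm (gradient f u) * \<epsilon> \<le> \<kappa> / 4" .
  qed
  have e: "e > 0" "e * (norm v + 1) = \<kappa> / 4"
    using \<kappa> pn(2) unfolding e_def by (simp_all add: divide_simps)
  have indep: "inj_on (\<lambda>k. gradient (C k) u) ?I" "independent ((\<lambda>k. gradient (C k) u) ` ?I)"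
    using cq unfolding G constraint_qualification_def Let_def by blast+
  obtain \<delta> where \<delta>: "\<delta> > 0" "\<And>t. 0 < t \<Longrightarrow> t < \<delta> \<Longrightarrow>
      \<exists>x. norm (x - u - t *\<^sub>R v) \<le> \<epsilon> * t \<and> (\<forall>k\<in>?I. peval (C k) x = t * (gradient (C k) u \<bullet> v))"
    using constraint_arc_exists[where C = C and v = v, OF fin zero indep \<epsilon>(1)] by blast
  obtain d1 where d1: "d1 > 0"
    "\<And>x. norm (x - u) < d1 \<Longrightarrow> norm (peval f x - peval f u - gradient f u \<bullet> (x - u)) \<le> e * norm (x - u)"
    using has_derivative_peval[of f u] e(1) unfolding has_derivative_at_alt by blast
  \<comment> \<open>Inactive constraints stay positive near u, so only active ones restrict the
    direction.\<close>
  have "\<forall>\<^sub>F x in nhds u. peval (g j) x > 0" if "j \<in> {1..m2} - ?J" for j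
  proof -
    have "peval (g j) u > 0" using that uK by (force simp: feasible_set_def active_def)
    then show ?thesis
      by (rule order_tendstoD(1)[OF isCont_peval[unfolded isCont_def tendsto_at_iff_tendsto_nhds]])
  qed
  then have "\<forall>\<^sub>F x in nhds u. \<forall>j\<in>{1..m2} - ?J. peval (g j) x > 0"
    by (intro eventually_ball_finite) auto
  then obtain d2 where d2: "d2 > 0" "\<And>x j. dist x u < d2 \<Longrightarrow> j \<in> {1..m2} - ?J \<Longrightarrow> peval (g j) x > 0"
    unfolding eventually_nhds_metric by blast
  define t where "t = min (\<delta> / 2) (min (d1 / (2 * (norm v + 1))) (d2 / (2 * (norm v + 1))))"
  have t: "0 < t" "t < \<delta>" using \<delta>(1) d1(1) d2(1) pn by (auto simp: t_def)
  have td: "t * (norm v + 1) < d1" "t * (norm v + 1) < d2"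
  proof -
    have "t \<le> d1 / (2 * (norm v + 1))" "t \<le> d2 / (2 * (norm v + 1))" by (simp_all add: t_def)
    then have "t * (norm v + 1) \<le> d1 / 2" "t * (norm v + 1) \<le> d2 / 2" using pn by (simp_all add: field_simps)
    then show "t * (norm v + 1) < d1" "t * (norm v + 1) < d2" using d1(1) d2(1) by linarith+
  qed
  obtain x where x: "norm (x - u - t *\<^sub>R v) \<le> \<epsilon> * t" "\<And>k. k \<in> ?I \<Longrightarrow> peval (C k) x = t * (gradient (C k) u \<bullet> v)"
    using \<delta>(2)[OF t] by blast
  have xn: "norm (x - u) \<le> t * (norm v + 1)"
  proof -
    have "norm (x - u) \<le> norm (x - u - t *\<^sub>R v) + norm (t *\<^sub>R v)"
      using norm_triangle_ineq[of "x - u - t *\<^sub>R v" "t *\<^sub>R v"] by simp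
    also have "\<dots> \<le> \<epsilon> * t + t * norm v" using x(1) t by simp
    also have "\<dots> \<le> 1 * t + t * norm v" using \<epsilon>(2) t by (intro add_right_mono mult_right_mono) auto
    finally show ?thesis by (simp add: algebra_simps)
  qed
  have "x \<in> feasible_set m1 h m2 g"
    unfolding feasible_set_def mem_Collect_eq
  proof (intro conjI ballI)
    fix i assume i: "i \<in> {1..m1}"
    then show "peval (h i) x = 0" using x(2)[OF InlI[OF i]] v(1)[OF i] by (simp add: C_def)
  next
    fix j assume j: "j \<in> {1..m2}"
    show "peval (g j) x \<ge> 0"
    proof (cases "j \<in> ?J")
      case True
      then show ?thesis using x(2)[OF InrI[OF True]] v(2)[OF True] t by (simp add: C_def)
    next
      case False
      then show ?thesis using d2(2)[of x j] j xn td(2) by (auto simp: dist_norm intro: less_imp_le)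
    qed
  qed
  then have "peval f u \<le> peval f x" using min by (simp add: global_minimizer_def)
  moreover have "peval f x - peval f u \<le> gradient f u \<bullet> (x - u) + e * norm (x - u)"
    using d1(2)[of x] xn td(1) by (simp add: abs_le_iff)
  moreover have "e * norm (x - u) \<le> \<kappa> / 4 * t"
  proof -
    have "e * norm (x - u) \<le> e * (t * (norm v + 1))" using xn e(1) by (intro mult_left_mono) auto
    also have "\<dots> = (e * (norm v + 1)) * t" by simp
    finally show ?thesis unfolding e(2) .
  qed
  moreover have "gradient f u \<bullet> (x - u) \<le> - \<kappa> * t + \<kappa> / 4 * t"
  proof -
    have "gradient f u \<bullet> (x - u) = t * (gradient f u \<bullet> v) + gradient f u \<bullet> (x - u - t *\<^sub>R v)"
      by (simp add: inner_diff_right)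
    also have "gradient f u \<bullet> (x - u - t *\<^sub>R v) \<le> norm (gradient f u) * norm (x - u - t *\<^sub>R v)"
      by (rule norm_cauchy_schwarz)
    also have "\<dots> \<le> norm (gradient f u) * (\<epsilon> * t)" using x(1) by (intro mult_left_mono) auto
    also have "\<dots> \<le> \<kappa> / 4 * t" using \<epsilon>(3) t by (simp flip: mult.assoc add: mult_right_mono)
    finally show ?thesis by (simp add: \<kappa>_def mult.commute)
  qed
  ultimately have "0 \<le> - \<kappa> * t + \<kappa> / 4 * t + \<kappa> / 4 * t" by linarith
  then show False using mult_pos_pos[OF \<kappa> t(1)] by simp
qed

text \<open>Dual vectors read off the only possible coefficients c. The residual d vanishes because
  the first-order condition, applied to v and to -v, gives 0 = d \<bullet> d.\<close>

theorem lagrange_multipliers_exist: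
  fixes f :: "'n::finite rpoly"
  assumes min: "global_minimizer f (feasible_set m1 h m2 g) u"
    and cq: "constraint_qualification m1 h m2 g u"
  obtains lam mu where "lagrange_multipliers f m1 h m2 g u lam mu"
proof -
  let ?J = "active m2 g u"
  let ?I = "{1..m1} <+> ?J"
  define G where "G = case_sum (\<lambda>i. gradient (h i) u) (\<lambda>j. gradient (g j) u)"
  obtain w where w: "\<And>k l. k \<in> ?I \<Longrightarrow> l \<in> ?I \<Longrightarrow> G k \<bullet> w l = (if k = l then 1 else 0)"
    using dual_vectors_exist[of G ?I] cq unfolding constraint_qualification_def Let_def G_def by blast
  have fin: "finite ?I" "finite ?J" by (simp_all add: active_def)
  have fo: "gradient f u \<bullet> v \<ge> 0" 
    if "\<And>i. i \<in> {1..m1} \<Longrightarrow> G (Inl i) \<bullet> v = 0" "\<And>j. j \<in> ?J \<Longrightarrow> G (Inr j) \<bullet> v \<ge> 0" for v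
    using first_order_necessary[OF min cq, of v] that by (simp add: G_def)
  define c where "c k = gradient f u \<bullet> w k" for k
  define d where "d = gradient f u - (\<Sum>k\<in>?I. c k *\<^sub>R G k)"
  \<comment> \<open>The dual vectors correct d so that it becomes orthogonal to every constraint
    gradient.\<close>
  define v where "v = d - (\<Sum>k\<in>?I. (G k \<bullet> d) *\<^sub>R w k)"
  have Gv: "G l \<bullet> v = 0" if l: "l \<in> ?I" for l
  proof -
    have "(\<Sum>k\<in>?I. (G k \<bullet> d) * (G l \<bullet> w k)) = (\<Sum>k\<in>?I. if k = l then G l \<bullet> d else 0)"
      using l by (intro sum.cong) (auto simp: w)
    then show ?thesis using l fin by (simp add: v_def inner_diff_right inner_sum_right)
  qed
  have "gradient f u \<bullet> v \<ge> 0" "gradient f u \<bullet> (- v) \<ge> 0"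
    by (rule fo; simp add: Gv[OF InlI] Gv[OF InrI])+
  then have "gradient f u \<bullet> v = 0" by simp
  moreover have "gradient f u \<bullet> v = d \<bullet> d"
  proof -
    have "gradient f u \<bullet> v = gradient f u \<bullet> d - (\<Sum>k\<in>?I. c k * (G k \<bullet> d))"
      by (simp add: v_def inner_diff_right inner_sum_right c_def mult.commute)
    also have "\<dots> = d \<bullet> d"
      by (subst (2) d_def) (simp add: inner_diff_left inner_sum_left)
    finally show ?thesis .
  qed
  ultimately have "gradient f u = (\<Sum>k\<in>?I. c k *\<^sub>R G k)" by (simp add: d_def)
  also have "\<dots> = (\<Sum>i=1..m1. c (Inl i) *\<^sub>R gradient (h i) u) + (\<Sum>j\<in>?J. c (Inr j) *\<^sub>R gradient (g j) u)"
    using fin by (simp add: sum.Plus G_def)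
  also have "(\<Sum>j\<in>?J. c (Inr j) *\<^sub>R gradient (g j) u)
      = (\<Sum>j=1..m2. (if j \<in> ?J then c (Inr j) else 0) *\<^sub>R gradient (g j) u)"
    by (intro sum.mono_neutral_cong_left) (auto simp: active_def)
  finally have grad: "gradient f u = (\<Sum>i=1..m1. c (Inl i) *\<^sub>R gradient (h i) u)
      + (\<Sum>j=1..m2. (if j \<in> ?J then c (Inr j) else 0) *\<^sub>R gradient (g j) u)" .
  have "c (Inr j) \<ge> 0" if "j \<in> ?J" for j
    unfolding c_def by (rule fo) (simp_all add: w[OF InlI InrI] w[OF InrI InrI] that)
  then have "lagrange_multipliers f m1 h m2 g u (\<lambda>i. c (Inl i)) (\<lambda>j. if j \<in> ?J then c (Inr j) else 0)"
    using grad unfolding lagrange_multipliers_def by (auto simp: active_def)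
  then show ?thesis by (rule that)
qed

section \<open>Local certificates at minimizers\<close>

lemma gradient_pconst [simp]:
  fixes u :: "real ^ 'n::finite"
  shows "gradient (pconst c) u = 0"
proof (rule gradient_eqI)
  have "peval (pconst c) = (\<lambda>x :: real ^ 'n. c)" by (rule ext) simp
  then show "(peval (pconst c) has_derivative (\<lambda>v. 0 \<bullet> v)) (at u)" by simp
qed

lemma gradient_add: "gradient (p + q) u = gradient p u + gradient q u"
proof (rule gradient_eqI)
  have "((\<lambda>x. peval p x + peval q x) has_derivative (\<lambda>v. gradient p u \<bullet> v + gradient q u \<bullet> v)) (at u)"
    by (intro has_derivative_add has_derivative_peval)
  then show "(peval (p + q) has_derivative (\<lambda>v. (gradient p u + gradient q u) \<bullet> v)) (at u)"
    by (simp add: peval_add[abs_def] inner_add_left)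
qed

lemma gradient_pconst_mult: "gradient (pconst c * p) u = c *\<^sub>R gradient p u"
proof (rule gradient_eqI)
  have "((\<lambda>x. c * peval p x) has_derivative (\<lambda>v. c * (gradient p u \<bullet> v))) (at u)"
    by (intro has_derivative_mult_right has_derivative_peval)
  then show "(peval (pconst c * p) has_derivative (\<lambda>v. (c *\<^sub>R gradient p u) \<bullet> v)) (at u)"
    by (simp add: peval_mult[abs_def])
qed

lemma gradient_diff: "gradient (p - q) u = gradient p u - gradient q u"
  using gradient_add[of "p - q" q u] by simp

lemma gradient_sum: "gradient (\<Sum>a\<in>A. p a) u = (\<Sum>a\<in>A. gradient (p a) u)"
  using gradient_pconst[of 0 u]
  by (induction A rule: infinite_finite_induct) (simp_all add: gradient_add)

text \<open>Here q is half the Hessian form of p at u, kept as a function so that linear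
  combinations can be tracked without naming coefficients.\<close>

definition quad_part :: "real ^ 'n \<Rightarrow> 'n::finite rpoly \<Rightarrow> (real ^ 'n \<Rightarrow> real) \<Rightarrow> bool" where
  "quad_part u p q \<longleftrightarrow> (\<exists>s. p = quad_expansion u s \<and> (\<forall>v. qform (\<lambda>i j. peval (s i j) u) v = q v))"

lemma quad_part_0: "quad_part u 0 (\<lambda>v. 0)"
  unfolding quad_part_def by (intro exI[of _ "\<lambda>_ _. 0"]) (simp add: quad_expansion_def qform_def)

lemma quad_part_add:
  assumes "quad_part u p q" "quad_part u p' q'"
  shows "quad_part u (p + p') (\<lambda>v. q v + q' v)"
proof -
  obtain s s' where "p = quad_expansion u s" "\<And>v. qform (\<lambda>i j. peval (s i j) u) v = q v"
    "p' = quad_expansion u s'" "\<And>v. qform (\<lambda>i j. peval (s' i j) u) v = q' v"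
    using assms unfolding quad_part_def by blast
  then show ?thesis unfolding quad_part_def
    by (intro exI[of _ "\<lambda>i j. s i j + s' i j"]) (simp add: quad_expansion_add peval_add qform_add)
qed

lemma quad_part_pconst_mult:
  assumes "quad_part u p q"
  shows "quad_part u (pconst c * p) (\<lambda>v. c * q v)"
proof -
  obtain s where "p = quad_expansion u s" "\<And>v. qform (\<lambda>i j. peval (s i j) u) v = q v"
    using assms unfolding quad_part_def by blast
  then show ?thesis unfolding quad_part_def
    by (intro exI[of _ "\<lambda>i j. pconst c * s i j"]) (simp add: quad_expansion_mult peval_mult qform_cmult)
qed

lemma quad_part_sum:
  "(\<And>a. a \<in> A \<Longrightarrow> quad_part u (p a) (q a)) \<Longrightarrow> quad_part u (\<Sum>a\<in>A. p a) (\<lambda>v. \<Sum>a\<in>A. q a v)"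
  by (induction A rule: infinite_finite_induct) (simp_all add: quad_part_0 quad_part_add)

lemma quad_part_square:
  assumes "peval p u = 0"
  shows "quad_part u (p * p) (\<lambda>v. (gradient p u \<bullet> v)\<^sup>2)"
proof -
  obtain s where s: "p = (\<Sum>i\<in>UNIV. s i * dvar u i)" "\<And>i. peval (s i) u = gradient p u $ i"
    using first_order_expansion_zero[OF assms] by blast
  have "p * p = quad_expansion u (\<lambda>i j. s i * s j)"
    unfolding quad_expansion_product[symmetric] s(1)[symmetric] ..
  moreover have "qform (\<lambda>i j. peval (s i * s j) u) v = (gradient p u \<bullet> v)\<^sup>2" for v
    by (simp add: qform_def peval_mult s(2) inner_vec_def power2_eq_square sum_product mult_ac)
  ultimately show ?thesis unfolding quad_part_def by blast
qed

lemma posdef_atI: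
  assumes "quad_part u p q" "\<And>v. v \<noteq> 0 \<Longrightarrow> 0 < q v"
  shows "posdef_at u p"
  using assms unfolding quad_part_def posdef_at_def by metis

text \<open>On the part of the unit sphere where A \<le> 0, which is compact, B has a positive
  minimum and a large multiple of it outweighs A. On the rest of the sphere A alone suffices, and
  homogeneity gives all other vectors.\<close>

lemma penalty_posdef:
  fixes A B :: "real ^ 'n::finite \<Rightarrow> real"
  assumes cont: "continuous_on UNIV A" "continuous_on UNIV B"
    and hom: "\<And>c v. A (c *\<^sub>R v) = c\<^sup>2 * A v" "\<And>c v. B (c *\<^sub>R v) = c\<^sup>2 * B v"
    and B: "\<And>v. B v \<ge> 0" and pos: "\<And>v. v \<noteq> 0 \<Longrightarrow> B v = 0 \<Longrightarrow> A v > 0"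
  obtains c where "c > 0" "\<And>v. v \<noteq> 0 \<Longrightarrow> A v + c * B v > 0"
proof -
  let ?S = "sphere (0::real^'n) 1"
  define S where "S = ?S \<inter> A -` {..0}"
  have "compact S" unfolding S_def
    using continuous_closed_preimage[OF continuous_on_subset[OF cont(1)] closed_sphere closed_atMost]
    by (metis Int_absorb1 Int_lower1 compact_Int_closed compact_sphere subset_UNIV)
  have Bpos: "B v > 0" if "v \<in> S" for v
  proof -
    have "v \<noteq> 0" "A v \<le> 0" using that by (auto simp: S_def)
    then show ?thesis using pos[of v] B[of v] by force
  qed
  have "\<exists>c>0. \<forall>v\<in>?S. A v + c * B v > 0"
  proof (cases "S = {}")
    case True
    have "A v + 1 * B v > 0" if "v \<in> ?S" for v
    proof -
      have "A v > 0" using True that by (force simp: S_def)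
      then show ?thesis using B[of v] by linarith
    qed
    then show ?thesis using zero_less_one by blast
  next
    case False
    obtain v1 where v1: "v1 \<in> S" "\<And>v. v \<in> S \<Longrightarrow> B v1 \<le> B v"
      using continuous_attains_inf[OF \<open>compact S\<close> False continuous_on_subset[OF cont(2) subset_UNIV]] by blast
    obtain v2 where v2: "\<And>v. v \<in> S \<Longrightarrow> A v2 \<le> A v"
      using continuous_attains_inf[OF \<open>compact S\<close> False continuous_on_subset[OF cont(1) subset_UNIV]] by blast
    define c where "c = (\<bar>A v2\<bar> + 1) / B v1"
    have c: "c > 0" using Bpos[OF v1(1)] by (simp add: c_def add_nonneg_pos)
    have "A v + c * B v > 0" if v: "v \<in> ?S" for v
    proof (cases "v \<in> S")
      case True
      have "\<bar>A v2\<bar> + 1 = c * B v1" using Bpos[OF v1(1)] by (simp add: c_def)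
      also have "\<dots> \<le> c * B v" using v1(2)[OF True] c by (intro mult_left_mono) auto
      finally show ?thesis using v2[OF True] by linarith
    next
      case False
      then have "A v > 0" using v by (auto simp: S_def)
      moreover have "c * B v \<ge> 0" using c B by (intro mult_nonneg_nonneg) auto
      ultimately show ?thesis by linarith
    qed
    then show ?thesis using c by blast
  qed
  then obtain c where c: "c > 0" "\<And>v. v \<in> ?S \<Longrightarrow> A v + c * B v > 0" by blast
  have "A v + c * B v > 0" if "v \<noteq> 0" for v
  proof -
    define z where "z = v /\<^sub>R norm v"
    have z: "z \<in> ?S" "v = norm v *\<^sub>R z" using that by (simp_all add: z_def)
    have "A (norm v *\<^sub>R z) + c * B (norm v *\<^sub>R z) = (norm v)\<^sup>2 * (A z + c * B z)"
      unfolding hom by (simp add: algebra_simps)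
    also have "\<dots> > 0" using that c(2)[OF z(1)] by simp
    finally show ?thesis using z(2) by simp
  qed
  then show ?thesis using that c(1) by blast
qed

text \<open>Near a minimizer, strict complementarity makes \<open>\<mu>\<^sub>j - c g\<^sub>j\<close> a square up to terms of order two,
  so subtracting \<open>(\<lambda>\<^sub>i - c h\<^sub>i) h\<^sub>i\<close> and \<open>(\<mu>\<^sub>j - c g\<^sub>j) g\<^sub>j\<close> turns \<open>f\<close> into the Lagrangian with
  a quadratic penalty, whose Hessian is positive definite for large \<open>c\<close>.\<close>

theorem local_certificate_exists:
  fixes f :: "'n::finite rpoly"
  assumes uK: "u \<in> feasible_set m1 h m2 g"
    and lm: "lagrange_multipliers f m1 h m2 g u lam mu"
    and sc: "strict_complementarity m2 g u mu"
    and so: "second_order_sufficiency f m1 h m2 g u lam mu"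
  obtains \<phi> a where "posdef_at u (f - pconst (peval f u)
    - ((\<Sum>i=1..m1. \<phi> i * h i) + (\<Sum>j=1..m2. (a j)\<^sup>2 * g j)))"
proof -
  define J where "J = active m2 g u"
  define L where "L = lagrangian f m1 h m2 g u lam mu"
  have J: "finite J" "J \<subseteq> {1..m2}" by (auto simp: J_def active_def)
  have h0: "peval (h i) u = 0" if "i \<in> {1..m1}" for i using that uK by (simp add: feasible_set_def)
  have g0: "peval (g j) u = 0" if "j \<in> J" for j using that by (simp add: J_def active_def)
  have mu_pos: "mu j > 0" if "j \<in> J" for j
    using sc that g0[OF that] J(2) unfolding strict_complementarity_def by fastforce
  have mu_0: "mu j = 0" if "j \<in> {1..m2} - J" for j
    using lm that unfolding lagrange_multipliers_def J_def active_def by auto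
  have L: "L = f - (\<Sum>i=1..m1. pconst (lam i) * h i) - (\<Sum>j\<in>J. pconst (mu j) * g j)"
    by (simp add: L_def lagrangian_def J_def)
  have Lu: "peval L u = peval f u"
    using h0 g0 by (simp add: L peval_simps)
  have "(\<Sum>j=1..m2. mu j *\<^sub>R gradient (g j) u) = (\<Sum>j\<in>J. mu j *\<^sub>R gradient (g j) u)"
    using J mu_0 by (intro sum.mono_neutral_right) auto
  then have "gradient L u = 0"
    using lm by (simp add: L lagrange_multipliers_def gradient_diff gradient_sum gradient_pconst_mult)
  then obtain s where s: "L = pconst (peval f u) + quad_expansion u s"
    "\<And>v. 2 * qform (\<lambda>i j. peval (s i j) u) v = v \<bullet> (hessian L u *v v)"
    using second_order_expansion[of L u] Lu by metis
  define A where "A = qform (\<lambda>i j. peval (s i j) u)"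
  define B where "B v = (\<Sum>i=1..m1. (gradient (h i) u \<bullet> v)\<^sup>2) + (\<Sum>j\<in>J. (gradient (g j) u \<bullet> v)\<^sup>2)" for v
  have B_nonneg: "B v \<ge> 0" for v unfolding B_def by (intro add_nonneg_nonneg sum_nonneg) auto
  have A_pos: "A v > 0" if v: "v \<noteq> 0" "B v = 0" for v
  proof -
    have "(\<Sum>i=1..m1. (gradient (h i) u \<bullet> v)\<^sup>2) = 0" "(\<Sum>j\<in>J. (gradient (g j) u \<bullet> v)\<^sup>2) = 0"
      using v(2) unfolding B_def by (simp_all add: add_nonneg_eq_0_iff sum_nonneg)
    then have "\<forall>i\<in>{1..m1}. gradient (h i) u \<bullet> v = 0" "\<forall>j\<in>J. gradient (g j) u \<bullet> v = 0"
      using J(1) by (simp_all add: sum_nonneg_eq_0_iff)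
    then have "v \<bullet> (hessian L u *v v) > 0"
      using so v(1) unfolding second_order_sufficiency_def L_def J_def by blast
    then show ?thesis using s(2)[of v] by (simp add: A_def)
  qed
  have "continuous_on UNIV A" "continuous_on UNIV B"
    unfolding A_def B_def qform_def by (intro continuous_intros)+
  moreover have "A (c *\<^sub>R v) = c\<^sup>2 * A v" "B (c *\<^sub>R v) = c\<^sup>2 * B v" for c v
    by (simp_all add: A_def qform_scaleR B_def power_mult_distrib sum_distrib_left distrib_left)
  ultimately obtain c where c: "c > 0" "\<And>v. v \<noteq> 0 \<Longrightarrow> A v + c * B v > 0"
    using penalty_posdef[of A B] B_nonneg A_pos by blast
  define \<phi> where "\<phi> i = pconst (lam i) - pconst c * h i" for i
  \<comment> \<open>The first-order Taylor polynomial of the square root of mu - c g in g; strict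
    complementarity makes mu positive. Its square is mu - c g + \<kappa> g^2.\<close>
  define a where "a j = (if j \<in> J then pconst (sqrt (mu j)) - pconst (c / (2 * sqrt (mu j))) * g j else 0)" for j
  define \<kappa> where "\<kappa> j = (c / (2 * sqrt (mu j)))\<^sup>2" for j
  have a2: "(a j)\<^sup>2 * g j = pconst (mu j) * g j - pconst c * (g j * g j) + pconst (\<kappa> j) * (g j * (g j * g j))"
    if j: "j \<in> J" for j
  proof -
    define p1 where "p1 = (pconst (sqrt (mu j)) :: 'n rpoly)"
    define p2 where "p2 = (pconst (c / (2 * sqrt (mu j))) :: 'n rpoly)"
    have "sqrt (mu j) > 0" using mu_pos[OF j] by simp
    then have "p1 * p1 = pconst (mu j)" "p1 * p2 + p1 * p2 = pconst c" "p2 * p2 = pconst (\<kappa> j)"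
      using mu_pos[OF j] unfolding p1_def p2_def \<kappa>_def
      by (simp_all flip: pconst_mult pconst_add add: power2_eq_square field_simps)
    moreover have "(a j)\<^sup>2 * g j = (p1 * p1) * g j - (p1 * p2 + p1 * p2) * (g j * g j) + (p2 * p2) * (g j * (g j * g j))"
      using j by (simp add: a_def p1_def p2_def power2_eq_square algebra_simps)
    ultimately show ?thesis by (simp only:)
  qed
  \<comment> \<open>Cubic in constraints that vanish at u, hence without effect on the Hessian
    there.\<close>
  define R where "R = (\<Sum>j\<in>J. pconst (\<kappa> j) * (g j * (g j * g j)))"
  have "(\<Sum>j=1..m2. (a j)\<^sup>2 * g j) = (\<Sum>j\<in>J. (a j)\<^sup>2 * g j)"
    using J by (intro sum.mono_neutral_right) (auto simp: a_def)
  also have "\<dots> = (\<Sum>j\<in>J. pconst (mu j) * g j) - (\<Sum>j\<in>J. pconst c * (g j * g j)) + R"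
    by (simp add: a2 sum.distrib sum_subtractf R_def)
  finally have sum_g: "(\<Sum>j=1..m2. (a j)\<^sup>2 * g j)
      = (\<Sum>j\<in>J. pconst (mu j) * g j) - (\<Sum>j\<in>J. pconst c * (g j * g j)) + R" .
  have sum_h: "(\<Sum>i=1..m1. \<phi> i * h i)
      = (\<Sum>i=1..m1. pconst (lam i) * h i) - (\<Sum>i=1..m1. pconst c * (h i * h i))"
    by (simp add: \<phi>_def left_diff_distrib sum_subtractf mult.assoc)
  have "f - pconst (peval f u) - ((\<Sum>i=1..m1. \<phi> i * h i) + (\<Sum>j=1..m2. (a j)\<^sup>2 * g j))
      = (quad_expansion u s + pconst c * ((\<Sum>i=1..m1. h i * h i) + (\<Sum>j\<in>J. g j * g j))) + (- R)"
  proof -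
    have "quad_expansion u s = L - pconst (peval f u)" using s(1) by simp
    then show ?thesis unfolding sum_g sum_h L
      by (simp add: distrib_left sum_distrib_left)
  qed
  moreover have "posdef_at u \<dots>"
  proof (rule posdef_at_add_vanish3)
    have "quad_part u (quad_expansion u s) A" unfolding quad_part_def A_def by blast
    moreover have "quad_part u ((\<Sum>i=1..m1. h i * h i) + (\<Sum>j\<in>J. g j * g j)) B"
      unfolding B_def by (intro quad_part_add quad_part_sum quad_part_square h0 g0)
    ultimately have "quad_part u (quad_expansion u s + pconst c * ((\<Sum>i=1..m1. h i * h i) + (\<Sum>j\<in>J. g j * g j)))
        (\<lambda>v. A v + c * B v)"
      by (intro quad_part_add quad_part_pconst_mult)
    then show "posdef_at u (quad_expansion u s + pconst c * ((\<Sum>i=1..m1. h i * h i) + (\<Sum>j\<in>J. g j * g j)))"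
      by (rule posdef_atI) (rule c(2))
    show "vanish3 u (- R)"
      unfolding R_def
      by (intro vanish3_uminus vanish3_sum vanish3_mult_left vanish3_mult vanish2_mult g0)
  qed
  ultimately have "posdef_at u (f - pconst (peval f u)
      - ((\<Sum>i=1..m1. \<phi> i * h i) + (\<Sum>j=1..m2. (a j)\<^sup>2 * g j)))" by (simp only:)
  then show ?thesis by (rule that)
qed

section \<open>From local certificates to membership\<close>

context archimedean_quadratic_module
begin

definition nonneg_set :: "(real ^ 'n) set" where
  "nonneg_set = {x. \<forall>m\<in>M. 0 \<le> peval m x}"

lemma compact_nonneg_set: "compact nonneg_set"
proof -
  have "nonneg_set = (\<Inter>m\<in>M. {x. 0 \<le> peval m x})" by (auto simp: nonneg_set_def)
  also have "closed \<dots>"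
    by (intro closed_INT ballI closed_Collect_le continuous_intros)
  finally have "closed nonneg_set" .
  moreover obtain R where R: "pconst R - (\<Sum>i\<in>UNIV. pvar i ^ 2) \<in> M" using arch by blast
  have "norm x \<le> sqrt R" if "x \<in> nonneg_set" for x
  proof -
    have "(\<Sum>i\<in>UNIV. (x $ i)\<^sup>2) \<le> R"
      using R that by (fastforce simp: nonneg_set_def peval_simps)
    then show ?thesis by (simp add: norm_vec_def L2_set_def)
  qed
  then have "bounded nonneg_set" by (rule boundedI)
  ultimately show ?thesis by (simp add: compact_eq_bounded_closed)
qed

text \<open>Infinitely many zeros would accumulate at a zero u by compactness. Near u, however, F
  exceeds a module element that is nonnegative on \<open>nonneg_set\<close>.\<close>

lemma finite_zeros_if_local_certificate:
  assumes nonneg: "\<And>x. x \<in> nonneg_set \<Longrightarrow> 0 \<le> peval F x"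
    and cert: "\<And>u. u \<in> nonneg_set \<Longrightarrow> peval F u = 0 \<Longrightarrow> \<exists>c\<in>M. posdef_at u (F - c)"
  shows "finite {u \<in> nonneg_set. peval F u = 0}"
proof (rule ccontr)
  let ?Z = "{u \<in> nonneg_set. peval F u = 0}"
  assume inf: "infinite ?Z"
  have "?Z = nonneg_set \<inter> {x. peval F x = 0}" by auto
  moreover have "closed {x. peval F x = 0}"
    by (intro closed_Collect_eq continuous_intros)
  ultimately have "compact ?Z" using compact_nonneg_set by (simp add: compact_Int_closed)
  then obtain u where u: "u \<in> ?Z" "u islimpt ?Z"
    using inf compact_eq_Bolzano_Weierstrass by blast
  obtain c where c: "c \<in> M" "posdef_at u (F - c)" using cert u(1) by blast
  obtain d where d: "d > 0" "\<And>x. dist x u < d \<Longrightarrow> x \<noteq> u \<Longrightarrow> peval (F - c) x > 0"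
    using posdef_at_local_pos[OF c(2)] by blast
  obtain x where x: "x \<in> ?Z" "x \<noteq> u" "dist x u < d"
    using u(2) d(1) unfolding islimpt_approachable by blast
  have "peval F x > peval c x" using d(2)[OF x(3,2)] by (simp add: peval_diff)
  moreover have "peval c x \<ge> 0" using x(1) c(1) by (simp add: nonneg_set_def)
  ultimately show False using x(1) by simp
qed

text \<open>Bumps glue the local certificates into one G in M that has the right second-order part
  at every zero. Since F - G may be negative far from the zeros, G is damped by b^2, where b equals
  1 to second order on Z and is small away from Z.\<close>

theorem in_module_if_local_certificate:
  assumes nonneg: "\<And>x. x \<in> nonneg_set \<Longrightarrow> 0 \<le> peval F x"
    and cert: "\<And>u. u \<in> nonneg_set \<Longrightarrow> peval F u = 0 \<Longrightarrow> \<exists>c\<in>M. posdef_at u (F - c)"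
  shows "F \<in> M"
proof -
  define Z where "Z = {u \<in> nonneg_set. peval F u = 0}"
  have Z: "finite Z" unfolding Z_def by (rule finite_zeros_if_local_certificate[OF assms])
  have "\<exists>c. u \<in> Z \<longrightarrow> c \<in> M \<and> posdef_at u (F - c)" for u using cert by (auto simp: Z_def)
  then obtain c where cM: "\<And>u. u \<in> Z \<Longrightarrow> c u \<in> M" and posdef: "\<And>u. u \<in> Z \<Longrightarrow> posdef_at u (F - c u)"
    by metis
  have c0: "peval (c u) u = 0" if "u \<in> Z" for u
    using vanish2_imp_zero[OF posdef_at_imp_vanish2[OF posdef[OF that]]] that
    by (simp add: Z_def peval_diff)
  have "\<exists>w. vanish2 u (1 - w) \<and> (\<forall>v\<in>Z. v \<noteq> u \<longrightarrow> vanish2 v w)" for u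
    using bump_polynomial_exists[OF Z, of u] by metis
  then obtain w where w1: "\<And>u. vanish2 u (1 - w u)" and w0: "\<And>u v. v \<in> Z \<Longrightarrow> v \<noteq> u \<Longrightarrow> vanish2 v (w u)"
    by metis
  define G where "G = (\<Sum>u\<in>Z. (w u)\<^sup>2 * c u)"
  have GM: "G \<in> M" unfolding G_def by (intro sum square_mult cM)
  \<comment> \<open>Stated for general b because b = 1 first yields the neighbourhoods of the zeros,
    and a high power of 1 - q is used afterwards.\<close>
  have posdef_b: "posdef_at v (F - b\<^sup>2 * G)" if v: "v \<in> Z" and b: "vanish2 v (1 - b)" for b v
  proof -
    \<comment> \<open>At v, the polynomial b^2 G differs from \<open>c v\<close> only by third-order
      terms: \<open>c v\<close> and \<open>1 - V v\<close> combine to order three, and the other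
      bumps enter squared.\<close>
    define V where "V u = (b * w u)\<^sup>2" for u
    have "1 - V v = (1 + b * w v) * ((1 - w v) + w v * (1 - b))"
      by (simp add: V_def power2_eq_square algebra_simps)
    then have V1: "vanish2 v (1 - V v)"
      using w1 b by (simp add: vanish2_mult_left vanish2_add)
    have V0: "vanish3 v (V u)" if u: "u \<in> Z - {v}" for u
    proof -
      have "vanish2 v (w u)" using w0[OF v, of u] u by auto
      then have "vanish3 v (b\<^sup>2 * (w u * w u))"
        by (intro vanish3_mult_left vanish3_mult vanish2_imp_zero)
      then show ?thesis by (simp add: V_def power2_eq_square mult_ac)
    qed
    have "b\<^sup>2 * G = (\<Sum>u\<in>Z. c u * V u)"
      by (simp add: G_def V_def sum_distrib_left power_mult_distrib mult_ac)
    also have "\<dots> = c v * V v + (\<Sum>u\<in>Z - {v}. c u * V u)"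
      by (rule sum.remove[OF Z v])
    finally have "F - b\<^sup>2 * G = (F - c v) + (c v * (1 - V v) + - (\<Sum>u\<in>Z - {v}. c u * V u))"
      by (simp add: algebra_simps)
    also have "posdef_at v \<dots>"
      by (intro posdef_at_add_vanish3 posdef v vanish3_add vanish3_mult c0 V1 vanish3_uminus
          vanish3_sum vanish3_mult_left V0)
    finally show ?thesis .
  qed
  have "\<exists>d. v \<in> Z \<longrightarrow> d > 0 \<and> (\<forall>x. dist x v < d \<longrightarrow> x \<noteq> v \<longrightarrow> peval (F - G) x > 0)" for v
  proof (cases "v \<in> Z")
    case True
    then have "posdef_at v (F - G)" using posdef_b[OF True, of 1] by (simp add: vanish2_0)
    from posdef_at_local_pos[OF this] show ?thesis by metis
  qed simp
  then obtain d where d: "\<And>v. v \<in> Z \<Longrightarrow> d v > 0"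
    "\<And>v x. v \<in> Z \<Longrightarrow> dist x v < d v \<Longrightarrow> x \<noteq> v \<Longrightarrow> peval (F - G) x > 0" by metis
  \<comment> \<open>Inside D, F - G is already positive off the zeros; on the compact remainder S, F
    itself is positive.\<close>
  define D where "D = (\<Union>v\<in>Z. ball v (d v))"
  define S where "S = nonneg_set - D"
  have "open D" by (simp add: D_def open_UN)
  then have "compact S" unfolding S_def by (intro compact_diff compact_nonneg_set)
  have ZD: "Z \<subseteq> D" using d(1) by (force simp: D_def)
  have SF: "peval F x > 0" if "x \<in> S" for x
    using that ZD nonneg[of x] by (force simp: S_def Z_def)
  define \<eta> where "\<eta> = (\<Prod>v\<in>Z. sqdist_poly v)"
  have \<eta>_nonneg: "peval \<eta> x \<ge> 0" for x
    by (simp add: \<eta>_def peval_prod peval_sqdist_poly prod_nonneg)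
  have \<eta>_pos: "peval \<eta> x > 0" if "x \<notin> Z" for x
    unfolding \<eta>_def peval_prod peval_sqdist_poly using that by (intro prod_pos) auto
  obtain E where E: "E > 0" "pconst E - \<eta> \<in> M" using bounded .
  \<comment> \<open>The scaling by E gives 0 \<le> q \<le> 1 on \<open>nonneg_set\<close>, while q
    still vanishes exactly on Z, and to second order.\<close>
  define q where "q = pconst (1 / E) * \<eta>"
  have q01: "0 \<le> peval q x" "peval q x \<le> 1" if "x \<in> nonneg_set" for x
  proof -
    show "0 \<le> peval q x" using E(1) \<eta>_nonneg by (simp add: q_def peval_mult)
    have "0 \<le> peval (pconst E - \<eta>) x" using E(2) that by (simp add: nonneg_set_def)
    then show "peval q x \<le> 1" using E(1) by (simp add: q_def peval_mult peval_diff)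
  qed
  have q2: "vanish2 v q" if "v \<in> Z" for v
    unfolding q_def \<eta>_def by (intro vanish2_mult_left vanish2_prod_sqdist_poly Z that)
  have b2: "vanish2 v (1 - (1 - q) ^ N)" if "v \<in> Z" for v N
  proof (induction N)
    case (Suc N)
    have "1 - (1 - q) ^ Suc N = (1 - (1 - q) ^ N) + (1 - q) ^ N * q" by (simp add: algebra_simps)
    also have "vanish2 v \<dots>" by (intro vanish2_add Suc vanish2_mult_left q2 that)
    finally show ?case .
  qed (simp add: vanish2_0)
  \<comment> \<open>On S the values of 1 - q are bounded by some \<theta> < 1, so a high power
    pushes G below the minimum of F.\<close>
  have "\<exists>N. \<forall>x\<in>S. peval (1 - q) x ^ N * peval G x < peval F x"
  proof (cases "S = {}")
    case False
    have cont: "continuous_on S (peval p)" for p by (rule continuous_on_peval[OF continuous_on_id])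
    obtain x0 where x0: "x0 \<in> S" "\<And>x. x \<in> S \<Longrightarrow> peval F x0 \<le> peval F x"
      using continuous_attains_inf[OF \<open>compact S\<close> False cont] by blast
    obtain x1 where x1: "x1 \<in> S" "\<And>x. x \<in> S \<Longrightarrow> peval (1 - q) x \<le> peval (1 - q) x1"
      using continuous_attains_sup[OF \<open>compact S\<close> False cont] by blast
    obtain B where B: "B > 0" "pconst B - G \<in> M" using bounded .
    define \<theta> where "\<theta> = peval (1 - q) x1"
    have "x1 \<notin> Z" "x1 \<in> nonneg_set" using x1(1) ZD by (auto simp: S_def)
    then have \<theta>: "0 \<le> \<theta>" "\<theta> < 1"
      using q01(2)[of x1] \<eta>_pos[of x1] E(1) by (simp_all add: \<theta>_def peval_simps q_def)
    obtain N where N: "\<theta> ^ N < peval F x0 / B"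
      using real_arch_pow_inv[OF _ \<theta>(2)] SF[OF x0(1)] B(1) by (metis divide_pos_pos)
    have "peval (1 - q) x ^ N * peval G x < peval F x" if x: "x \<in> S" for x
    proof -
      have xn: "x \<in> nonneg_set" using x by (simp add: S_def)
      have q: "0 \<le> peval (1 - q) x" "peval (1 - q) x \<le> \<theta>"
        using q01(2)[OF xn] x1(2)[OF x] by (simp_all add: \<theta>_def peval_diff)
      have G: "0 \<le> peval G x" "peval G x \<le> B"
        using xn GM B(2) by (force simp: nonneg_set_def peval_diff)+
      have "peval (1 - q) x ^ N * peval G x \<le> \<theta> ^ N * B"
        using q G \<theta>(1) by (intro mult_mono power_mono) auto
      also have "\<dots> < peval F x0" using N B(1) by (simp add: pos_less_divide_eq)
      also have "\<dots> \<le> peval F x" by (rule x0(2)[OF x])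
      finally show ?thesis .
    qed
    then show ?thesis by blast
  qed simp
  then obtain N where N: "\<And>x. x \<in> S \<Longrightarrow> peval (1 - q) x ^ N * peval G x < peval F x" by blast
  define b where "b = (1 - q) ^ N"
  have "F - b\<^sup>2 * G \<in> M"
  proof (rule posdef_zeros_in_module[OF Z])
    show "posdef_at u (F - b\<^sup>2 * G)" if "u \<in> Z" for u
      unfolding b_def by (intro posdef_b that b2)
    fix x assume "\<And>m. m \<in> M \<Longrightarrow> 0 \<le> peval m x" and xZ: "x \<notin> Z"
    then have x: "x \<in> nonneg_set" by (simp add: nonneg_set_def)
    have G: "0 \<le> peval G x" using x GM by (simp add: nonneg_set_def)
    have q: "0 \<le> peval (1 - q) x" "peval (1 - q) x \<le> 1" using q01[OF x] by (simp_all add: peval_diff)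
    have b: "0 \<le> peval b x" "peval b x \<le> 1"
      unfolding b_def peval_power using q by (auto intro: power_le_one)
    \<comment> \<open>The bound by 1 is used on D, and the bound by b on S, where N was chosen for b
      rather than b^2.\<close>
    have b_sq: "(peval b x)\<^sup>2 \<le> peval b x" "(peval b x)\<^sup>2 \<le> 1"
      using b by (simp_all add: power2_eq_square mult_left_le power_le_one mult_le_one)
    have "(peval b x)\<^sup>2 * peval G x < peval F x"
    proof (cases "x \<in> D")
      case True
      then obtain v where "v \<in> Z" "dist x v < d v" by (auto simp: D_def dist_commute)
      then have "peval G x < peval F x" using d(2)[of v x] xZ by (auto simp: peval_diff)
      moreover have "(peval b x)\<^sup>2 * peval G x \<le> 1 * peval G x" using b_sq(2) G by (rule mult_right_mono)
      ultimately show ?thesis by simp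
    next
      case False
      then have "peval b x * peval G x < peval F x" using N[of x] x by (simp add: S_def b_def peval_power)
      moreover have "(peval b x)\<^sup>2 * peval G x \<le> peval b x * peval G x" using b_sq(1) G by (rule mult_right_mono)
      ultimately show ?thesis by simp
    qed
    then show "0 < peval (F - b\<^sup>2 * G) x" by (simp add: peval_simps)
  qed
  then have "(F - b\<^sup>2 * G) + b\<^sup>2 * G \<in> M" by (intro add square_mult GM)
  then show ?thesis by simp
qed

end

section \<open>Truncated and full modules of the constraints\<close>

lemma total_deg_le_iff:
  "total_deg p \<le> d \<longleftrightarrow> (\<forall>m\<in>Poly_Mapping.keys p. (\<Sum>i\<in>UNIV. Poly_Mapping.lookup m i) \<le> d)"
  unfolding total_deg_def by (subst Max_le_iff) auto

lemma total_deg_add_le: "total_deg p \<le> d \<Longrightarrow> total_deg q \<le> d \<Longrightarrow> total_deg (p + q) \<le> d"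
  unfolding total_deg_le_iff using Poly_Mapping.keys_add[of p q] by blast

lemma keys_pconst_mult: "Poly_Mapping.keys (pconst c * p) \<subseteq> Poly_Mapping.keys p"
proof -
  have "Poly_Mapping.keys (pconst c) \<subseteq> {0}" by (simp add: pconst_def)
  then show ?thesis using Poly_Mapping.keys_mult[of "pconst c" p] by fastforce
qed

lemma total_deg_pconst_mult_le: "total_deg p \<le> d \<Longrightarrow> total_deg (pconst c * p) \<le> d"
  unfolding total_deg_le_iff using keys_pconst_mult by blast

definition trunc_module :: "nat \<Rightarrow> nat \<Rightarrow> (nat \<Rightarrow> 'n::finite rpoly) \<Rightarrow> nat \<Rightarrow> (nat \<Rightarrow> 'n rpoly) \<Rightarrow> 'n rpoly set" where
  "trunc_module k m1 h m2 g = trunc_ideal (2 * k) m1 h + trunc_qmodule k m2 g"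

definition constraint_module :: "nat \<Rightarrow> (nat \<Rightarrow> 'n::finite rpoly) \<Rightarrow> nat \<Rightarrow> (nat \<Rightarrow> 'n rpoly) \<Rightarrow> 'n rpoly set" where
  "constraint_module m1 h m2 g = (\<Union>k. trunc_module k m1 h m2 g)"

lemma trunc_module_iff:
  "p \<in> trunc_module k m1 h m2 g \<longleftrightarrow> (\<exists>\<phi> \<sigma>.
     p = (\<Sum>i=1..m1. \<phi> i * h i) + (\<Sum>j=0..m2. \<sigma> j * (g(0 := 1)) j) \<and>
     (\<forall>i\<in>{1..m1}. total_deg (\<phi> i * h i) \<le> 2 * k) \<and>
     (\<forall>j\<in>{0..m2}. \<sigma> j \<in> sos \<and> total_deg (\<sigma> j * (g(0 := 1)) j) \<le> 2 * k))"
  unfolding trunc_module_def trunc_ideal_def trunc_qmodule_def set_plus_def by blast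

lemma trunc_module_mono: "k \<le> l \<Longrightarrow> trunc_module k m1 h m2 g \<subseteq> trunc_module l m1 h m2 g"
proof
  fix p assume kl: "k \<le> l" and "p \<in> trunc_module k m1 h m2 g"
  then obtain \<phi> \<sigma> where p: "p = (\<Sum>i=1..m1. \<phi> i * h i) + (\<Sum>j=0..m2. \<sigma> j * (g(0 := 1)) j)"
     "\<forall>i\<in>{1..m1}. total_deg (\<phi> i * h i) \<le> 2 * k"
     "\<forall>j\<in>{0..m2}. \<sigma> j \<in> sos \<and> total_deg (\<sigma> j * (g(0 := 1)) j) \<le> 2 * k"
    unfolding trunc_module_iff by blast
  show "p \<in> trunc_module l m1 h m2 g"
    unfolding trunc_module_iff
  proof (rule exI[of _ \<phi>], rule exI[of _ \<sigma>], intro conjI ballI)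
    show "total_deg (\<phi> i * h i) \<le> 2 * l" if "i \<in> {1..m1}" for i
      using bspec[OF p(2) that] kl by linarith
    fix j assume j: "j \<in> {0..m2}"
    show "\<sigma> j \<in> sos" using p(3) j by blast
    show "total_deg (\<sigma> j * (g(0 := 1)) j) \<le> 2 * l" using bspec[OF p(3) j] kl by linarith
  qed (rule p(1))
qed

lemma trunc_module_add:
  assumes "p \<in> trunc_module k m1 h m2 g" "q \<in> trunc_module k m1 h m2 g"
  shows "p + q \<in> trunc_module k m1 h m2 g"
proof -
  obtain \<phi> \<sigma> where p: "p = (\<Sum>i=1..m1. \<phi> i * h i) + (\<Sum>j=0..m2. \<sigma> j * (g(0 := 1)) j)"
     "\<forall>i\<in>{1..m1}. total_deg (\<phi> i * h i) \<le> 2 * k"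
     "\<forall>j\<in>{0..m2}. \<sigma> j \<in> sos \<and> total_deg (\<sigma> j * (g(0 := 1)) j) \<le> 2 * k"
    using assms(1) unfolding trunc_module_iff by blast
  obtain \<psi> \<tau> where q: "q = (\<Sum>i=1..m1. \<psi> i * h i) + (\<Sum>j=0..m2. \<tau> j * (g(0 := 1)) j)"
     "\<forall>i\<in>{1..m1}. total_deg (\<psi> i * h i) \<le> 2 * k"
     "\<forall>j\<in>{0..m2}. \<tau> j \<in> sos \<and> total_deg (\<tau> j * (g(0 := 1)) j) \<le> 2 * k"
    using assms(2) unfolding trunc_module_iff by blast
  show ?thesis unfolding trunc_module_iff
  proof (rule exI[of _ "\<lambda>i. \<phi> i + \<psi> i"], rule exI[of _ "\<lambda>j. \<sigma> j + \<tau> j"], intro conjI ballI)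
    show "p + q = (\<Sum>i=1..m1. (\<phi> i + \<psi> i) * h i) + (\<Sum>j=0..m2. (\<sigma> j + \<tau> j) * (g(0 := 1)) j)"
      unfolding p(1) q(1) by (simp only: distrib_right sum.distrib add_ac)
  qed (use p q in \<open>simp_all only: distrib_right total_deg_add_le sos_add\<close>)
qed

lemma trunc_module_pconst_mult:
  assumes "p \<in> trunc_module k m1 h m2 g" "c \<ge> 0"
  shows "pconst c * p \<in> trunc_module k m1 h m2 g"
proof -
  obtain \<phi> \<sigma> where p: "p = (\<Sum>i=1..m1. \<phi> i * h i) + (\<Sum>j=0..m2. \<sigma> j * (g(0 := 1)) j)"
     "\<forall>i\<in>{1..m1}. total_deg (\<phi> i * h i) \<le> 2 * k"
     "\<forall>j\<in>{0..m2}. \<sigma> j \<in> sos \<and> total_deg (\<sigma> j * (g(0 := 1)) j) \<le> 2 * k"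
    using assms(1) unfolding trunc_module_iff by blast
  show ?thesis unfolding trunc_module_iff
  proof (rule exI[of _ "\<lambda>i. pconst c * \<phi> i"], rule exI[of _ "\<lambda>j. pconst c * \<sigma> j"], intro conjI ballI)
    show "pconst c * p = (\<Sum>i=1..m1. pconst c * \<phi> i * h i) + (\<Sum>j=0..m2. pconst c * \<sigma> j * (g(0 := 1)) j)"
      unfolding p(1) by (simp only: distrib_left sum_distrib_left mult.assoc)
  qed (use p assms(2) in \<open>simp_all only: mult.assoc total_deg_pconst_mult_le sos_pconst_mult\<close>)
qed

text \<open>Only finitely many summands occur, so some truncation order bounds all their
  degrees.\<close>

lemma constraint_module_iff:
  "p \<in> constraint_module m1 h m2 g \<longleftrightarrow> (\<exists>\<phi> \<sigma>.
     p = (\<Sum>i=1..m1. \<phi> i * h i) + (\<Sum>j=0..m2. \<sigma> j * (g(0 := 1)) j) \<and> (\<forall>j\<in>{0..m2}. \<sigma> j \<in> sos))"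
proof
  assume "p \<in> constraint_module m1 h m2 g"
  then show "\<exists>\<phi> \<sigma>. p = (\<Sum>i=1..m1. \<phi> i * h i) + (\<Sum>j=0..m2. \<sigma> j * (g(0 := 1)) j) \<and> (\<forall>j\<in>{0..m2}. \<sigma> j \<in> sos)"
    unfolding constraint_module_def UN_iff trunc_module_iff by blast
next
  assume "\<exists>\<phi> \<sigma>. p = (\<Sum>i=1..m1. \<phi> i * h i) + (\<Sum>j=0..m2. \<sigma> j * (g(0 := 1)) j) \<and> (\<forall>j\<in>{0..m2}. \<sigma> j \<in> sos)"
  then obtain \<phi> \<sigma> where p: "p = (\<Sum>i=1..m1. \<phi> i * h i) + (\<Sum>j=0..m2. \<sigma> j * (g(0 := 1)) j)"
    "\<forall>j\<in>{0..m2}. \<sigma> j \<in> sos" by blast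
  \<comment> \<open>The sum of all degrees serves as a common bound and also makes sense when there
    are no equality constraints.\<close>
  define k where "k = (\<Sum>i=1..m1. total_deg (\<phi> i * h i)) + (\<Sum>j=0..m2. total_deg (\<sigma> j * (g(0 := 1)) j))"
  have "total_deg (\<phi> i * h i) \<le> 2 * k" if "i \<in> {1..m1}" for i
    using member_le_sum[OF that, of "\<lambda>i. total_deg (\<phi> i * h i)"] by (simp add: k_def)
  moreover have "total_deg (\<sigma> j * (g(0 := 1)) j) \<le> 2 * k" if "j \<in> {0..m2}" for j
    using member_le_sum[OF that, of "\<lambda>j. total_deg (\<sigma> j * (g(0 := 1)) j)"] unfolding k_def by simp
  ultimately have "p \<in> trunc_module k m1 h m2 g"
    unfolding trunc_module_iff using p by blast
  then show "p \<in> constraint_module m1 h m2 g" unfolding constraint_module_def by blast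
qed

text \<open>The multiplier s of the convention \<open>g(0 := 1)\<close> is split off, so that the
  remaining sum uses g itself.\<close>

lemma constraint_moduleI:
  assumes "\<And>j. j \<in> {1..m2} \<Longrightarrow> \<sigma> j \<in> sos" "s \<in> sos"
  shows "(\<Sum>i=1..m1. \<phi> i * h i) + (\<Sum>j=1..m2. \<sigma> j * g j) + s \<in> constraint_module m1 h m2 g"
  unfolding constraint_module_iff
proof (rule exI[of _ \<phi>], rule exI[of _ "\<sigma>(0 := s)"], intro conjI ballI)
  have "(\<Sum>j=0..m2. (\<sigma>(0 := s)) j * (g(0 := 1)) j) = s + (\<Sum>j=Suc 0..m2. (\<sigma>(0 := s)) j * (g(0 := 1)) j)"
    by (simp add: sum.atLeast_Suc_atMost)
  also have "(\<Sum>j=Suc 0..m2. (\<sigma>(0 := s)) j * (g(0 := 1)) j) = (\<Sum>j=1..m2. \<sigma> j * g j)"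
    by (intro sum.cong) auto
  finally show "(\<Sum>i=1..m1. \<phi> i * h i) + (\<Sum>j=1..m2. \<sigma> j * g j) + s
      = (\<Sum>i=1..m1. \<phi> i * h i) + (\<Sum>j=0..m2. (\<sigma>(0 := s)) j * (g(0 := 1)) j)"
    by (simp add: add_ac)
  show "(\<sigma>(0 := s)) j \<in> sos" if "j \<in> {0..m2}" for j
    using assms that by auto
qed

lemma constraint_module_nonneg:
  assumes "p \<in> constraint_module m1 h m2 g" "x \<in> feasible_set m1 h m2 g"
  shows "0 \<le> peval p x"
proof -
  obtain \<phi> \<sigma> where p: "p = (\<Sum>i=1..m1. \<phi> i * h i) + (\<Sum>j=0..m2. \<sigma> j * (g(0 := 1)) j)"
    "\<forall>j\<in>{0..m2}. \<sigma> j \<in> sos" using assms(1) unfolding constraint_module_iff by blast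
  have "(\<Sum>i=1..m1. peval (\<phi> i) x * peval (h i) x) = 0"
    using assms(2) by (intro sum.neutral) (auto simp: feasible_set_def)
  moreover have "0 \<le> (\<Sum>j=0..m2. peval (\<sigma> j) x * peval ((g(0 := 1)) j) x)"
  proof (intro sum_nonneg mult_nonneg_nonneg)
    fix j assume j: "j \<in> {0..m2}"
    show "0 \<le> peval (\<sigma> j) x" using p(2) j peval_sos_nonneg by blast
    show "0 \<le> peval ((g(0 := 1)) j) x" using assms(2) j by (auto simp: feasible_set_def)
  qed
  ultimately show ?thesis unfolding p(1) by (simp only: peval_add peval_sum peval_mult)
qed

lemma constraint_module_archimedean:
  assumes "archimedean m1 h m2 g"
  shows "archimedean_quadratic_module (constraint_module m1 h m2 g)"
proof
  show "1 \<in> constraint_module m1 h m2 g"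
    using constraint_moduleI[where \<sigma> = "\<lambda>_. 0" and s = 1 and \<phi> = "\<lambda>_. 0"] by simp
  show "p + q \<in> constraint_module m1 h m2 g" if pq: "p \<in> constraint_module m1 h m2 g" "q \<in> constraint_module m1 h m2 g" for p q
  proof -
    obtain k l where "p \<in> trunc_module k m1 h m2 g" "q \<in> trunc_module l m1 h m2 g"
      using pq unfolding constraint_module_def by blast
    then have "p + q \<in> trunc_module (max k l) m1 h m2 g"
      using trunc_module_mono[of k "max k l" m1 h m2 g] trunc_module_mono[of l "max k l" m1 h m2 g]
      by (intro trunc_module_add) auto
    then show ?thesis unfolding constraint_module_def by blast
  qed
  show "a\<^sup>2 * p \<in> constraint_module m1 h m2 g" if "p \<in> constraint_module m1 h m2 g" for p a
  proof -
    obtain \<phi> \<sigma> where p: "p = (\<Sum>i=1..m1. \<phi> i * h i) + (\<Sum>j=0..m2. \<sigma> j * (g(0 := 1)) j)"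
      "\<forall>j\<in>{0..m2}. \<sigma> j \<in> sos" using \<open>p \<in> _\<close> unfolding constraint_module_iff by blast
    show ?thesis unfolding constraint_module_iff
    proof (rule exI[of _ "\<lambda>i. a\<^sup>2 * \<phi> i"], rule exI[of _ "\<lambda>j. a\<^sup>2 * \<sigma> j"], intro conjI)
      show "a\<^sup>2 * p = (\<Sum>i=1..m1. a\<^sup>2 * \<phi> i * h i) + (\<Sum>j=0..m2. a\<^sup>2 * \<sigma> j * (g(0 := 1)) j)"
        unfolding p(1) by (simp only: distrib_left sum_distrib_left mult.assoc)
      show "\<forall>j\<in>{0..m2}. a\<^sup>2 * \<sigma> j \<in> sos" using p(2) sos_mult_square by blast
    qed
  qed
  show "\<exists>R. pconst R - (\<Sum>i\<in>UNIV. (pvar i)\<^sup>2) \<in> constraint_module m1 h m2 g"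
    using assms unfolding archimedean_def constraint_module_def trunc_module_def by blast
qed

text \<open>The module contains each \<open>h i\<close> together with its negative, and each
  \<open>g j\<close>.\<close>

lemma feasible_if_module_nonneg:
  fixes h g :: "nat \<Rightarrow> 'a::finite rpoly"
  assumes nonneg: "\<And>p. p \<in> constraint_module m1 h m2 g \<Longrightarrow> 0 \<le> peval p x"
  shows "x \<in> feasible_set m1 h m2 g"
  unfolding feasible_set_def mem_Collect_eq
proof (intro conjI ballI)
  fix i assume i: "i \<in> {1..m1}"
  have "pconst e * h i \<in> constraint_module m1 h m2 g" for e
  proof -
    have "(\<Sum>k=1..m1. (if k = i then pconst e else 0) * h k) = pconst e * h i"
      using i by (subst sum.remove[of _ i]) auto
    then show ?thesis
      using constraint_moduleI[where \<sigma> = "\<lambda>_. 0" and s = 0 and \<phi> = "\<lambda>k. if k = i then pconst e else 0"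
          and h = h and ?m1.0 = m1 and ?m2.0 = m2 and g = g] by simp
  qed
  from nonneg[OF this[of 1]] nonneg[OF this[of "- 1"]]
  show "peval (h i) x = 0" by (simp add: peval_mult)
next
  fix j assume j: "j \<in> {1..m2}"
  have "(\<Sum>k=1..m2. (if k = j then 1 else 0) * g k) = g j"
    using j by (subst sum.remove[of _ j]) auto
  moreover have "(if k = j then 1 else 0 :: 'a rpoly) \<in> sos" for k
    by simp
  from constraint_moduleI[where \<phi> = "\<lambda>_. 0" and h = h and ?m1.0 = m1 and ?m2.0 = m2 and g = g, OF this sos_0]
  have "(\<Sum>k=1..m2. (if k = j then 1 else 0) * g k) \<in> constraint_module m1 h m2 g" by simp
  ultimately have "g j \<in> constraint_module m1 h m2 g" by simp
  then show "0 \<le> peval (g j) x" by (rule nonneg)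
qed

section \<open>Finite convergence of the hierarchy\<close>

theorem theorem1p1:
  fixes f :: "'n::finite rpoly" and h g :: "nat \<Rightarrow> 'n rpoly" and m1 m2 :: nat
  assumes "archimedean m1 h m2 g"
    and "\<And>u. global_minimizer f (feasible_set m1 h m2 g) u \<Longrightarrow>
           constraint_qualification m1 h m2 g u"
    and "\<And>u lam mu. global_minimizer f (feasible_set m1 h m2 g) u \<Longrightarrow>
           lagrange_multipliers f m1 h m2 g u lam mu \<Longrightarrow>
           strict_complementarity m2 g u mu \<and>
           second_order_sufficiency f m1 h m2 g u lam mu"
  shows "\<exists>k. lasserre_value k f m1 h m2 g = f_min f (feasible_set m1 h m2 g)"
proof -
  interpret archimedean_quadratic_module "constraint_module m1 h m2 g" by (rule constraint_module_archimedean[OF assms(1)])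
  let ?K = "feasible_set m1 h m2 g"
  have K: "nonneg_set = ?K"
    using feasible_if_module_nonneg constraint_module_nonneg unfolding nonneg_set_def by blast
  have lasserre: "lasserre_value k f m1 h m2 g
      = (SUP \<gamma>\<in>{\<gamma>. f - pconst \<gamma> \<in> trunc_module k m1 h m2 g}. ereal \<gamma>)" for k
    by (simp add: lasserre_value_def trunc_module_def)
  show ?thesis
  proof (cases "?K = {}")
    case True
    \<comment> \<open>Without feasible points the certificate conditions are vacuous, so the module
      is the whole ring. Adding multiples of -1 to f then makes every natural number an admissible
      bound at one fixed order.\<close>
    have all: "p \<in> constraint_module m1 h m2 g" for p
      by (rule in_module_if_local_certificate) (use K True in auto)
    obtain k l where "f \<in> trunc_module k m1 h m2 g" "- 1 \<in> trunc_module l m1 h m2 g"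
      using all[of f] all[of "- 1"] unfolding constraint_module_def by blast
    then have k: "f \<in> trunc_module (max k l) m1 h m2 g" "- 1 \<in> trunc_module (max k l) m1 h m2 g"
      using trunc_module_mono[of k "max k l" m1 h m2 g] trunc_module_mono[of l "max k l" m1 h m2 g] by auto
    have "f - pconst (real n) \<in> trunc_module (max k l) m1 h m2 g" for n
      using trunc_module_add[OF k(1) trunc_module_pconst_mult[OF k(2), of "real n"]] by simp
    then have "lasserre_value (max k l) f m1 h m2 g = \<infinity>"
      unfolding lasserre by (intro SUP_PInfty) auto
    moreover have "f_min f ?K = \<infinity>" by (simp add: f_min_def True top_ereal_def)
    ultimately show ?thesis by auto
  next
    case False
    have "continuous_on ?K (peval f)" by (rule continuous_on_peval[OF continuous_on_id])
    then obtain u where u: "global_minimizer f ?K u"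
      using continuous_attains_inf[OF _ False] compact_nonneg_set unfolding K global_minimizer_def by blast
    define F where "F = f - pconst (peval f u)"
    have "F \<in> constraint_module m1 h m2 g"
    proof (rule in_module_if_local_certificate)
      show "0 \<le> peval F x" if "x \<in> nonneg_set" for x
        using u that by (simp add: F_def K global_minimizer_def peval_diff)
      fix x assume x: "x \<in> nonneg_set" "peval F x = 0"
      then have fx: "peval f x = peval f u" by (simp add: F_def peval_diff)
      \<comment> \<open>The zeros of F on the feasible set are exactly the global minimizers, where
        the optimality conditions provide the local certificate.\<close>
      have xmin: "global_minimizer f ?K x" using u x(1) fx by (simp add: K global_minimizer_def)
      obtain lam mu where lm: "lagrange_multipliers f m1 h m2 g x lam mu"
        using lagrange_multipliers_exist[OF xmin assms(2)[OF xmin]] .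
      obtain \<phi> a where cert: "posdef_at x (f - pconst (peval f x)
          - ((\<Sum>i=1..m1. \<phi> i * h i) + (\<Sum>j=1..m2. (a j)\<^sup>2 * g j)))"
        using local_certificate_exists[OF _ lm] assms(3)[OF xmin lm] x(1) K by blast
      have "(\<Sum>i=1..m1. \<phi> i * h i) + (\<Sum>j=1..m2. (a j)\<^sup>2 * g j) + 0 \<in> constraint_module m1 h m2 g"
        by (rule constraint_moduleI) auto
      then show "\<exists>c\<in>constraint_module m1 h m2 g. posdef_at x (F - c)"
        using cert unfolding F_def fx by auto
    qed
    then obtain k where k: "f - pconst (peval f u) \<in> trunc_module k m1 h m2 g"
      unfolding constraint_module_def F_def by blast
    have "lasserre_value k f m1 h m2 g = ereal (peval f u)"
      unfolding lasserre
    proof (rule antisym)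
      \<comment> \<open>Weak duality: module elements are nonnegative at the minimizer. The reverse
        inequality holds because the minimum itself is an admissible bound at order k.\<close>
      show "(SUP \<gamma>\<in>{\<gamma>. f - pconst \<gamma> \<in> trunc_module k m1 h m2 g}. ereal \<gamma>) \<le> ereal (peval f u)"
      proof (rule SUP_least)
        fix \<gamma> assume "\<gamma> \<in> {\<gamma>. f - pconst \<gamma> \<in> trunc_module k m1 h m2 g}"
        then have "f - pconst \<gamma> \<in> constraint_module m1 h m2 g" by (auto simp: constraint_module_def)
        then have "0 \<le> peval (f - pconst \<gamma>) u"
          using u by (intro constraint_module_nonneg) (auto simp: global_minimizer_def)
        then show "ereal \<gamma> \<le> ereal (peval f u)" by (simp add: peval_diff)
      qed
      show "ereal (peval f u) \<le> (SUP \<gamma>\<in>{\<gamma>. f - pconst \<gamma> \<in> trunc_module k m1 h m2 g}. ereal \<gamma>)"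
        using k by (intro SUP_upper) auto
    qed
    then show ?thesis using f_min_eq[OF u] by auto
  qed
qed

end
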